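(* Let $m\ge1$ and let $a_1,\dots,a_m$ be nonzero real numbers; let $\mathcal{L}$ be the operator with symbol $\alpha(\xi)=\prod_{i=1}^m(\xi^2+a_i^2)$, i.e. $\mathcal{L}v=\mathcal{F}^{-1}[\alpha(\xi)\,\mathcal{F}v(\xi)]$. Let $f\in C^2(\mathbb{R})$ satisfy: (F1) $f(0)=0$ and $f(r)>0$ for all $r>0$; (F2) there exists $p>1$ such that $r^2f'(r)\ge p\,r f(r)$ for all $r\in\mathbb{R}$; (F3) there exist $2\le q_1\le q_2$ and $C>0$ such that $|f'(r)|\le C(|r|^{q_1-1}+|r|^{q_2-1})$ for all $r\in\mathbb{R}$. Then (a) there exists a positive solution $\varphi\in H^m(\mathbb{R})$ of $\mathcal{L}\varphi=f(\varphi)$; and (b) every positive solution $\varphi\in H^m(\mathbb{R})$ of $\mathcal{L}\varphi=f(\varphi)$ is a translate of an even function, i.e. there is $\lambda\in\mathbb{R}$ such that $\varphi(2\lambda-x)=\varphi(x)$ for all $x\in\mathbb{R}$.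
   Context: Fourier transform convention: $\mathcal{F}g(\xi)=\int_{\mathbb{R}}e^{ix\xi}g(x)\,dx$. "Positive" means $\varphi(x)>0$ for all $x\in\mathbb{R}$. *)

theory Defs
  imports "HOL-Analysis.Analysis"
begin

definition C2_fun :: "(real \<Rightarrow> real) \<Rightarrow> bool" where
  "C2_fun f \<longleftrightarrow>
     (\<forall>x. (f has_real_derivative deriv f x) (at x)) \<and>
     (\<forall>x. (deriv f has_real_derivative deriv (deriv f) x) (at x)) \<and>
     continuous_on UNIV (deriv (deriv f))"

definition test_fun :: "(real \<Rightarrow> real) \<Rightarrow> bool" where
  "test_fun \<psi> \<longleftrightarrow>
     (\<forall>k x. ((deriv ^^ k) \<psi> has_real_derivative (deriv ^^ Suc k) \<psi> x) (at x)) \<and>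
     bounded {x. \<psi> x \<noteq> 0}"

definition L2_fun :: "(real \<Rightarrow> real) \<Rightarrow> bool" where
  "L2_fun u \<longleftrightarrow> u \<in> borel_measurable lborel \<and> integrable lborel (\<lambda>x. (u x)\<^sup>2)"

definition weak_deriv :: "nat \<Rightarrow> (real \<Rightarrow> real) \<Rightarrow> (real \<Rightarrow> real) \<Rightarrow> bool" where
  "weak_deriv k u g \<longleftrightarrow>
     (\<forall>\<psi>. test_fun \<psi> \<longrightarrow>
        (LINT x|lborel. u x * (deriv ^^ k) \<psi> x) = (-1) ^ k * (LINT x|lborel. g x * \<psi> x))"

definition sobolev_H :: "nat \<Rightarrow> (real \<Rightarrow> real) \<Rightarrow> bool" where
  "sobolev_H m u \<longleftrightarrow> L2_fun u \<and> (\<forall>k\<in>{1..m}. \<exists>g. L2_fun g \<and> weak_deriv k u g)"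

definition symbol_alpha :: "real list \<Rightarrow> real \<Rightarrow> real" where
  "symbol_alpha as \<xi> = (\<Prod>a\<leftarrow>as. \<xi>\<^sup>2 + a\<^sup>2)"

text \<open>With F g(xi) = int e^{ix xi} g(x) dx one has F(g'') = -xi^2 F g, so the Fourier
  multiplier xi^2 + a^2 is the differential operator a^2 - d^2/dx^2, and the operator L with
  symbol alpha is the composition of these factors. L_op applies it to (smooth) functions.\<close>
fun L_op :: "real list \<Rightarrow> (real \<Rightarrow> real) \<Rightarrow> (real \<Rightarrow> real)" where
  "L_op [] \<psi> = \<psi>"
| "L_op (a # as) \<psi> = (\<lambda>x. a\<^sup>2 * L_op as \<psi> x - deriv (deriv (L_op as \<psi>)) x)"

text \<open>phi is a positive H^m solution of L phi = f(phi), the equation understood in the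
  distributional sense (L is formally self-adjoint); phi is the continuous representative.\<close>
definition positive_solution :: "real list \<Rightarrow> (real \<Rightarrow> real) \<Rightarrow> (real \<Rightarrow> real) \<Rightarrow> bool" where
  "positive_solution as f \<phi> \<longleftrightarrow>
     continuous_on UNIV \<phi> \<and> (\<forall>x. \<phi> x > 0) \<and> sobolev_H (length as) \<phi> \<and>
     (\<forall>\<psi>. test_fun \<psi> \<longrightarrow>
        (LINT x|lborel. \<phi> x * L_op as \<psi> x) = (LINT x|lborel. f (\<phi> x) * \<psi> x))"

end

theory Submission
  imports Defs "HOL-Complex_Analysis.Great_Picard"
begin

text \<open>
  Let \<open>K\<close> be the convolution of the kernels \<open>exp (- \<bar>a\<bar> \<bar>x\<bar>) / (2 \<bar>a\<bar>)\<close>. It is positive, even, strictly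
  decreasing on the half-line, satisfies \<open>K (x + t) \<ge> exp (- A \<bar>t\<bar>) K x\<close>, and inverts the operator, so
  that positive solutions are the positive \<open>L\<^sup>2\<close> solutions of \<open>\<phi> = K * f(\<phi>)\<close>.

  Symmetry is the method of moving planes for this integral equation, carried out in the sup norm.

  For existence the equation is solved first for even decreasing functions on \<open>(-n, n)\<close>: these are
  discretised, and Brouwer's theorem is applied to the amplitude together with the shape; the
  inequality for \<open>K\<close> bounds the amplitude from both sides uniformly in \<open>n\<close>. The limit \<open>n \<rightarrow> \<infinity>\<close> could be
  the constant solution. This is excluded because \<open>f'(c) > f(c)/c\<close> there: an even decreasing solution
  cannot stay near that constant on a long interval, as is seen by testing its odd part about an
  off-centre point with an odd subsolution of compact support. So the limit decays at infinity.
\<close>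

section \<open>Convolution\<close>

text \<open>One identity takes its place: for \<open>x < c\<close> the difference
  \<open>K (x - y) - K (2 * c - x - y)\<close> is odd in \<open>y\<close> about \<open>c\<close> and
  has a fixed sign on each side. Moving planes, the preservation of symmetric decreasing functions
  and positivity on odd functions are all read off from it. The exponential lower bound for
  \<open>K\<close> plays the part of regularity theory: it passes to every convolution of
  \<open>K\<close> with a nonnegative function and yields Lipschitz bounds, lower bounds and decay.

  Existence meets two obstacles. Superlinearity makes the iteration expansive in the amplitude while
  shapes stay in a compact set, which is why amplitude and shape are treated as separate unknowns.
  And the constant solution is itself even and weakly decreasing, so compactness cannot exclude it.
  Two things do: the cut-off at finite \<open>n\<close> breaks translation invariance, and
  \<open>p > 1\<close> leaves a gap between the linearisation at the constant and the bottom
  \<open>1 / \<integral> K\<close> of the spectrum, wide enough for a comparison on an interval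
  whose length does not depend on \<open>n\<close>.\<close>

definition bdd_meas :: "(real \<Rightarrow> real) \<Rightarrow> bool" where
  "bdd_meas g \<longleftrightarrow> g \<in> borel_measurable borel \<and> (\<exists>B. \<forall>x. \<bar>g x\<bar> \<le> B)"

definition conv :: "(real \<Rightarrow> real) \<Rightarrow> (real \<Rightarrow> real) \<Rightarrow> real \<Rightarrow> real" where
  "conv K g x = (LINT y|lborel. K (x - y) * g y)"

lemma bdd_meas_measurable [measurable_dest]: "bdd_meas g \<Longrightarrow> g \<in> borel_measurable borel"
  by (simp add: bdd_meas_def)

lemma bdd_meas_bound:
  assumes "bdd_meas g" obtains B where "B > 0" "\<And>x. \<bar>g x\<bar> \<le> B"
proof -
  obtain B where B: "\<And>x. \<bar>g x\<bar> \<le> B" using assms by (auto simp: bdd_meas_def)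
  have "\<bar>g x\<bar> \<le> \<bar>B\<bar> + 1" for x using B[of x] by linarith
  then show ?thesis by (intro that[of "\<bar>B\<bar> + 1"]) auto
qed

lemma bdd_measI: "g \<in> borel_measurable borel \<Longrightarrow> (\<And>x. \<bar>g x\<bar> \<le> B) \<Longrightarrow> bdd_meas g"
  by (auto simp: bdd_meas_def)

lemma bdd_meas_const [simp]: "bdd_meas (\<lambda>_. c)"
  by (rule bdd_measI[where B = "\<bar>c\<bar>"]) auto

lemma bdd_meas_reflect:
  assumes "bdd_meas g" shows "bdd_meas (\<lambda>y. g (c - y))"
proof -
  obtain B where "B > 0" "\<And>x. \<bar>g x\<bar> \<le> B" using assms by (rule bdd_meas_bound) blast
  moreover have [measurable]: "g \<in> borel_measurable borel" using assms by (rule bdd_meas_measurable)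
  ultimately show ?thesis by (intro bdd_measI[where B = B]) auto
qed

lemma bdd_meas_mult:
  assumes "bdd_meas g" "bdd_meas h" shows "bdd_meas (\<lambda>y. g y * h y)"
proof -
  obtain B where B: "B > 0" "\<And>x. \<bar>g x\<bar> \<le> B" using assms(1) by (rule bdd_meas_bound) blast
  obtain B' where B': "B' > 0" "\<And>x. \<bar>h x\<bar> \<le> B'" using assms(2) by (rule bdd_meas_bound) blast
  show ?thesis
    using assms B B' by (intro bdd_measI[where B = "B * B'"]) (auto simp: abs_mult intro!: mult_mono dest: bdd_meas_measurable)
qed

lemma bdd_meas_diff:
  assumes "bdd_meas g" "bdd_meas h" shows "bdd_meas (\<lambda>y. g y - h y)"
proof -
  obtain B where B: "B > 0" "\<And>x. \<bar>g x\<bar> \<le> B" using assms(1) by (rule bdd_meas_bound) blast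
  obtain B' where B': "B' > 0" "\<And>x. \<bar>h x\<bar> \<le> B'" using assms(2) by (rule bdd_meas_bound) blast
  have "\<bar>g x - h x\<bar> \<le> B + B'" for x using B(2)[of x] B'(2)[of x] by linarith
  then show ?thesis
    using assms by (intro bdd_measI[where B = "B + B'"]) (auto dest: bdd_meas_measurable)
qed

lemma lborel_integral_reflect: "(LINT y|lborel. g (c - y)) = (LINT y::real|lborel. (g y :: real))"
  using lborel_integral_real_affine[of "-1" g c] by simp

lemma lborel_integral_shift: "(LINT y|lborel. g (y - c)) = (LINT y::real|lborel. (g y :: real))"
  using lborel_integral_real_affine[of "1" g "-c"] by (simp add: algebra_simps)

lemma lborel_integrable_reflect: "integrable lborel g \<Longrightarrow> integrable lborel (\<lambda>y::real. g (c - y) :: real)"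
  using lborel_integrable_real_affine[of g "-1" c] by simp

lemma lborel_integrable_shift: "integrable lborel g \<Longrightarrow> integrable lborel (\<lambda>y::real. g (y - c) :: real)"
  using lborel_integrable_real_affine[of g "1" "-c"] by (simp add: algebra_simps)

lemma integrable_mult_bdd_meas:
  assumes "integrable lborel K" "bdd_meas g"
  shows "integrable lborel (\<lambda>y. K y * g y)"
proof -
  obtain B where "B > 0" "\<And>x. \<bar>g x\<bar> \<le> B" using assms(2) by (rule bdd_meas_bound) blast
  then have *: "\<bar>K y * g y\<bar> \<le> \<bar>B * K y\<bar>" for y
    by (simp add: abs_mult mult.commute[of B] mult_left_mono)
  have m: "(\<lambda>y. K y * g y) \<in> borel_measurable lborel"
    using assms by (auto dest: bdd_meas_measurable)
  show ?thesis
  proof (rule Bochner_Integration.integrable_bound)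
    show "integrable lborel (\<lambda>y. B * K y)" using assms(1) by simp
    show "AE y in lborel. norm (K y * g y) \<le> norm (B * K y)"
      unfolding real_norm_def using * by (rule AE_I2)
  qed (rule m)
qed

lemma integrable_conv:
  assumes "integrable lborel K" "bdd_meas g"
  shows "integrable lborel (\<lambda>y. K (x - y) * g y)"
  using integrable_mult_bdd_meas[OF lborel_integrable_reflect[OF assms(1)] assms(2)] .

lemma conv_altdef: "conv K g x = (LINT y|lborel. K y * g (x - y))"
  unfolding conv_def using lborel_integral_reflect[of "\<lambda>y. K y * g (x - y)" x] by simp

lemma conv_commute: "conv K g = conv g K"
  by (rule ext, subst conv_altdef) (simp add: conv_def mult.commute)

lemma conv_measurable [measurable]:
  assumes "K \<in> borel_measurable borel" "g \<in> borel_measurable borel"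
  shows "conv K g \<in> borel_measurable borel"
proof -
  note [measurable] = assms
  have "(\<lambda>x. LINT y|lborel. K (x - y) * g y) \<in> borel_measurable lborel"
    by (intro lborel.borel_measurable_lebesgue_integral) measurable
  then show ?thesis unfolding conv_def[abs_def] by simp
qed

lemma conv_abs_le:
  assumes "integrable lborel K" "g \<in> borel_measurable borel" "\<And>x. \<bar>g x\<bar> \<le> B"
  shows "\<bar>conv K g x\<bar> \<le> B * (LINT y|lborel. \<bar>K y\<bar>)"
proof -
  have b: "bdd_meas g" using assms by (auto simp: bdd_meas_def)
  have "\<bar>conv K g x\<bar> \<le> (LINT y|lborel. \<bar>K y * g (x - y)\<bar>)"
    unfolding conv_altdef by (rule integral_abs_bound)
  also have "\<dots> \<le> (LINT y|lborel. B * \<bar>K y\<bar>)"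
    using assms integrable_mult_bdd_meas[OF assms(1) bdd_meas_reflect[OF b]]
    by (intro integral_mono integrable_abs) (auto simp: abs_mult mult.commute[of B] mult_left_mono)
  finally show ?thesis by simp
qed

lemma bdd_meas_conv:
  assumes "integrable lborel K" "bdd_meas g" shows "bdd_meas (conv K g)"
proof -
  obtain B where "B > 0" "\<And>x. \<bar>g x\<bar> \<le> B" using assms(2) by (rule bdd_meas_bound) blast
  then show ?thesis
    using conv_abs_le[OF assms(1), of g B] assms
    by (intro bdd_measI[where B = "B * (LINT y|lborel. \<bar>K y\<bar>)"]) (auto dest: bdd_meas_measurable)
qed

lemma conv_diff:
  assumes "integrable lborel K" "bdd_meas g" "bdd_meas h"
  shows "conv K (\<lambda>y. g y - h y) x = conv K g x - conv K h x"
  using integrable_conv[OF assms(1,2)] integrable_conv[OF assms(1,3)]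
  by (simp add: conv_def right_diff_distrib)

lemma conv_add:
  assumes "integrable lborel K" "bdd_meas g" "bdd_meas h"
  shows "conv K (\<lambda>y. g y + h y) x = conv K g x + conv K h x"
  using integrable_conv[OF assms(1,2)] integrable_conv[OF assms(1,3)]
  by (simp add: conv_def distrib_left)

lemma conv_cmult: "conv K (\<lambda>y. c * g y) x = c * conv K g x"
  by (simp add: conv_def mult.left_commute)

lemma conv_cmult_left: "conv (\<lambda>y. c * K y) g x = c * conv K g x"
  by (simp add: conv_def mult.assoc)

lemma conv_add_left:
  assumes "integrable lborel K" "integrable lborel L" "bdd_meas g"
  shows "conv (\<lambda>y. K y + L y) g x = conv K g x + conv L g x"
  using integrable_conv[OF assms(1,3)] integrable_conv[OF assms(2,3)]
  by (simp add: conv_def distrib_right)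

lemma conv_mono:
  assumes "integrable lborel K" "\<And>y. K y \<ge> 0" "bdd_meas g" "bdd_meas h" "\<And>y. g y \<le> h y"
  shows "conv K g x \<le> conv K h x"
  unfolding conv_def using assms by (intro integral_mono integrable_conv mult_left_mono)

lemma conv_const: "conv K (\<lambda>_. c) x = c * (LINT y|lborel. K y)"
  by (simp add: conv_altdef mult.commute)

section \<open>Adjoint, associativity and integrability of convolutions by Fubini\<close>

lemma integrable_conv_kernel_prod:
  assumes "integrable lborel \<psi>" "integrable lborel K" "bdd_meas g"
  shows "integrable (lborel \<Otimes>\<^sub>M lborel) (\<lambda>(x, y). \<psi> x * (K (x - y) * g y))"
proof (rule lborel_pair.Fubini_integrable)
  note [measurable] = bdd_meas_measurable[OF assms(3)] borel_measurable_integrable[OF assms(1)]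
    borel_measurable_integrable[OF assms(2)]
  show "(\<lambda>(x, y). \<psi> x * (K (x - y) * g y)) \<in> borel_measurable (lborel \<Otimes>\<^sub>M lborel)"
    by measurable
  have *: "(LINT y|lborel. norm (case (x, y) of (x, y) \<Rightarrow> \<psi> x * (K (x - y) * g y)))
      = \<bar>\<psi> x\<bar> * conv (\<lambda>x. \<bar>K x\<bar>) (\<lambda>y. \<bar>g y\<bar>) x" for x
    by (simp add: abs_mult conv_def)
  have b: "bdd_meas (\<lambda>y. \<bar>g y\<bar>)" using assms(3) by (auto simp: bdd_meas_def)
  show "integrable lborel (\<lambda>x. LINT y|lborel. norm (case (x, y) of (x, y) \<Rightarrow> \<psi> x * (K (x - y) * g y)))"
    unfolding * using assms b by (intro integrable_mult_bdd_meas bdd_meas_conv) auto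
  show "AE x in lborel. integrable lborel (\<lambda>y. case (x, y) of (x, y) \<Rightarrow> \<psi> x * (K (x - y) * g y))"
    using integrable_conv[OF assms(2,3)] by simp
qed

text \<open>The adjoint of convolution by \<open>K\<close> is convolution by the reflected kernel.
  Besides associativity this drives the weak derivatives in \<open>sobolev_conv_kern\<close> and the
  testing argument in \<open>decay_at_fixed_distance\<close>.\<close>

lemma integral_conv_swap:
  assumes "integrable lborel \<psi>" "integrable lborel K" "bdd_meas g"
  shows "(LINT x|lborel. \<psi> x * conv K g x) = (LINT y|lborel. g y * conv (\<lambda>x. K (- x)) \<psi> y)"
proof -
  have "(LINT x|lborel. \<psi> x * conv K g x) = (LINT x|lborel. LINT y|lborel. \<psi> x * (K (x - y) * g y))"
    by (simp add: conv_def)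
  also have "\<dots> = (LINT y|lborel. LINT x|lborel. \<psi> x * (K (x - y) * g y))"
    using lborel_pair.Fubini_integral[OF integrable_conv_kernel_prod[OF assms]] by simp
  also have "\<dots> = (LINT y|lborel. LINT x|lborel. g y * (K (x - y) * \<psi> x))"
    by (simp add: algebra_simps)
  also have "\<dots> = (LINT y|lborel. g y * conv (\<lambda>x. K (- x)) \<psi> y)"
    by (simp add: conv_def)
  finally show ?thesis .
qed

lemma integral_conv_swap_even:
  assumes "integrable lborel \<psi>" "integrable lborel K" "bdd_meas g" "\<And>x. K (- x) = K x"
  shows "(LINT x|lborel. \<psi> x * conv K g x) = (LINT y|lborel. g y * conv K \<psi> y)"
  using integral_conv_swap[OF assms(1-3)] assms(4) by simp

text \<open>A convolution at \<open>x\<close> is a pairing with \<open>K (x - y)\<close>, so the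
  adjoint identity with this test function moves \<open>L\<close> onto \<open>K\<close>; a shift of
  the variable then produces \<open>conv K L\<close>.\<close>

lemma conv_assoc:
  assumes "integrable lborel K" "integrable lborel L" "bdd_meas g"
  shows "conv K (conv L g) x = conv (conv K L) g x"
proof -
  have "conv K (conv L g) x = (LINT y|lborel. g y * conv (\<lambda>x. L (- x)) (\<lambda>y. K (x - y)) y)"
    using integral_conv_swap[OF lborel_integrable_reflect[OF assms(1)] assms(2,3)] by (simp add: conv_def)
  moreover have "conv (\<lambda>x. L (- x)) (\<lambda>y. K (x - y)) y = conv K L (x - y)" for y
    using lborel_integral_shift[of "\<lambda>z. K (x - y - z) * L z" y]
    by (simp add: conv_def algebra_simps)
  ultimately show ?thesis unfolding conv_def[of "conv K L"] by (simp add: mult.commute)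
qed

lemma integrable_conv_conv:
  assumes "integrable lborel K" "integrable lborel L" "bdd_meas L"
  shows "integrable lborel (conv K L)"
proof -
  note [measurable] = bdd_meas_measurable[OF assms(3)] borel_measurable_integrable[OF assms(1)]
  have "integrable (lborel \<Otimes>\<^sub>M lborel) (\<lambda>(y, x). K (x - y) * L y)"
  proof (rule lborel_pair.Fubini_integrable)
    show "(\<lambda>(y, x). K (x - y) * L y) \<in> borel_measurable (lborel \<Otimes>\<^sub>M lborel)"
      by measurable
    have "(LINT x|lborel. norm (case (y, x) of (y, x) \<Rightarrow> K (x - y) * L y))
        = (LINT x|lborel. \<bar>K x\<bar>) * \<bar>L y\<bar>" for y
      using lborel_integral_shift[of "\<lambda>x. \<bar>K x\<bar>" y] by (simp add: abs_mult)
    then show "integrable lborel (\<lambda>y. LINT x|lborel. norm (case (y, x) of (y, x) \<Rightarrow> K (x - y) * L y))"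
      using assms(2) by simp
    show "AE y in lborel. integrable lborel (\<lambda>x. case (y, x) of (y, x) \<Rightarrow> K (x - y) * L y)"
      using lborel_integrable_shift[OF assms(1)] by simp
  qed
  from lborel_pair.integrable_snd[OF this] show ?thesis unfolding conv_def[abs_def] by simp
qed

section \<open>Reflections and symmetric decreasing functions\<close>

lemma conv_eq_reflect:
  assumes "\<And>x. K (- x) = K x"
  shows "conv K g (c - x) = conv K (\<lambda>y. g (c - y)) x"
proof -
  have "K (c - x - (c - y)) = K (x - y)" for y
    using assms[of "x - y"] by (simp add: algebra_simps)
  then show ?thesis
    using lborel_integral_reflect[of "\<lambda>y. K (c - x - y) * g y" c] by (simp add: conv_def)
qed

text \<open>The kernel difference \<open>D\<close> changes sign under
  \<open>y \<mapsto> 2 * c - y\<close>, so averaging the integral with its reflected form leaves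
  only the part of \<open>g\<close> that is odd about \<open>c\<close>. The integrand becomes a
  product of two functions odd about \<open>c\<close>, whose sign has to be known on one side
  only.\<close>

lemma conv_reflect_identity:
  assumes K: "integrable lborel K" and even: "\<And>x. K (- x) = K x" and g: "bdd_meas g"
  shows "conv K g x - conv K g (2 * c - x)
    = (LINT y|lborel. (K (x - y) - K (2 * c - x - y)) * (g y - g (2 * c - y))) / 2"
    and "integrable lborel (\<lambda>y. (K (x - y) - K (2 * c - x - y)) * (g y - g (2 * c - y)))"
proof -
  define D where "D y = K (x - y) - K (2 * c - x - y)" for y
  have Dr: "D (2 * c - y) = - D y" for y
    using even[of "x - y"] even[of "x - 2 * c + y"] by (simp add: D_def algebra_simps)
  have D: "integrable lborel D"
    unfolding D_def[abs_def] using lborel_integrable_reflect[OF K] by auto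
  have I: "integrable lborel (\<lambda>y. D y * g y)" "integrable lborel (\<lambda>y. D y * g (2 * c - y))"
    using integrable_mult_bdd_meas[OF D] g bdd_meas_reflect[OF g] by auto
  have 1: "conv K g x - conv K g (2 * c - x) = (LINT y|lborel. D y * g y)"
    using integrable_conv[OF K g] by (simp add: D_def conv_def left_diff_distrib)
  have "(LINT y|lborel. D y * g y) = (LINT y|lborel. D (2 * c - y) * g (2 * c - y))"
    by (rule lborel_integral_reflect[symmetric])
  also have "\<dots> = - (LINT y|lborel. D y * g (2 * c - y))"
    by (simp add: Dr)
  finally have 2: "2 * (LINT y|lborel. D y * g y) = (LINT y|lborel. D y * (g y - g (2 * c - y)))"
    using I by (simp add: right_diff_distrib)
  show "conv K g x - conv K g (2 * c - x)
    = (LINT y|lborel. (K (x - y) - K (2 * c - x - y)) * (g y - g (2 * c - y))) / 2"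
    using 1 2 by (simp add: D_def)
  show "integrable lborel (\<lambda>y. (K (x - y) - K (2 * c - x - y)) * (g y - g (2 * c - y)))"
    using I by (simp add: D_def[symmetric] right_diff_distrib)
qed

lemma even_antimono_reflect:
  fixes g :: "real \<Rightarrow> real"
  assumes "\<And>x. g (- x) = g x" "\<And>x y. 0 \<le> x \<Longrightarrow> x \<le> y \<Longrightarrow> g y \<le> g x" "\<bar>x\<bar> \<le> \<bar>y\<bar>"
  shows "g y \<le> g x"
proof -
  have "g x = g \<bar>x\<bar>" "g y = g \<bar>y\<bar>" using assms(1)[of x] assms(1)[of y] by (auto simp: abs_if)
  then show ?thesis using assms(2)[of "\<bar>x\<bar>" "\<bar>y\<bar>"] assms(3) by simp
qed

text \<open>Reflect about the midpoint \<open>c\<close> of \<open>x\<close> and \<open>y\<close>.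
  For \<open>z \<le> c\<close> the reflected point is farther from 0, because
  \<open>c \<ge> 0\<close>, and farther from \<open>x\<close>, so both factors of the reflection
  identity have the same sign. Weak monotonicity is assumed because the indicator of an interval
  also serves as a kernel later.\<close>

lemma conv_even_antimono:
  assumes K: "integrable lborel K" "\<And>x. K (- x) = K x" "\<And>x y. 0 \<le> x \<Longrightarrow> x \<le> y \<Longrightarrow> K y \<le> K x"
    and g: "bdd_meas g" "\<And>x. g (- x) = g x" "\<And>x y. 0 \<le> x \<Longrightarrow> x \<le> y \<Longrightarrow> g y \<le> g x"
    and xy: "0 \<le> x" "x \<le> y"
  shows "conv K g y \<le> conv K g x"
proof -
  define c where "c = (x + y) / 2"
  have y: "y = 2 * c - x" and c: "x \<le> c" "0 \<le> c" using xy by (auto simp: c_def field_simps)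
  have "0 \<le> (K (x - z) - K (2 * c - x - z)) * (g z - g (2 * c - z))" for z
  proof (cases "z \<le> c")
    case True
    then have "K (2 * c - x - z) \<le> K (x - z)" "g (2 * c - z) \<le> g z"
      using c by (intro even_antimono_reflect[of K, OF K(2,3)] even_antimono_reflect[of g, OF g(2,3)]; auto)+
    then show ?thesis by simp
  next
    case False
    then have "K (x - z) \<le> K (2 * c - x - z)" "g z \<le> g (2 * c - z)"
      using c by (intro even_antimono_reflect[of K, OF K(2,3)] even_antimono_reflect[of g, OF g(2,3)]; auto)+
    then show ?thesis by (simp add: mult_nonpos_nonpos)
  qed
  then have "0 \<le> conv K g x - conv K g (2 * c - x)"
    unfolding conv_reflect_identity(1)[OF K(1,2) g(1)] by simp
  then show ?thesis using y by simp
qed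

lemma conv_even: "(\<And>x. K (- x) = K x) \<Longrightarrow> (\<And>x. g (- x) = g x) \<Longrightarrow> conv K g (- x) = conv K g x"
  using conv_eq_reflect[of K g 0 x] by simp

lemma integral_pos_real:
  fixes g :: "real \<Rightarrow> real"
  assumes "integrable lborel g" "\<And>x. g x \<ge> 0" "a < b" "\<And>x. a < x \<Longrightarrow> x < b \<Longrightarrow> g x > 0"
  shows "(LINT x|lborel. g x) > 0"
proof (rule ccontr)
  assume "\<not> ?thesis"
  moreover have "(LINT x|lborel. g x) \<ge> 0" using assms(2) by simp
  ultimately have "(LINT x|lborel. g x) = 0" by simp
  then have "AE x in lborel. g x = 0"
    using integral_nonneg_eq_0_iff_AE[OF assms(1)] assms(2) by simp
  then have "AE x in lborel. x \<notin> {a<..<b}"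
    by eventually_elim (use assms(4) in force)
  then have "{a<..<b} \<in> null_sets lborel"
    using AE_iff_null_sets[of "{a<..<b}" lborel] by simp
  then show False using \<open>a < b\<close> by (simp add: null_sets_def)
qed

section \<open>The kernel of a second-order factor\<close>

text \<open>For \<open>a > 0\<close>, \<open>rker a\<close> and \<open>lker a\<close> are the
  Green's functions of \<open>a + d/dx\<close> and \<open>a - d/dx\<close>. The value at the jump is
  arbitrary.\<close>

definition rker :: "real \<Rightarrow> real \<Rightarrow> real" where
  "rker a z = (if z > 0 then exp (- a * z) else 0)"

definition lker :: "real \<Rightarrow> real \<Rightarrow> real" where
  "lker a z = rker a (- z)"

text \<open>This is the derivative of \<open>exp_kernel a\<close> away from 0.\<close>

definition dker :: "real \<Rightarrow> real \<Rightarrow> real" where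
  "dker a z = (if z < 0 then exp (\<bar>a\<bar> * z) / 2 else if z > 0 then - exp (- \<bar>a\<bar> * z) / 2 else 0)"

definition exp_kernel :: "real \<Rightarrow> real \<Rightarrow> real" where
  "exp_kernel a x = exp (- \<bar>a\<bar> * \<bar>x\<bar>) / (2 * \<bar>a\<bar>)"

lemma rker_measurable [measurable]: "rker a \<in> borel_measurable borel"
  unfolding rker_def[abs_def] by measurable

lemma integrable_rker:
  assumes "a > 0" shows "integrable lborel (rker a)"
proof -
  have "(\<integral>\<^sup>+x. ennreal (exp (- a * x)) * indicator {0..} x \<partial>lborel) = ennreal (0 - (- exp (- a * 0) / a))"
  proof (rule nn_integral_FTC_atLeast)
    show "((\<lambda>x. - exp (- a * x) / a) has_real_derivative exp (- a * x)) (at x)" for x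
      using assms by (auto intro!: derivative_eq_intros)
    have "((\<lambda>x. exp (- a * x)) \<longlongrightarrow> 0) at_top"
      using assms by (intro filterlim_compose[OF exp_at_bot] filterlim_tendsto_neg_mult_at_bot[OF tendsto_const])
        (auto simp: filterlim_ident)
    then show "((\<lambda>x. - exp (- a * x) / a) \<longlongrightarrow> 0) at_top"
      using tendsto_divide[OF tendsto_minus tendsto_const, of "\<lambda>x. exp (- a * x)" 0 at_top a] assms by simp
  qed auto
  then have *: "(\<integral>\<^sup>+x. ennreal (exp (- a * x)) * indicator {0..} x \<partial>lborel) < \<infinity>"
    by simp
  have "(\<integral>\<^sup>+x. ennreal (norm (rker a x)) \<partial>lborel) \<le> (\<integral>\<^sup>+x. ennreal (exp (- a * x)) * indicator {0..} x \<partial>lborel)"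
    by (intro nn_integral_mono) (auto simp: rker_def indicator_def)
  then show ?thesis
    using * by (intro integrableI_bounded) auto
qed

lemma integrable_lker: "a > 0 \<Longrightarrow> integrable lborel (lker a)"
  using lborel_integrable_reflect[OF integrable_rker, of a 0] by (simp add: lker_def[abs_def])

lemma dker_eq: "dker a = (\<lambda>z. 1 / 2 * lker \<bar>a\<bar> z + (- 1 / 2) * rker \<bar>a\<bar> z)"
  by (auto simp: dker_def lker_def rker_def)

lemma integrable_dker: "a \<noteq> 0 \<Longrightarrow> integrable lborel (dker a)"
  unfolding dker_eq using integrable_lker[of "\<bar>a\<bar>"] integrable_rker[of "\<bar>a\<bar>"] by auto

lemma bdd_meas_dker: "bdd_meas (dker a)"
proof (rule bdd_measI[where B = 1])
  show "dker a \<in> borel_measurable borel" unfolding dker_def[abs_def] by measurable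
  show "\<bar>dker a x\<bar> \<le> 1" for x
    by (cases "x < 0") (auto simp: dker_def mult_nonneg_nonpos intro: order_trans[of _ 1])
qed

lemma bdd_meas_continuous:
  assumes "continuous_on UNIV g" "\<And>x. \<bar>g x\<bar> \<le> B" shows "bdd_meas g"
  using assms by (intro bdd_measI[where B = B] borel_measurable_continuous_onI)

text \<open>The integrand \<open>exp (- a * z) * (a * w + w') (x - z)\<close> is the exact
  \<open>z\<close>-derivative of \<open>- exp (- a * z) * w (x - z)\<close>, and boundedness of
  \<open>w\<close> kills the boundary term at infinity.\<close>

lemma conv_rker:
  assumes a: "a > 0" and w: "\<And>x. (w has_real_derivative w' x) (at x)" "continuous_on UNIV w'"
    and b: "\<And>x. \<bar>w x\<bar> \<le> B" "\<And>x. \<bar>w' x\<bar> \<le> B"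
  shows "conv (rker a) (\<lambda>y. a * w y + w' y) x = w x"
proof -
  define g where "g y = a * w y + w' y" for y
  have wc: "continuous_on UNIV w"
    using w(1) by (meson DERIV_continuous continuous_at_imp_continuous_on)
  have gc: "continuous_on UNIV g"
    unfolding g_def[abs_def] by (intro continuous_intros wc w(2))
  have gb: "\<bar>g y\<bar> \<le> a * B + B" for y
  proof -
    have "\<bar>g y\<bar> \<le> \<bar>a * w y\<bar> + \<bar>w' y\<bar>" unfolding g_def by (rule abs_triangle_ineq)
    also have "\<bar>a * w y\<bar> \<le> a * B" using a b(1)[of y] by (simp add: abs_mult)
    finally show ?thesis using b(2)[of y] by linarith
  qed
  have g: "bdd_meas g" by (rule bdd_meas_continuous[OF gc gb])
  have int: "integrable lborel (\<lambda>z. rker a z * g (x - z))"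
    by (rule integrable_mult_bdd_meas[OF integrable_rker[OF a] bdd_meas_reflect[OF g]])
  have ind: "rker a z * g (x - z) = indicator (einterval 0 \<infinity>) z *\<^sub>R (exp (- a * z) * g (x - z))" for z
    by (auto simp: rker_def indicator_def einterval_iff)
  have "conv (rker a) g x = (LBINT z=0..\<infinity>. exp (- a * z) * g (x - z))"
    by (simp add: conv_altdef ind interval_lebesgue_integral_def set_lebesgue_integral_def)
  also have "\<dots> = 0 - (- w x)"
  proof (rule interval_integral_FTC_integrable)
    show "((\<lambda>z. - exp (- a * z) * w (x - z)) has_vector_derivative exp (- a * z) * g (x - z)) (at z)" for z
      unfolding has_real_derivative_iff_has_vector_derivative[symmetric] g_def
      by (auto intro!: derivative_eq_intros DERIV_chain2[OF w(1)] simp: algebra_simps)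
    have "continuous_on UNIV (\<lambda>z. exp (- a * z) * g (x - z))"
      by (intro continuous_intros continuous_on_compose2[OF gc]) auto
    then show "isCont (\<lambda>z. exp (- a * z) * g (x - z)) z" for z
      by (simp add: continuous_on_eq_continuous_at)
    show "set_integrable lborel (einterval 0 \<infinity>) (\<lambda>z. exp (- a * z) * g (x - z))"
      using int unfolding ind set_integrable_def .
    have "continuous_on UNIV (\<lambda>z. - exp (- a * z) * w (x - z))"
      by (intro continuous_intros continuous_on_compose2[OF wc]) auto
    then have "isCont (\<lambda>z. - exp (- a * z) * w (x - z)) 0"
      by (simp add: continuous_on_eq_continuous_at)
    then have "((\<lambda>z. - exp (- a * z) * w (x - z)) \<longlongrightarrow> - w x) (at_right 0)"
      by (auto simp: isCont_def intro: filterlim_mono[OF _ order_refl] at_le)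
    then show "(((\<lambda>z. - exp (- a * z) * w (x - z)) \<circ> real_of_ereal) \<longlongrightarrow> - w x) (at_right 0)"
      using ereal_tendsto_simps(1,2)
      by (simp add: ereal_tendsto_simps zero_ereal_def)
    have "((\<lambda>x. exp (- a * x)) \<longlongrightarrow> 0) at_top"
      using a by (intro filterlim_compose[OF exp_at_bot] filterlim_tendsto_neg_mult_at_bot[OF tendsto_const])
        (auto simp: filterlim_ident)
    then have "((\<lambda>z. B * exp (- a * z)) \<longlongrightarrow> 0) at_top"
      by (rule tendsto_mult_right_zero)
    then have "((\<lambda>z. - exp (- a * z) * w (x - z)) \<longlongrightarrow> 0) at_top"
    proof (rule Lim_null_comparison[rotated], intro always_eventually allI)
      fix z show "norm (- exp (- a * z) * w (x - z)) \<le> B * exp (- a * z)"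
        using b(1)[of "x - z"] by (simp add: abs_mult)
    qed
    then show "(((\<lambda>z. - exp (- a * z) * w (x - z)) \<circ> real_of_ereal) \<longlongrightarrow> 0) (at_left \<infinity>)"
      by (simp add: ereal_tendsto_simps)
  qed simp
  finally show ?thesis by (simp add: g_def[abs_def])
qed

lemma conv_lker_reflect: "conv (lker a) g x = conv (rker a) (\<lambda>y. g (- y)) (- x)"
  using lborel_integral_reflect[of "\<lambda>y. rker a y * g (x + y)" 0]
  by (simp add: conv_altdef lker_def add.commute)

lemma conv_lker:
  assumes a: "a > 0" and w: "\<And>x. (w has_real_derivative w' x) (at x)" "continuous_on UNIV w'"
    and b: "\<And>x. \<bar>w x\<bar> \<le> B" "\<And>x. \<bar>w' x\<bar> \<le> B"
  shows "conv (lker a) (\<lambda>y. a * w y - w' y) x = w x"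
proof -
  have "conv (rker a) (\<lambda>y. a * w (- y) + (- w' (- y))) (- x) = w (- (- x))"
  proof (rule conv_rker[where B = B])
    show "((\<lambda>x. w (- x)) has_real_derivative - w' (- x)) (at x)" for x
      using DERIV_mirror[of w "w' (- x)" x] w(1)[of "- x"] by simp
    show "continuous_on UNIV (\<lambda>x. - w' (- x))"
      by (intro continuous_intros continuous_on_compose2[OF w(2)]) auto
  qed (use a b in auto)
  then show ?thesis by (simp add: conv_lker_reflect)
qed

lemma bdd_meas_exp_kernel: "bdd_meas (exp_kernel a)"
proof (rule bdd_measI[where B = "1 / (2 * \<bar>a\<bar>)"])
  show "exp_kernel a \<in> borel_measurable borel" unfolding exp_kernel_def[abs_def] by measurable
qed (auto simp: exp_kernel_def divide_right_mono)

text \<open>Partial fractions for the factorisation into first-order operators. The kernels disagree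
  at 0, where both one-sided kernels vanish, so the integrands are compared almost
  everywhere.\<close>

lemma exp_kernel_decomp:
  assumes "a \<noteq> 0" "bdd_meas g"
  shows "conv (exp_kernel a) g x = (conv (rker \<bar>a\<bar>) g x + conv (lker \<bar>a\<bar>) g x) / (2 * \<bar>a\<bar>)"
proof -
  have [measurable]: "g \<in> borel_measurable borel" using assms(2) by (rule bdd_meas_measurable)
  have "conv (exp_kernel a) g x = (LINT y|lborel. (rker \<bar>a\<bar> (x - y) * g y + lker \<bar>a\<bar> (x - y) * g y) / (2 * \<bar>a\<bar>))"
    unfolding conv_def
  proof (rule integral_cong_AE)
    have "AE y in lborel. y \<noteq> x" by (rule AE_lborel_singleton)
    then show "AE y in lborel. exp_kernel a (x - y) * g y =
        (rker \<bar>a\<bar> (x - y) * g y + lker \<bar>a\<bar> (x - y) * g y) / (2 * \<bar>a\<bar>)"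
      by eventually_elim (auto simp: exp_kernel_def rker_def lker_def)
  qed (auto simp: exp_kernel_def lker_def)
  then show ?thesis
    using integrable_conv[OF integrable_rker assms(2), of "\<bar>a\<bar>"] integrable_conv[OF integrable_lker assms(2), of "\<bar>a\<bar>"] assms(1)
    by (simp add: conv_def)
qed

lemma integrable_exp_kernel:
  assumes "a \<noteq> 0" shows "integrable lborel (exp_kernel a)"
proof -
  have "integrable lborel (\<lambda>x. (rker \<bar>a\<bar> x + lker \<bar>a\<bar> x) / (2 * \<bar>a\<bar>))"
    using integrable_rker[of "\<bar>a\<bar>"] integrable_lker[of "\<bar>a\<bar>"] assms by simp
  then show ?thesis
  proof (rule integrable_cong_AE_imp)
    have "AE x in lborel. x \<noteq> (0::real)" by (rule AE_lborel_singleton)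
    then show "AE x in lborel. (rker \<bar>a\<bar> x + lker \<bar>a\<bar> x) / (2 * \<bar>a\<bar>) = exp_kernel a x"
      by eventually_elim (auto simp: exp_kernel_def rker_def lker_def)
  qed (use bdd_meas_exp_kernel bdd_meas_measurable in auto)
qed

definition C2_bdd :: "(real \<Rightarrow> real) \<Rightarrow> (real \<Rightarrow> real) \<Rightarrow> (real \<Rightarrow> real) \<Rightarrow> bool" where
  "C2_bdd w w' w'' \<longleftrightarrow> (\<forall>x. (w has_real_derivative w' x) (at x)) \<and> (\<forall>x. (w' has_real_derivative w'' x) (at x)) \<and>
     continuous_on UNIV w'' \<and> (\<exists>B. \<forall>x. \<bar>w x\<bar> \<le> B \<and> \<bar>w' x\<bar> \<le> B \<and> \<bar>w'' x\<bar> \<le> B)"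

text \<open>The kernel is the Green's function of \<open>a\<^sup>2 - d\<^sup>2/dx\<^sup>2\<close>: the operator factors as
  \<open>(a + d/dx) (a - d/dx)\<close>, and the one-sided kernels invert the factors.\<close>
lemma conv_exp_kernel_C2:
  assumes a: "a \<noteq> 0" and w: "C2_bdd w w' w''"
  shows "conv (exp_kernel a) (\<lambda>y. a\<^sup>2 * w y - w'' y) x = w x"
proof -
  obtain B where b: "\<And>x. \<bar>w x\<bar> \<le> B" "\<And>x. \<bar>w' x\<bar> \<le> B" "\<And>x. \<bar>w'' x\<bar> \<le> B"
    using w by (auto simp: C2_bdd_def)
  have d: "\<And>x. (w has_real_derivative w' x) (at x)" "\<And>x. (w' has_real_derivative w'' x) (at x)"
    and c: "continuous_on UNIV w''" using w by (auto simp: C2_bdd_def)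
  have c': "continuous_on UNIV w'" "continuous_on UNIV w"
    using d by (meson DERIV_continuous continuous_at_imp_continuous_on)+
  define A where "A = \<bar>a\<bar>"
  have A: "A > 0" "a\<^sup>2 = A\<^sup>2" using a by (auto simp: A_def)
  have b': "\<bar>A * u + v\<bar> \<le> (A + 1) * B" if "\<bar>u\<bar> \<le> B" "\<bar>v\<bar> \<le> B" for u v
  proof -
    have "\<bar>A * u + v\<bar> \<le> \<bar>A * u\<bar> + \<bar>v\<bar>" by (rule abs_triangle_ineq)
    also have "\<bar>A * u\<bar> \<le> A * B" using that A by (simp add: abs_mult)
    finally show ?thesis using that(2) by (simp add: algebra_simps)
  qed
  have b'': "\<bar>A * u - v\<bar> \<le> (A + 1) * B" if "\<bar>u\<bar> \<le> B" "\<bar>v\<bar> \<le> B" for u v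
    using b'[of u "- v"] that by simp
  have B0: "B \<ge> 0" using b(1)[of 0] by linarith
  have g: "bdd_meas (\<lambda>y. A\<^sup>2 * w y - w'' y)"
  proof (rule bdd_meas_continuous)
    show "continuous_on UNIV (\<lambda>y. A\<^sup>2 * w y - w'' y)" by (intro continuous_intros c c')
    show "\<bar>A\<^sup>2 * w y - w'' y\<bar> \<le> A\<^sup>2 * B + B" for y
    proof -
      have "\<bar>A\<^sup>2 * w y\<bar> \<le> A\<^sup>2 * B" using b(1)[of y] by (simp add: abs_mult mult_left_mono)
      then show ?thesis using b(3)[of y] by linarith
    qed
  qed
  have "conv (rker A) (\<lambda>y. A * (A * w y - w' y) + (A * w' y - w'' y)) x = A * w x - w' x"
    using A b b'' by (intro conv_rker[where B = "(A + 1) * B"])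
      (auto intro!: derivative_eq_intros d continuous_intros c c')
  then have 1: "conv (rker A) (\<lambda>y. A\<^sup>2 * w y - w'' y) x = A * w x - w' x"
    by (simp add: algebra_simps power2_eq_square)
  have "conv (lker A) (\<lambda>y. A * (A * w y + w' y) - (A * w' y + w'' y)) x = A * w x + w' x"
    using A b b' by (intro conv_lker[where B = "(A + 1) * B"])
      (auto intro!: derivative_eq_intros d continuous_intros c c')
  then have 2: "conv (lker A) (\<lambda>y. A\<^sup>2 * w y - w'' y) x = A * w x + w' x"
    by (simp add: algebra_simps power2_eq_square)
  show ?thesis
    using exp_kernel_decomp[OF a g] A 1 2 unfolding A(2) A_def[symmetric] by simp
qed

text \<open>Both first-order inversion formulas return \<open>w x\<close>; subtracting one from the
  other trades \<open>w'\<close> for \<open>w\<close>. This is integration by parts in which the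
  kernel is never differentiated.\<close>

lemma conv_exp_kernel_deriv:
  assumes a: "a \<noteq> 0" and w: "\<And>x. (w has_real_derivative w' x) (at x)" "continuous_on UNIV w'"
    and b: "\<And>x. \<bar>w x\<bar> \<le> B" "\<And>x. \<bar>w' x\<bar> \<le> B"
  shows "conv (exp_kernel a) w' x = conv (dker a) w x"
proof -
  define A where "A = \<bar>a\<bar>"
  have A: "A > 0" using a by (auto simp: A_def)
  have c: "continuous_on UNIV w" using w(1) by (meson DERIV_continuous continuous_at_imp_continuous_on)
  have bm: "bdd_meas w" "bdd_meas w'" using c w(2) b by (auto intro: bdd_meas_continuous)
  have bmA: "bdd_meas (\<lambda>y. A * w y)" using bm(1) bdd_meas_mult[of "\<lambda>_. A" w] by simp
  have "conv (rker A) (\<lambda>y. A * w y + w' y) x = w x" by (rule conv_rker[OF A w b])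
  then have 1: "A * conv (rker A) w x + conv (rker A) w' x = w x"
    by (simp add: conv_add[OF integrable_rker[OF A] bmA bm(2)] conv_cmult)
  have "conv (lker A) (\<lambda>y. A * w y - w' y) x = w x" by (rule conv_lker[OF A w b])
  then have 2: "A * conv (lker A) w x - conv (lker A) w' x = w x"
    by (simp add: conv_diff[OF integrable_lker[OF A] bmA bm(2)] conv_cmult)
  have "conv (dker a) w x = conv (\<lambda>z. 1 / 2 * lker A z + (- 1 / 2) * rker A z) w x"
    by (simp add: dker_eq A_def[symmetric])
  also have "\<dots> = conv (\<lambda>z. 1 / 2 * lker A z) w x + conv (\<lambda>z. (- 1 / 2) * rker A z) w x"
    using integrable_lker[OF A] integrable_rker[OF A] bm(1) by (intro conv_add_left) auto
  also have "\<dots> = 1 / 2 * conv (lker A) w x + (- 1 / 2) * conv (rker A) w x"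
    by (simp only: conv_cmult_left)
  finally have 3: "2 * conv (dker a) w x = conv (lker A) w x - conv (rker A) w x" by simp
  have "conv (exp_kernel a) w' x = (conv (rker A) w' x + conv (lker A) w' x) / (2 * A)"
    using exp_kernel_decomp[OF a bm(2)] by (simp add: A_def)
  then have "A * (2 * conv (exp_kernel a) w' x) = conv (rker A) w' x + conv (lker A) w' x"
    using A by simp
  also have "\<dots> = A * (conv (lker A) w x - conv (rker A) w x)"
    using 1 2 by (simp add: right_diff_distrib)
  finally have "A * (2 * conv (exp_kernel a) w' x) = A * (2 * conv (dker a) w x)"
    unfolding 3 .
  then show ?thesis using A by simp
qed

section \<open>Symmetric decreasing kernels\<close>

text \<open>The condition \<open>harnack\<close> stands in for all smoothness of \<open>K\<close>.
  It survives convolution with nonnegative functions, and Lipschitz estimates, lower bounds near the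
  maximum and decay of square-integrable solutions all come from it.\<close>

locale sym_kernel =
  fixes K :: "real \<Rightarrow> real" and A :: real
  assumes integrable: "integrable lborel K"
    and pos: "K x > 0"
    and even: "K (- x) = K x"
    and strict_decr: "0 \<le> x \<Longrightarrow> x < y \<Longrightarrow> K y < K x"
    and A_pos: "A > 0"
    and harnack: "exp (- A * \<bar>t\<bar>) * K x \<le> K (x + t)"
begin

lemma less_abs: "\<bar>x\<bar> < \<bar>y\<bar> \<Longrightarrow> K y < K x"
  using strict_decr[of "\<bar>x\<bar>" "\<bar>y\<bar>"] even[of x] even[of y] by (auto simp: abs_if split: if_splits)

lemma le_0: "K x \<le> K 0"
  using less_abs[of 0 x] by (cases "x = 0") auto

lemma decr: "0 \<le> x \<Longrightarrow> x \<le> y \<Longrightarrow> K y \<le> K x"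
  using strict_decr[of x y] by (cases "x = y") auto

lemma bdd_meas: "bdd_meas K"
  using borel_measurable_integrable[OF integrable] le_0 pos
  by (intro bdd_measI[where B = "K 0"]) (auto simp: abs_of_pos)

lemma integral_pos: "(LINT y|lborel. K y) > 0"
  by (rule integral_pos_real[OF integrable less_imp_le[OF pos], of 0 1]) (use pos in auto)

lemma conv_nonneg: "(\<And>y. g y \<ge> 0) \<Longrightarrow> conv K g x \<ge> 0"
  unfolding conv_def using less_imp_le[OF pos] by (auto intro!: integral_nonneg_AE)

lemma conv_pos:
  assumes "bdd_meas g" "\<And>y. g y \<ge> 0" "a < b" "\<And>y. a < y \<Longrightarrow> y < b \<Longrightarrow> g y > 0"
  shows "conv K g x > 0"
  unfolding conv_def using assms less_imp_le[OF pos]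
  by (intro integral_pos_real[where a = a and b = b] integrable_conv integrable) (auto intro!: pos mult_pos_pos)

lemma conv_harnack:
  assumes "bdd_meas g" "\<And>y. g y \<ge> 0"
  shows "exp (- A * \<bar>t\<bar>) * conv K g x \<le> conv K g (x + t)"
proof -
  have "exp (- A * \<bar>t\<bar>) * conv K g x = (LINT y|lborel. exp (- A * \<bar>t\<bar>) * (K (x - y) * g y))"
    by (simp add: conv_def)
  also have "\<dots> \<le> (LINT y|lborel. K (x + t - y) * g y)"
  proof (rule integral_mono)
    show "exp (- A * \<bar>t\<bar>) * (K (x - y) * g y) \<le> K (x + t - y) * g y" for y
      using mult_right_mono[OF harnack[of t "x - y"] assms(2)[of y]]
      by (simp add: algebra_simps)
  qed (use integrable_conv[OF integrable assms(1)] in auto)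
  finally show ?thesis by (simp add: conv_def)
qed

lemma conv_reflect_integrand_nonneg:
  assumes "x < c" "\<And>z. z < c \<Longrightarrow> g (2 * c - z) \<le> g z"
  shows "0 \<le> (K (x - z) - K (2 * c - x - z)) * (g z - g (2 * c - z))"
proof -
  consider "z < c" | "z > c" | "z = c" by linarith
  then show ?thesis
  proof cases
    case 1
    then have "K (2 * c - x - z) < K (x - z)" using assms(1) by (intro less_abs) auto
    with assms(2)[OF 1] show ?thesis by simp
  next
    case 2
    then have "K (x - z) < K (2 * c - x - z)" using assms(1) by (intro less_abs) auto
    with assms(2)[of "2 * c - z"] 2 show ?thesis by (simp add: mult_nonpos_nonpos)
  qed simp
qed

lemma conv_reflect_le:
  assumes "bdd_meas g" "x < c" "\<And>z. z < c \<Longrightarrow> g (2 * c - z) \<le> g z"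
  shows "conv K g (2 * c - x) \<le> conv K g x"
proof -
  have "0 \<le> conv K g x - conv K g (2 * c - x)"
    unfolding conv_reflect_identity(1)[OF integrable even assms(1)]
    using conv_reflect_integrand_nonneg[of x c g] assms(2,3) by simp
  then show ?thesis by simp
qed

text \<open>This acts as a strong maximum principle: a strict inequality on one small interval left
  of \<open>c\<close> spreads to every \<open>x < c\<close>, because the kernel difference is
  strictly positive there.\<close>

lemma conv_reflect_less:
  assumes "bdd_meas g" "x < c" "\<And>z. z < c \<Longrightarrow> g (2 * c - z) \<le> g z"
    and "a < b" "b \<le> c" "\<And>z. a < z \<Longrightarrow> z < b \<Longrightarrow> g (2 * c - z) < g z"
  shows "conv K g (2 * c - x) < conv K g x"
proof -
  have "0 < conv K g x - conv K g (2 * c - x)"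
    unfolding conv_reflect_identity(1)[OF integrable even assms(1)]
  proof (rule divide_pos_pos, rule integral_pos_real[OF conv_reflect_identity(2)[OF integrable even assms(1)] _ assms(4)])
    show "0 \<le> (K (x - z) - K (2 * c - x - z)) * (g z - g (2 * c - z))" for z
      by (rule conv_reflect_integrand_nonneg) (use assms in auto)
    show "0 < (K (x - z) - K (2 * c - x - z)) * (g z - g (2 * c - z))" if "a < z" "z < b" for z
    proof -
      have "K (2 * c - x - z) < K (x - z)" using assms(2,5) that by (intro less_abs) auto
      with assms(6)[OF that] show ?thesis by simp
    qed
  qed simp
  then show ?thesis by simp
qed

text \<open>On odd functions the operator acts through the kernel \<open>K (x - y) - K (x + y)\<close> on the
  half-line, which is positive.\<close>
lemma conv_odd_nonneg:
  assumes "bdd_meas g" "\<And>x. g (- x) = - g x" "\<And>x. x > 0 \<Longrightarrow> g x \<ge> 0" "x > 0"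
  shows "conv K g x \<ge> 0"
proof -
  \<comment> \<open>The reflection inequality about 0 expects the larger values on the left, so it
    is applied to the mirror image of \<open>g\<close>.\<close>
  have neg: "bdd_meas (\<lambda>y. g (- y))" using bdd_meas_reflect[OF assms(1), of 0] by simp
  have le: "g z \<le> g (- z)" if "z < 0" for z
    using assms(2)[of z] assms(3)[of "- z"] that by auto
  have "conv K (\<lambda>y. g (- y)) x \<le> conv K (\<lambda>y. g (- y)) (- x)"
    using conv_reflect_le[OF neg, of "- x" 0] assms(4) le by simp
  also have "conv K (\<lambda>y. g (- y)) (- x) = conv K g x"
    using conv_eq_reflect[of K g, OF even, of 0 "- x"] by simp
  also have "conv K (\<lambda>y. g (- y)) x = - conv K g x"
    using conv_cmult[of K "-1" g x] assms(2) by simp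
  finally show ?thesis by simp
qed

lemma conv_odd: "(\<And>x. g (- x) = - g x) \<Longrightarrow> conv K g (- x) = - conv K g x"
  using conv_eq_reflect[of K g, OF even, of 0 x] conv_cmult[of K "-1" g x] by simp

end

text \<open>The loss from \<open>x\<close> to \<open>y\<close> is at most
  \<open>(1 - exp (- A * \<bar>y - x\<bar>)) * u x\<close>, and
  \<open>1 - exp (- s) \<le> s\<close>; exchanging \<open>x\<close> and \<open>y\<close> gives the
  absolute value.\<close>

lemma harnack_imp_lipschitz:
  fixes u :: "real \<Rightarrow> real"
  assumes "A > 0" "\<And>x. 0 \<le> u x" "\<And>x. u x \<le> B" "\<And>x t. exp (- A * \<bar>t\<bar>) * u x \<le> u (x + t)"
  shows "\<bar>u x - u y\<bar> \<le> A * B * \<bar>x - y\<bar>"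
proof -
  have *: "u x - u y \<le> A * B * \<bar>x - y\<bar>" for x y
  proof -
    have e: "1 - exp (- A * \<bar>y - x\<bar>) \<le> A * \<bar>y - x\<bar>"
      using exp_ge_add_one_self[of "- A * \<bar>y - x\<bar>"] by simp
    have "u x - u y \<le> u x - exp (- A * \<bar>y - x\<bar>) * u x"
      using assms(4)[of "y - x" x] by simp
    also have "\<dots> = (1 - exp (- A * \<bar>y - x\<bar>)) * u x" by (simp add: algebra_simps)
    also have "\<dots> \<le> (A * \<bar>y - x\<bar>) * u x"
      using e assms(2) by (rule mult_right_mono)
    also have "\<dots> \<le> (A * \<bar>y - x\<bar>) * B"
      using assms(1,3) by (intro mult_left_mono) auto
    finally show ?thesis by (simp add: algebra_simps abs_minus_commute)
  qed
  show ?thesis using *[of x y] *[of y x] by (simp add: abs_minus_commute abs_le_iff)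
qed

lemma lipschitz_imp_continuous:
  fixes u :: "real \<Rightarrow> real"
  assumes "\<And>x y. \<bar>u x - u y\<bar> \<le> C * \<bar>x - y\<bar>"
  shows "continuous_on UNIV u"
proof -
  have "C \<ge> 0" using assms[of 0 1] by simp
  then have "C-lipschitz_on UNIV u"
    using assms by (intro lipschitz_onI) (auto simp: dist_real_def)
  then show ?thesis by (rule lipschitz_on_continuous_on)
qed

context sym_kernel
begin

lemma conv_lipschitz:
  assumes "bdd_meas g" "\<And>y. g y \<ge> 0" "\<And>y. conv K g y \<le> B"
  shows "\<bar>conv K g x - conv K g y\<bar> \<le> A * B * \<bar>x - y\<bar>"
  by (rule harnack_imp_lipschitz[OF A_pos]) (use assms conv_nonneg conv_harnack in auto)

lemma conv_le:
  assumes "g \<in> borel_measurable borel" "\<And>y. \<bar>g y\<bar> \<le> B"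
  shows "\<bar>conv K g x\<bar> \<le> B * (LINT y|lborel. K y)"
  using conv_abs_le[OF integrable assms] pos by (simp add: abs_of_pos)

lemma conv_continuous:
  assumes "bdd_meas g" "\<And>y. g y \<ge> 0"
  shows "continuous_on UNIV (conv K g)"
proof -
  obtain B where "\<And>y. \<bar>g y\<bar> \<le> B" using assms(1) by (auto simp: bdd_meas_def)
  then have "\<bar>conv K g y\<bar> \<le> B * (LINT y|lborel. K y)" for y
    using conv_le assms(1) bdd_meas_measurable by blast
  then have "conv K g y \<le> B * (LINT y|lborel. K y)" for y by (simp add: abs_le_iff)
  from lipschitz_imp_continuous[OF conv_lipschitz[OF assms this]] show ?thesis .
qed

end

section \<open>The kernel that inverts the composed operator\<close>

lemma sym_kernel_exp_kernel:
  assumes "a \<noteq> 0" shows "sym_kernel (exp_kernel a) \<bar>a\<bar>"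
proof
  show "exp (- \<bar>a\<bar> * \<bar>t\<bar>) * exp_kernel a x \<le> exp_kernel a (x + t)" for x t
  proof -
    have "\<bar>a\<bar> * \<bar>x + t\<bar> \<le> \<bar>a\<bar> * (\<bar>x\<bar> + \<bar>t\<bar>)" by (intro mult_left_mono) auto
    then have "exp (- \<bar>a\<bar> * \<bar>t\<bar> - \<bar>a\<bar> * \<bar>x\<bar>) \<le> exp (- \<bar>a\<bar> * \<bar>x + t\<bar>)"
      by (simp add: algebra_simps)
    then show ?thesis
      by (simp add: exp_kernel_def divide_right_mono exp_add[symmetric])
  qed
qed (use assms integrable_exp_kernel in \<open>auto simp: exp_kernel_def divide_strict_right_mono\<close>)

text \<open>Strict decrease is the strict reflection inequality applied to \<open>L\<close> about
  the midpoint of the two points. The lower bound needs only \<open>L \<ge> 0\<close>, so the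
  constant of \<open>K\<close> survives.\<close>

lemma sym_kernel_conv:
  assumes "sym_kernel K A" "sym_kernel L B" shows "sym_kernel (conv K L) A"
proof -
  interpret K: sym_kernel K A by fact
  interpret L: sym_kernel L B by fact
  show ?thesis
  proof
    show "integrable lborel (conv K L)"
      by (rule integrable_conv_conv[OF K.integrable L.integrable L.bdd_meas])
    show "conv K L x > 0" for x
      by (rule K.conv_pos[OF L.bdd_meas less_imp_le[OF L.pos], of 0 1]) (auto intro: L.pos)
    show "conv K L (- x) = conv K L x" for x
      by (rule conv_even[of K L, OF K.even L.even])
    show "exp (- A * \<bar>t\<bar>) * conv K L x \<le> conv K L (x + t)" for x t
      by (rule K.conv_harnack[OF L.bdd_meas less_imp_le[OF L.pos]])
    show "conv K L y < conv K L x" if "0 \<le> x" "x < y" for x y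
    proof -
      define c where "c = (x + y) / 2"
      have c: "x < c" "c > 0" "y = 2 * c - x" using that by (auto simp: c_def field_simps)
      have "L (2 * c - z) < L z" if "z < c" for z
        using that c by (intro L.less_abs) auto
      then show ?thesis unfolding c(3)
        using c(1) by (intro K.conv_reflect_less[OF L.bdd_meas, of x c "c - 1" c]) (auto intro: less_imp_le)
    qed
  qed (rule K.A_pos)
qed

text \<open>The empty list stands for the identity, whose kernel would be a Dirac mass; 0 is a
  placeholder there, and singletons are the true base case.\<close>

fun kern :: "real list \<Rightarrow> real \<Rightarrow> real" where
  "kern [] = (\<lambda>_. 0)"
| "kern [a] = exp_kernel a"
| "kern (a # b # as) = conv (kern (b # as)) (exp_kernel a)"

lemma sym_kernel_kern:
  assumes "as \<noteq> []" "\<forall>a\<in>set as. a \<noteq> 0" shows "\<exists>A. sym_kernel (kern as) A"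
  using assms
proof (induction as rule: kern.induct)
  case (2 a)
  then show ?case using sym_kernel_exp_kernel by auto
next
  case (3 a b as)
  then obtain A where "sym_kernel (kern (b # as)) A" by auto
  from sym_kernel_conv[OF this sym_kernel_exp_kernel] show ?case using 3 by auto
qed simp

text \<open>In the kernel the factor of the head acts first, while \<open>L_op\<close> applies the
  factor of the head last. Inverting \<open>L_op\<close> therefore cancels head against
  head.\<close>

lemma conv_kern_Cons:
  assumes "as \<noteq> []" "\<forall>a\<in>set as. a \<noteq> 0" "a \<noteq> 0" "bdd_meas g"
  shows "conv (kern (a # as)) g = conv (kern as) (conv (exp_kernel a) g)"
proof -
  obtain A where "sym_kernel (kern as) A" using sym_kernel_kern[OF assms(1,2)] by blast
  then interpret sym_kernel "kern as" A .
  have "kern (a # as) = conv (kern as) (exp_kernel a)" using assms(1) by (cases as) auto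
  then show ?thesis
    using conv_assoc[OF integrable integrable_exp_kernel[OF assms(3)] assms(4)] by auto
qed

lemma integrable_kern: "as \<noteq> [] \<Longrightarrow> \<forall>a\<in>set as. a \<noteq> 0 \<Longrightarrow> integrable lborel (kern as)"
  using sym_kernel_kern sym_kernel.integrable by blast

lemma bdd_meas_kern: "as \<noteq> [] \<Longrightarrow> \<forall>a\<in>set as. a \<noteq> 0 \<Longrightarrow> bdd_meas (kern as)"
  using sym_kernel_kern sym_kernel.bdd_meas by blast

lemma C2_bdd_const: "C2_bdd (\<lambda>_. c) (\<lambda>_. 0) (\<lambda>_. 0)"
  by (auto simp: C2_bdd_def intro!: exI[of _ "\<bar>c\<bar>"])

lemma conv_exp_kernel_const: "a \<noteq> 0 \<Longrightarrow> conv (exp_kernel a) (\<lambda>_. c) x = c / a\<^sup>2"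
  using conv_exp_kernel_C2[OF _ C2_bdd_const[of "c / a\<^sup>2"], of a x] by simp

text \<open>With \<open>c = 1\<close> this computes the mass of the kernel as the reciprocal of the
  symbol at frequency 0, the threshold against which all later constants are measured.\<close>

lemma conv_kern_const:
  assumes "as \<noteq> []" "\<forall>a\<in>set as. a \<noteq> 0"
  shows "conv (kern as) (\<lambda>_. c) x = c / (\<Prod>a\<leftarrow>as. a\<^sup>2)"
  using assms
proof (induction as arbitrary: c x rule: kern.induct)
  case (2 a)
  then show ?case by (simp add: conv_exp_kernel_const)
next
  case (3 a b as)
  then have "conv (kern (a # b # as)) (\<lambda>_. c) x = conv (kern (b # as)) (conv (exp_kernel a) (\<lambda>_. c)) x"
    by (subst conv_kern_Cons) auto
  also have "conv (exp_kernel a) (\<lambda>_. c) = (\<lambda>_. c / a\<^sup>2)"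
    using 3 conv_exp_kernel_const by auto
  finally show ?case using 3 by simp
qed simp

section \<open>Test functions\<close>

definition smooth :: "(real \<Rightarrow> real) \<Rightarrow> bool" where
  "smooth \<psi> \<longleftrightarrow> (\<forall>k x. ((deriv ^^ k) \<psi> has_real_derivative (deriv ^^ Suc k) \<psi> x) (at x))"

lemma test_fun_iff: "test_fun \<psi> \<longleftrightarrow> smooth \<psi> \<and> bounded {x. \<psi> x \<noteq> 0}"
  by (simp add: test_fun_def smooth_def)

text \<open>A class of functions closed under differentiation consists of smooth functions.
  Exhibiting such a class avoids any formula for the \<open>k\<close>-th derivative.\<close>

lemma smooth_coinduct:
  assumes "\<psi> \<in> S" and S: "\<And>g. g \<in> S \<Longrightarrow> \<exists>g'\<in>S. \<forall>x. (g has_real_derivative g' x) (at x)"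
  shows "smooth \<psi>"
proof -
  have d: "deriv g \<in> S \<and> (\<forall>x. (g has_real_derivative deriv g x) (at x))" if "g \<in> S" for g
  proof -
    obtain g' where g': "g' \<in> S" "\<And>x. (g has_real_derivative g' x) (at x)" using S[of g] \<open>g \<in> S\<close> by blast
    then have "deriv g = g'" using DERIV_imp_deriv by blast
    then show ?thesis using g' by simp
  qed
  have "(deriv ^^ k) \<psi> \<in> S" for k
    by (induction k) (use assms(1) d in auto)
  then show ?thesis using d by (auto simp: smooth_def)
qed

lemma smooth_DERIV: "smooth \<psi> \<Longrightarrow> (\<psi> has_real_derivative deriv \<psi> x) (at x)"
  unfolding smooth_def by (drule spec[of _ 0]) simp

lemma smooth_funpow: "smooth \<psi> \<Longrightarrow> smooth ((deriv ^^ k) \<psi>)"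
  unfolding smooth_def by (metis comp_apply funpow_add add_Suc)

lemma smooth_deriv: "smooth \<psi> \<Longrightarrow> smooth (deriv \<psi>)"
  using smooth_funpow[of \<psi> 1] by simp

lemma smooth_antideriv:
  assumes "\<And>x. (\<psi> has_real_derivative g x) (at x)" "smooth g"
  shows "smooth \<psi>"
proof (rule smooth_coinduct[where S = "insert \<psi> {g. smooth g}"])
  fix h assume "h \<in> insert \<psi> {g. smooth g}"
  then show "\<exists>h'\<in>insert \<psi> {g. smooth g}. \<forall>x. (h has_real_derivative h' x) (at x)"
    using assms smooth_DERIV smooth_deriv by (cases "h = \<psi>") blast+
qed simp

lemma smooth_lincomb:
  assumes "smooth u" "smooth v" shows "smooth (\<lambda>x. c * u x + d * v x)"
proof (rule smooth_coinduct[where S = "{\<lambda>x. c * u x + d * v x | u v. smooth u \<and> smooth v}"])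
  fix g assume "g \<in> {\<lambda>x. c * u x + d * v x | u v. smooth u \<and> smooth v}"
  then obtain u v where uv: "g = (\<lambda>x. c * u x + d * v x)" "smooth u" "smooth v" by blast
  have "(\<lambda>x. c * deriv u x + d * deriv v x) \<in> {\<lambda>x. c * u x + d * v x | u v. smooth u \<and> smooth v}"
    using uv smooth_deriv by blast
  moreover have "(g has_real_derivative c * deriv u x + d * deriv v x) (at x)" for x
    unfolding uv(1) by (intro DERIV_add DERIV_cmult smooth_DERIV uv)
  ultimately show "\<exists>g'\<in>{\<lambda>x. c * u x + d * v x | u v. smooth u \<and> smooth v}.
      \<forall>x. (g has_real_derivative g' x) (at x)" by (intro bexI) auto
qed (use assms in auto)

lemma smooth_affine:
  assumes "smooth u" shows "smooth (\<lambda>x. u (c * x + d))"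
proof (rule smooth_coinduct[where S = "{\<lambda>x. e * u (c * x + d) | e u. smooth u}"])
  fix g assume "g \<in> {\<lambda>x. e * u (c * x + d) | e u. smooth u}"
  then obtain u e where u: "g = (\<lambda>x. e * u (c * x + d))" "smooth u" by blast
  have "(\<lambda>x. (e * c) * deriv u (c * x + d)) \<in> {\<lambda>x. e * u (c * x + d) | e u. smooth u}"
    using u smooth_deriv by blast
  moreover have "(g has_real_derivative (e * c) * deriv u (c * x + d)) (at x)" for x
    unfolding u(1) by (auto intro!: derivative_eq_intros DERIV_chain2[OF smooth_DERIV[OF u(2)]])
  ultimately show "\<exists>g'\<in>{\<lambda>x. e * u (c * x + d) | e u. smooth u}. \<forall>x. (g has_real_derivative g' x) (at x)"
    by (intro bexI) auto
next
  have "(\<lambda>x. 1 * u (c * x + d)) \<in> {\<lambda>x. e * u (c * x + d) | e u. smooth u}"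
    using assms by blast
  then show "(\<lambda>x. u (c * x + d)) \<in> {\<lambda>x. e * u (c * x + d) | e u. smooth u}" by simp
qed

lemma bounded_support_iff: "bounded {x::real. g x \<noteq> (0::real)} \<longleftrightarrow> (\<exists>R>0. \<forall>x. \<bar>x\<bar> > R \<longrightarrow> g x = 0)"
  unfolding bounded_pos by (auto simp: not_le[symmetric] real_norm_def)

lemma support_deriv:
  assumes "\<forall>x. \<bar>x\<bar> > R \<longrightarrow> g x = (0::real)" "\<bar>x\<bar> > R" shows "deriv g x = 0"
proof -
  have "eventually (\<lambda>y. y \<in> {y. \<bar>y\<bar> > R}) (nhds x)"
    using assms(2) by (intro eventually_nhds_in_open open_Collect_less) (auto intro!: continuous_intros)
  then have "eventually (\<lambda>y. g y = (\<lambda>_. 0) y) (nhds x)"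
    by eventually_elim (use assms(1) in auto)
  then have "deriv g x = deriv (\<lambda>_. 0) x" by (intro deriv_cong_ev) auto
  then show ?thesis by simp
qed

lemma test_fun_support:
  assumes "test_fun \<psi>" obtains R where "R > 0" "\<And>k x. \<bar>x\<bar> > R \<Longrightarrow> (deriv ^^ k) \<psi> x = 0"
proof -
  obtain R where R: "R > 0" "\<forall>x. \<bar>x\<bar> > R \<longrightarrow> \<psi> x = 0"
    using assms by (auto simp: test_fun_iff bounded_support_iff)
  have "\<forall>x. \<bar>x\<bar> > R \<longrightarrow> (deriv ^^ k) \<psi> x = 0" for k
    by (induction k) (use R support_deriv in auto)
  then show ?thesis using that R by blast
qed

lemma test_fun_funpow: "test_fun \<psi> \<Longrightarrow> test_fun ((deriv ^^ k) \<psi>)"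
  by (metis test_fun_iff smooth_funpow test_fun_support bounded_support_iff)

lemma test_fun_lincomb:
  assumes "test_fun u" "test_fun v" shows "test_fun (\<lambda>x. c * u x + d * v x)"
proof -
  obtain R R' where R: "\<forall>x. \<bar>x\<bar> > R \<longrightarrow> u x = 0" "R > 0" "\<forall>x. \<bar>x\<bar> > R' \<longrightarrow> v x = 0"
    using assms by (auto simp: test_fun_iff bounded_support_iff)
  then have "\<forall>x. \<bar>x\<bar> > max R R' \<longrightarrow> c * u x + d * v x = 0" "max R R' > 0" by auto
  then have "bounded {x. c * u x + d * v x \<noteq> 0}" unfolding bounded_support_iff by blast
  then show ?thesis using smooth_lincomb assms by (simp add: test_fun_iff)
qed

lemma test_fun_reflect:
  assumes "test_fun u" shows "test_fun (\<lambda>x. u (c - x))"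
proof -
  obtain R where R: "\<forall>x. \<bar>x\<bar> > R \<longrightarrow> u x = 0" "R > 0"
    using assms by (auto simp: test_fun_iff bounded_support_iff)
  then have "\<forall>x. \<bar>x\<bar> > R + \<bar>c\<bar> \<longrightarrow> u (c - x) = 0" "R + \<bar>c\<bar> > 0" by auto
  then have "bounded {x. u (c - x) \<noteq> 0}" unfolding bounded_support_iff by blast
  then show ?thesis using smooth_affine[of u "-1" c] assms by (simp add: test_fun_iff)
qed

lemma test_fun_continuous: "test_fun \<psi> \<Longrightarrow> continuous_on UNIV \<psi>"
  by (meson DERIV_continuous continuous_at_imp_continuous_on smooth_DERIV test_fun_iff)

lemma compact_support_continuous:
  fixes g :: "real \<Rightarrow> real"
  assumes "continuous_on UNIV g" "\<And>x. \<bar>x\<bar> > R \<Longrightarrow> g x = 0"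
  shows "integrable lborel g" "\<exists>B>0. \<forall>x. \<bar>g x\<bar> \<le> B"
proof -
  have c: "continuous_on {-R..R} g" using assms(1) by (rule continuous_on_subset) simp
  have out: "g x = 0" if "x \<notin> {-R..R}" for x
    using that by (intro assms(2)) (auto simp: not_le)
  have "integrable lborel (\<lambda>x. indicator {-R..R} x *\<^sub>R g x)"
    using c by (intro borel_integrable_compact) auto
  also have "(\<lambda>x. indicator {-R..R} x *\<^sub>R g x) = g"
    using out by (auto simp: indicator_def fun_eq_iff)
  finally show "integrable lborel g" .
  obtain B where B: "B > 0" "\<And>x. x \<in> {-R..R} \<Longrightarrow> \<bar>g x\<bar> \<le> B"
    using compact_imp_bounded[OF compact_continuous_image[OF c compact_Icc]]
    unfolding bounded_pos by (metis imageI real_norm_def)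
  have "\<bar>g x\<bar> \<le> B" for x using B out[of x] by (cases "x \<in> {-R..R}") auto
  then show "\<exists>B>0. \<forall>x. \<bar>g x\<bar> \<le> B" using B(1) by blast
qed

lemma test_fun_bounded:
  assumes "test_fun \<psi>" obtains B where "B > 0" "\<And>x. \<bar>\<psi> x\<bar> \<le> B"
proof -
  obtain R where "\<And>x. \<bar>x\<bar> > R \<Longrightarrow> \<psi> x = 0"
    using assms by (auto simp: test_fun_iff bounded_support_iff)
  from compact_support_continuous(2)[OF test_fun_continuous[OF assms] this] show ?thesis using that by blast
qed

lemma test_fun_bdd_meas: "test_fun \<psi> \<Longrightarrow> bdd_meas \<psi>"
  by (metis test_fun_bounded bdd_meas_continuous test_fun_continuous)

lemma test_fun_integrable: "test_fun \<psi> \<Longrightarrow> integrable lborel \<psi>"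
  using compact_support_continuous(1)[OF test_fun_continuous]
  by (auto simp: test_fun_iff bounded_support_iff)

lemma test_fun_C2_bdd: "test_fun \<psi> \<Longrightarrow> C2_bdd \<psi> (deriv \<psi>) (deriv (deriv \<psi>))"
proof -
  assume t: "test_fun \<psi>"
  have t': "test_fun (deriv \<psi>)" "test_fun (deriv (deriv \<psi>))"
    using test_fun_funpow[OF t, of 1] test_fun_funpow[OF t, of 2] by (simp_all add: numeral_2_eq_2)
  obtain B where B: "B > 0" "\<And>x. \<bar>\<psi> x\<bar> \<le> B" using test_fun_bounded[OF t] by blast
  obtain B' where B': "B' > 0" "\<And>x. \<bar>deriv \<psi> x\<bar> \<le> B'" using test_fun_bounded[OF t'(1)] by blast
  obtain B'' where B'': "B'' > 0" "\<And>x. \<bar>deriv (deriv \<psi>) x\<bar> \<le> B''" using test_fun_bounded[OF t'(2)] by blast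
  have "\<bar>\<psi> x\<bar> \<le> B + B' + B'' \<and> \<bar>deriv \<psi> x\<bar> \<le> B + B' + B'' \<and> \<bar>deriv (deriv \<psi>) x\<bar> \<le> B + B' + B''" for x
    using B(1) B(2)[of x] B'(1) B'(2)[of x] B''(1) B''(2)[of x] by linarith
  then show ?thesis
    using t t' test_fun_continuous[OF t'(2)] by (auto simp: C2_bdd_def test_fun_iff smooth_DERIV)
qed

lemma test_fun_operator:
  assumes "test_fun \<psi>" shows "test_fun (\<lambda>x. c * \<psi> x - deriv (deriv \<psi>) x)"
  using test_fun_lincomb[OF assms test_fun_funpow[OF assms, of 2], of c "-1"] by (simp add: numeral_2_eq_2)

lemma test_fun_L_op: "test_fun \<psi> \<Longrightarrow> test_fun (L_op as \<psi>)"
  by (induction as) (auto intro: test_fun_operator)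

lemma conv_exp_kernel_test_fun:
  assumes "a \<noteq> 0" "test_fun \<psi>"
  shows "conv (exp_kernel a) (\<lambda>y. a\<^sup>2 * \<psi> y - deriv (deriv \<psi>) y) = \<psi>"
  using conv_exp_kernel_C2[OF assms(1) test_fun_C2_bdd[OF assms(2)]] by auto

lemma conv_kern_L_op:
  assumes "as \<noteq> []" "\<forall>a\<in>set as. a \<noteq> 0" "test_fun \<psi>"
  shows "conv (kern as) (L_op as \<psi>) = \<psi>"
  using assms
proof (induction as rule: kern.induct)
  case (2 a)
  then show ?case using conv_exp_kernel_test_fun by simp
next
  case (3 a b as)
  have t: "test_fun (L_op (b # as) \<psi>)" using 3 by (intro test_fun_L_op)
  have "conv (kern (a # b # as)) (L_op (a # b # as) \<psi>)
      = conv (kern (b # as)) (conv (exp_kernel a) (L_op (a # b # as) \<psi>))"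
    by (intro conv_kern_Cons test_fun_bdd_meas test_fun_L_op) (use 3 in auto)
  also have "conv (exp_kernel a) (L_op (a # b # as) \<psi>) = L_op (b # as) \<psi>"
    using conv_exp_kernel_test_fun[OF _ t, of a] 3 by simp
  finally show ?case using 3 by simp
qed simp

lemma conv_exp_kernel_deriv_test:
  assumes "a \<noteq> 0" "test_fun \<psi>"
  shows "conv (exp_kernel a) (deriv \<psi>) = conv (dker a) \<psi>"
proof -
  have c: "C2_bdd \<psi> (deriv \<psi>) (deriv (deriv \<psi>))" by (rule test_fun_C2_bdd[OF assms(2)])
  then obtain B where "\<And>x. \<bar>\<psi> x\<bar> \<le> B" "\<And>x. \<bar>deriv \<psi> x\<bar> \<le> B" unfolding C2_bdd_def by blast
  moreover have "continuous_on UNIV (deriv \<psi>)"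
    using test_fun_continuous[OF test_fun_funpow[OF assms(2), of 1]] by simp
  ultimately show ?thesis
    using conv_exp_kernel_deriv[OF assms(1), of \<psi> "deriv \<psi>" B] c by (auto simp: C2_bdd_def)
qed

text \<open>Each factor of the kernel absorbs one derivative; the derivative of the kernel itself
  is never formed, so no regularity of \<open>kern as\<close> is needed.\<close>
lemma conv_kern_derivs:
  assumes "as \<noteq> []" "\<forall>a\<in>set as. a \<noteq> 0" "j \<le> length as"
  shows "\<exists>Q. integrable lborel Q \<and> bdd_meas Q \<and>
    (\<forall>\<psi>. test_fun \<psi> \<longrightarrow> conv (kern as) ((deriv ^^ j) \<psi>) = conv Q \<psi>)"
  using assms
proof (induction as arbitrary: j rule: kern.induct)
  case (2 a)
  consider "j = 0" | "j = 1" using 2 by force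
  then show ?case
  proof cases
    case 1
    then show ?thesis using integrable_kern[OF 2(1,2)] bdd_meas_kern[OF 2(1,2)] by auto
  next
    case 2
    then show ?thesis using \<open>\<forall>a\<in>set [a]. a \<noteq> 0\<close> integrable_dker bdd_meas_dker conv_exp_kernel_deriv_test
      by (intro exI[of _ "dker a"]) auto
  qed
next
  case (3 a b as)
  show ?case
  proof (cases j)
    case 0
    then show ?thesis using integrable_kern[OF 3(2,3)] bdd_meas_kern[OF 3(2,3)] by auto
  next
    case (Suc i)
    let ?L = "kern (b # as)"
    have ne: "b # as \<noteq> []" "\<forall>a\<in>set (b # as). a \<noteq> 0" "a \<noteq> 0" "i \<le> length (b # as)"
      using 3 Suc by auto
    obtain Q where Q: "integrable lborel Q" "bdd_meas Q"
        "\<And>\<psi>. test_fun \<psi> \<Longrightarrow> conv ?L ((deriv ^^ i) \<psi>) = conv Q \<psi>"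
      using 3(1)[OF ne(1,2,4)] by blast
    have "conv (kern (a # b # as)) ((deriv ^^ j) \<psi>) = conv (conv (dker a) Q) \<psi>" if t: "test_fun \<psi>" for \<psi>
    proof -
      have ti: "test_fun ((deriv ^^ i) \<psi>)" using t by (rule test_fun_funpow)
      have "conv (kern (a # b # as)) ((deriv ^^ j) \<psi>) = conv ?L (conv (exp_kernel a) ((deriv ^^ j) \<psi>))"
        using ne test_fun_bdd_meas[OF test_fun_funpow[OF t]] by (intro conv_kern_Cons) auto
      also have "conv (exp_kernel a) ((deriv ^^ j) \<psi>) = conv (dker a) ((deriv ^^ i) \<psi>)"
        using conv_exp_kernel_deriv_test[OF ne(3) ti] Suc by simp
      also have "conv ?L \<dots> = conv (conv ?L (dker a)) ((deriv ^^ i) \<psi>)"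
        using conv_assoc[OF integrable_kern[OF ne(1,2)] integrable_dker[OF ne(3)] test_fun_bdd_meas[OF ti]] by auto
      also have "\<dots> = conv (conv (dker a) ?L) ((deriv ^^ i) \<psi>)"
        by (subst conv_commute[of ?L]) simp
      also have "\<dots> = conv (dker a) (conv ?L ((deriv ^^ i) \<psi>))"
        using conv_assoc[OF integrable_dker[OF ne(3)] integrable_kern[OF ne(1,2)] test_fun_bdd_meas[OF ti]] by auto
      also have "\<dots> = conv (dker a) (conv Q \<psi>)" using Q(3)[OF t] by simp
      also have "\<dots> = conv (conv (dker a) Q) \<psi>"
        using conv_assoc[OF integrable_dker[OF ne(3)] Q(1) test_fun_bdd_meas[OF t]] by auto
      finally show ?thesis .
    qed
    then show ?thesis
      using integrable_conv_conv[OF integrable_dker[OF ne(3)] Q(1,2)] bdd_meas_conv[OF integrable_dker[OF ne(3)] Q(2)]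
      by blast
  qed
qed simp


section \<open>A smooth bump and a smooth step\<close>

lemma power_le_fact_exp:
  assumes "(s::real) \<ge> 0" shows "s ^ k \<le> fact k * exp s"
proof -
  have "(\<Sum>i\<in>{k}. s ^ i /\<^sub>R fact i) \<le> exp s"
    unfolding exp_def using assms summable_exp_generic[of s]
    by (intro sum_le_suminf) auto
  then show ?thesis by (simp add: field_simps)
qed

text \<open>The two parameters make the family closed under differentiation, as
  \<open>smooth_coinduct\<close> requires; the function of interest is the member with
  \<open>P = 1\<close> and \<open>n = 0\<close>.\<close>

definition bump :: "real poly \<Rightarrow> nat \<Rightarrow> real \<Rightarrow> real" where
  "bump P n x = (if \<bar>x\<bar> < 1 then poly P x / (1 - x\<^sup>2) ^ n * exp (- 1 / (1 - x\<^sup>2)) else 0)"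

text \<open>The exponential beats every power of \<open>1 - y\<^sup>2\<close>. A quadratic bound
  around each point outside the open interval gives derivative 0 there, and so treats the endpoints
  together with the exterior.\<close>

lemma bump_quadratic_bound: "\<exists>C. \<forall>x y. \<bar>x\<bar> \<ge> 1 \<longrightarrow> \<bar>bump P n y\<bar> \<le> C * \<bar>y - x\<bar>\<^sup>2"
proof -
  have "compact (poly P ` {-1..1})"
    by (intro compact_continuous_image) (auto intro!: continuous_intros)
  then obtain M where M: "M > 0" "\<And>x. x \<in> {-1..1} \<Longrightarrow> \<bar>poly P x\<bar> \<le> M"
    using compact_imp_bounded bounded_pos by (metis imageI real_norm_def)
  have "\<bar>bump P n y\<bar> \<le> (4 * M * fact (n + 2)) * \<bar>y - x\<bar>\<^sup>2" if "\<bar>x\<bar> \<ge> 1" for x y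
  proof (cases "\<bar>y\<bar> < 1")
    case True
    define D where "D = 1 - y\<^sup>2"
    have D: "0 < D" "D \<le> 1" using True by (auto simp: D_def abs_square_less_1)
    \<comment> \<open>Of these \<open>n + 2\<close> powers, \<open>n\<close> cancel the denominator
      of the bump and two remain as \<open>D\<^sup>2\<close>.\<close>
    have "(1 / D) ^ (n + 2) \<le> fact (n + 2) * exp (1 / D)"
      using D by (intro power_le_fact_exp) auto
    then have "1 / D ^ n * exp (- 1 / D) \<le> fact (n + 2) * D\<^sup>2"
      using D by (simp add: exp_minus field_simps power_add power2_eq_square)
    moreover have "D \<le> 2 * \<bar>y - x\<bar>"
    proof -
      have "D = (1 - \<bar>y\<bar>) * (1 + \<bar>y\<bar>)" by (simp add: D_def algebra_simps power2_eq_square)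
      also have "\<dots> \<le> (1 - \<bar>y\<bar>) * 2" using True by (intro mult_left_mono) auto
      also have "1 - \<bar>y\<bar> \<le> \<bar>y - x\<bar>" using \<open>\<bar>x\<bar> \<ge> 1\<close> by (simp add: abs_if split: if_splits)
      finally show ?thesis by simp
    qed
    then have "D\<^sup>2 \<le> (2 * \<bar>y - x\<bar>)\<^sup>2" using D by (intro power_mono) auto
    ultimately have le: "1 / D ^ n * exp (- 1 / D) \<le> fact (n + 2) * (2 * \<bar>y - x\<bar>)\<^sup>2"
      by (meson mult_left_mono order_trans fact_ge_zero)
    have "\<bar>bump P n y\<bar> = \<bar>poly P y\<bar> * (1 / D ^ n * exp (- 1 / D))"
      using True D by (simp add: bump_def D_def[symmetric] abs_mult)
    also have "\<dots> \<le> M * (fact (n + 2) * (2 * \<bar>y - x\<bar>)\<^sup>2)"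
    proof (rule mult_mono[OF _ le])
      show "\<bar>poly P y\<bar> \<le> M" using M(2)[of y] True by (auto simp: abs_less_iff)
    qed (use M(1) D in auto)
    finally show ?thesis by (simp add: power_mult_distrib algebra_simps)
  qed (use M in \<open>auto simp: bump_def\<close>)
  then show ?thesis by blast
qed

lemma DERIV_0_quadratic:
  fixes g :: "real \<Rightarrow> real"
  assumes "\<And>y. \<bar>g y - g x\<bar> \<le> C * \<bar>y - x\<bar>\<^sup>2"
  shows "(g has_real_derivative 0) (at x)"
  unfolding has_field_derivative_iff
proof (rule Lim_null_comparison)
  show "\<forall>\<^sub>F y in at x. norm ((g y - g x) / (y - x)) \<le> C * \<bar>y - x\<bar>"
    unfolding eventually_at_filter
  proof (intro always_eventually allI impI)
    fix y assume "y \<noteq> x"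
    then show "norm ((g y - g x) / (y - x)) \<le> C * \<bar>y - x\<bar>"
      using assms[of y] by (simp add: abs_divide divide_le_eq power2_eq_square mult.assoc)
  qed
  show "((\<lambda>y. C * \<bar>y - x\<bar>) \<longlongrightarrow> 0) (at x)"
    by (auto intro!: tendsto_eq_intros)
qed

text \<open>Here \<open>[:1, 0, -1:]\<close> is \<open>1 - x\<^sup>2\<close>. The exponent rises by
  2 because differentiating \<open>- 1 / (1 - x\<^sup>2)\<close> brings in the inverse square; the
  other two terms are put over the same denominator.\<close>

lemma DERIV_bump:
  "(bump P n has_real_derivative
    bump (pderiv P * [:1, 0, -1:] ^ 2 + [:0, 2 * real n:] * P * [:1, 0, -1:] - [:0, 2:] * P) (n + 2) x) (at x)"
  (is "(_ has_real_derivative bump ?P _ x) _")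
proof (cases "\<bar>x\<bar> < 1")
  case True
  define D where "D = 1 - x\<^sup>2"
  have D: "0 < D" using True by (auto simp: D_def abs_square_less_1)
  let ?g = "\<lambda>x. poly P x * inverse ((1 - x\<^sup>2) ^ n) * exp (- inverse (1 - x\<^sup>2))"
  \<comment> \<open>At \<open>n = 0\<close> the truncated exponent \<open>n - Suc 0\<close> does no
    harm, thanks to the factor \<open>real n\<close>.\<close>
  have pw: "real n * D ^ (n - Suc 0) * D = real n * D ^ n" by (cases n) auto
  have "(?g has_real_derivative (poly (pderiv P) x * inverse (D ^ n) * exp (- inverse D)
      + poly P x * (real n * D ^ (n - Suc 0) * (2 * x) * (inverse (D ^ n))\<^sup>2) * exp (- inverse D)
      + poly P x * inverse (D ^ n) * (exp (- inverse D) * - (2 * x * (inverse D)\<^sup>2)))) (at x)"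
    using D unfolding D_def
    by (auto intro!: derivative_eq_intros poly_DERIV simp: power2_eq_square algebra_simps)
  also have "(poly (pderiv P) x * inverse (D ^ n) * exp (- inverse D)
      + poly P x * (real n * D ^ (n - Suc 0) * (2 * x) * (inverse (D ^ n))\<^sup>2) * exp (- inverse D)
      + poly P x * inverse (D ^ n) * (exp (- inverse D) * - (2 * x * (inverse D)\<^sup>2)))
    = (poly (pderiv P) x * D\<^sup>2 + 2 * real n * x * poly P x * D - 2 * x * poly P x) / D ^ (n + 2) * exp (- inverse D)"
  proof -
    have "real n * D ^ (n - Suc 0) * (2 * x) * (inverse (D ^ n))\<^sup>2 = (real n * D ^ (n - Suc 0) * D) * (2 * x) * (inverse (D ^ n))\<^sup>2 * inverse D"
      using D by simp
    also have "\<dots> = real n * (2 * x) * inverse (D ^ n) * inverse D"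
      unfolding pw using D by (simp add: power2_eq_square)
    finally show ?thesis
      using D by (auto simp: field_simps power_add power2_eq_square)
  qed
  also have "\<dots> = bump ?P (n + 2) x"
    using True by (simp add: bump_def D_def power2_eq_square algebra_simps divide_inverse)
  finally show ?thesis
  proof (rule has_field_derivative_transform_within_open)
    show "open {-1<..<(1::real)}" by simp
  qed (use True in \<open>auto simp: bump_def divide_inverse\<close>)
next
  case False
  obtain C where C: "\<forall>x y. \<bar>x\<bar> \<ge> 1 \<longrightarrow> \<bar>bump P n y\<bar> \<le> C * \<bar>y - x\<bar>\<^sup>2"
    using bump_quadratic_bound by blast
  have "(bump P n has_real_derivative 0) (at x)"
    by (rule DERIV_0_quadratic[of _ _ C]) (use False C in \<open>auto simp: bump_def[of _ _ x]\<close>)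
  then show ?thesis using False by (simp add: bump_def)
qed

definition std_bump :: "real \<Rightarrow> real" where
  "std_bump = bump 1 0"

lemma std_bump_eq: "std_bump x = (if \<bar>x\<bar> < 1 then exp (- 1 / (1 - x\<^sup>2)) else 0)"
  by (simp add: std_bump_def bump_def)

lemma std_bump_nonneg: "std_bump x \<ge> 0" by (simp add: std_bump_eq)
lemma std_bump_pos: "\<bar>x\<bar> < 1 \<Longrightarrow> std_bump x > 0" by (simp add: std_bump_eq)
lemma std_bump_zero: "\<bar>x\<bar> \<ge> 1 \<Longrightarrow> std_bump x = 0" by (simp add: std_bump_eq)

lemma smooth_std_bump: "smooth std_bump"
  by (rule smooth_coinduct[where S = "range (\<lambda>(P, n). bump P n)"])
    (use DERIV_bump in \<open>fastforce simp: std_bump_def\<close>)+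

lemma test_fun_std_bump: "test_fun std_bump"
  unfolding test_fun_iff bounded_support_iff using smooth_std_bump std_bump_zero
  by (auto intro!: exI[of _ 1])

lemma test_fun_scaled_bump:
  assumes "e > 0" shows "test_fun (\<lambda>y. std_bump ((y - x) / e))"
proof -
  have "smooth (\<lambda>y. std_bump ((1 / e) * y + (- x / e)))" by (rule smooth_affine[OF smooth_std_bump])
  moreover have "\<forall>y. \<bar>y\<bar> > \<bar>x\<bar> + e \<longrightarrow> std_bump ((y - x) / e) = 0"
    using assms by (auto intro!: std_bump_zero simp: le_divide_eq)
  ultimately show ?thesis using assms
    unfolding test_fun_iff bounded_support_iff
    by (auto simp: diff_divide_distrib intro!: exI[of _ "\<bar>x\<bar> + e"])
qed

lemma smooth_step_exists:
  obtains \<Psi> c where "smooth \<Psi>" "\<And>x. (\<Psi> has_real_derivative std_bump x) (at x)"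
    "\<And>x. x \<le> -1 \<Longrightarrow> \<Psi> x = 0" "\<And>x. x \<ge> 1 \<Longrightarrow> \<Psi> x = c" "\<And>x. 0 \<le> \<Psi> x \<and> \<Psi> x \<le> c"
proof -
  \<comment> \<open>The base point \<open>-2\<close> lies to the left of the support of the bump;
    left of it the integral runs over an empty interval and is 0 as desired.\<close>
  define \<Psi> where "\<Psi> x = integral {-2..x} std_bump" for x
  have cont: "continuous_on S std_bump" for S
    using test_fun_continuous[OF test_fun_std_bump] by (rule continuous_on_subset) simp
  have zero: "\<Psi> x = 0" if "x \<le> -1" for x
  proof -
    have "\<Psi> x = integral {-2..x} (\<lambda>_. 0)"
      unfolding \<Psi>_def using that by (intro integral_cong std_bump_zero) auto
    then show ?thesis by simp
  qed
  have d: "(\<Psi> has_real_derivative std_bump x) (at x)" for x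
  proof (cases "x < -1")
    case True
    have "((\<lambda>_. 0) has_real_derivative std_bump x) (at x)"
      using True by (simp add: std_bump_zero)
    then show ?thesis
      by (rule has_field_derivative_transform_within_open[of _ _ _ "{..<-1}"]) (use True zero in auto)
  next
    case False
    have "(\<Psi> has_real_derivative std_bump x) (at x within {-2..x+1})"
      unfolding \<Psi>_def[abs_def] using False
      by (intro integral_has_real_derivative cont) auto
    moreover have "at x within {-2..x+1} = at x"
      using False by (intro at_within_interior) auto
    ultimately show ?thesis by simp
  qed
  have const: "\<Psi> x = \<Psi> 1" if "x \<ge> 1" for x
  proof (cases "x = 1")
    case False
    then have "1 < x" using that by simp
    obtain z where z: "1 < z" "z < x" "\<Psi> x - \<Psi> 1 = (x - 1) * std_bump z"
      using MVT2[OF \<open>1 < x\<close>, of \<Psi> std_bump] d by blast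
    then show ?thesis using std_bump_zero[of z] by simp
  qed simp
  have mono: "\<Psi> x \<le> \<Psi> y" if "x \<le> y" for x y
    by (rule DERIV_nonneg_imp_nondecreasing[OF that]) (use d std_bump_nonneg in blast)
  have "0 \<le> \<Psi> x \<and> \<Psi> x \<le> \<Psi> 1" for x
    using mono[of x 1] mono[of "-1" x] zero[of x] zero[of "-1"] const[of x]
    by (cases "x \<ge> 1"; cases "x \<le> -1") auto
  then show ?thesis
    using that[of \<Psi> "\<Psi> 1"] smooth_antideriv[OF d smooth_std_bump] d zero const by blast
qed

section \<open>Weak solutions and the integral equation\<close>

text \<open>Only derivatives of even order occur, so the operator commutes with reflections. This
  turns the weak equation into a statement about convolutions with test functions.\<close>

lemma L_op_reflect:
  assumes "test_fun \<psi>"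
  shows "L_op as (\<lambda>y. \<psi> (c - y)) = (\<lambda>y. L_op as \<psi> (c - y))"
proof (induction as)
  case (Cons a as)
  have d: "deriv (\<lambda>y. u (c - y)) = (\<lambda>y. - deriv u (c - y))" if "test_fun u" for u
  proof
    fix y
    have "((\<lambda>y. u (c - y)) has_real_derivative deriv u (c - y) * (0 - 1)) (at y)"
      using that by (intro DERIV_chain2[OF smooth_DERIV]) (auto simp: test_fun_iff intro!: derivative_eq_intros)
    then show "deriv (\<lambda>y. u (c - y)) y = - deriv u (c - y)" by (auto dest: DERIV_imp_deriv)
  qed
  have t: "test_fun (L_op as \<psi>)" using assms by (rule test_fun_L_op)
  have t': "test_fun (deriv (L_op as \<psi>))" using test_fun_funpow[OF t, of 1] by simp
  have "deriv (deriv (\<lambda>y. L_op as \<psi> (c - y))) y = deriv (deriv (L_op as \<psi>)) (c - y)" for y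
  proof -
    have "deriv (deriv (\<lambda>y. L_op as \<psi> (c - y))) y = deriv (\<lambda>y. - deriv (L_op as \<psi>) (c - y)) y"
      by (simp add: d[OF t])
    also have "\<dots> = - deriv (\<lambda>y. deriv (L_op as \<psi>) (c - y)) y"
      using smooth_DERIV[of "\<lambda>y. deriv (L_op as \<psi>) (c - y)" y] test_fun_reflect[OF t', of c]
      by (intro DERIV_imp_deriv DERIV_minus) (auto simp: test_fun_iff)
    finally show ?thesis by (simp add: d[OF t'])
  qed
  then show ?case by (simp add: Cons)
qed simp

lemma integrable_continuous_test:
  assumes "continuous_on UNIV u" "test_fun \<psi>"
  shows "integrable lborel (\<lambda>x. u x * \<psi> x)"
proof -
  obtain R where R: "\<forall>x. \<bar>x\<bar> > R \<longrightarrow> \<psi> x = 0"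
    using assms by (auto simp: test_fun_iff bounded_support_iff)
  show ?thesis
    by (rule compact_support_continuous(1)[of _ R])
      (use assms(1) test_fun_continuous[OF assms(2)] R in \<open>auto intro!: continuous_intros\<close>)
qed

lemma continuous_pos_nbhd:
  fixes u :: "real \<Rightarrow> real"
  assumes "continuous_on UNIV u" "u x > c"
  obtains e where "0 < e" "e \<le> 1" "\<And>y. \<bar>y - x\<bar> < e \<Longrightarrow> u y > c"
proof -
  have "(u \<longlongrightarrow> u x) (nhds x)"
    using assms(1) tendsto_at_iff_tendsto_nhds by (simp add: continuous_on_eq_continuous_at isCont_def) blast
  then have "eventually (\<lambda>y. u y > c) (nhds x)"
    using assms(2) by (rule order_tendstoD)
  then obtain d where "d > 0" "\<And>y. \<bar>y - x\<bar> < d \<Longrightarrow> u y > c"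
    unfolding eventually_nhds_metric dist_real_def by blast
  then show ?thesis using that[of "min d 1"] by auto
qed

text \<open>Fundamental lemma of the calculus of variations: if \<open>u x > 0\<close>, a bump
  supported where \<open>u\<close> is positive has a positive pairing with \<open>u\<close>.\<close>

lemma continuous_test_nonpos:
  assumes "continuous_on UNIV u" "\<And>\<psi>. test_fun \<psi> \<Longrightarrow> (LINT y|lborel. u y * \<psi> y) = 0"
  shows "u x \<le> 0"
proof (rule ccontr)
  assume "\<not> u x \<le> 0"
  then obtain e where e: "0 < e" "\<And>y. \<bar>y - x\<bar> < e \<Longrightarrow> u y > 0"
    using continuous_pos_nbhd[OF assms(1), of 0 x] by auto
  let ?\<psi> = "\<lambda>y. std_bump ((y - x) / e)"
  have t: "test_fun ?\<psi>" by (rule test_fun_scaled_bump[OF e(1)])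
  have "(LINT y|lborel. u y * ?\<psi> y) > 0"
  proof (rule integral_pos_real[OF integrable_continuous_test[OF assms(1) t], of "x - e" "x + e"])
    show "0 \<le> u y * ?\<psi> y" for y
    proof (cases "\<bar>y - x\<bar> < e")
      case True
      then show ?thesis using e(2)[OF True] std_bump_nonneg by simp
    next
      case False
      then show ?thesis using e(1) std_bump_zero[of "(y - x) / e"] by simp
    qed
    show "0 < u y * ?\<psi> y" if "x - e < y" "y < x + e" for y
    proof -
      have "\<bar>y - x\<bar> < e" using that by (simp add: abs_less_iff)
      then show ?thesis using e std_bump_pos[of "(y - x) / e"] by (simp add: abs_divide)
    qed
  qed (use e in auto)
  then show False using assms(2)[OF t] by simp
qed

lemma continuous_test_zero:
  assumes "continuous_on UNIV u" "\<And>\<psi>. test_fun \<psi> \<Longrightarrow> (LINT y|lborel. u y * \<psi> y) = 0"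
  shows "u x = 0"
proof -
  have "- u x \<le> 0"
    by (rule continuous_test_nonpos[of "\<lambda>y. - u y"]) (use assms in \<open>auto intro!: continuous_intros\<close>)
  with continuous_test_nonpos[of u x] assms show ?thesis by auto
qed

text \<open>Writing a test function as \<open>\<psi> = kern as * L \<psi>\<close> moves the weak equation from \<open>L \<psi>\<close> to \<open>\<psi>\<close>
  by associativity of convolution.\<close>
lemma weak_solution_eq_conv:
  assumes as: "as \<noteq> []" "\<forall>a\<in>set as. a \<noteq> 0"
    and u: "continuous_on UNIV u" "\<And>x. \<bar>u x\<bar> \<le> B"
    and h: "bdd_meas h" "\<And>x. h x \<ge> 0"
    and weak: "\<And>\<psi>. test_fun \<psi> \<Longrightarrow> (LINT x|lborel. u x * L_op as \<psi> x) = (LINT x|lborel. h x * \<psi> x)"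
  shows "u = conv (kern as) h"
proof -
  obtain A where "sym_kernel (kern as) A" using sym_kernel_kern[OF as] by blast
  then interpret sym_kernel "kern as" A .
  have ub: "bdd_meas u" using u by (rule bdd_meas_continuous)
  have wb: "bdd_meas (conv (kern as) h)" by (rule bdd_meas_conv[OF integrable h(1)])
  \<comment> \<open>Both sides are mollified first. Continuity of \<open>u\<close> and of the
    convolution removes the mollifier afterwards.\<close>
  have eq: "conv \<psi> u x = conv \<psi> (conv (kern as) h) x" if t: "test_fun \<psi>" for \<psi> x
  proof -
    have tL: "test_fun (L_op as \<psi>)" by (rule test_fun_L_op[OF t])
    have 1: "conv (L_op as \<psi>) u = conv \<psi> h"
    proof
      fix x
      have "conv (L_op as \<psi>) u x = (LINT y|lborel. u y * L_op as (\<lambda>y. \<psi> (x - y)) y)"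
        by (simp add: L_op_reflect[OF t] conv_def mult.commute)
      also have "\<dots> = (LINT y|lborel. h y * \<psi> (x - y))" by (rule weak[OF test_fun_reflect[OF t]])
      finally show "conv (L_op as \<psi>) u x = conv \<psi> h x" by (simp add: conv_def mult.commute)
    qed
    have "conv \<psi> u x = conv (conv (kern as) (L_op as \<psi>)) u x" by (simp add: conv_kern_L_op[OF as t])
    also have "\<dots> = conv (kern as) (conv (L_op as \<psi>) u) x"
      by (rule conv_assoc[symmetric, OF integrable test_fun_integrable[OF tL] ub])
    also have "\<dots> = conv (kern as) (conv \<psi> h) x" by (simp add: 1)
    also have "\<dots> = conv (conv (kern as) \<psi>) h x"
      by (rule conv_assoc[OF integrable test_fun_integrable[OF t] h(1)])
    also have "\<dots> = conv (conv \<psi> (kern as)) h x" by (subst conv_commute[of "kern as"]) simp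
    also have "\<dots> = conv \<psi> (conv (kern as) h) x"
      by (rule conv_assoc[symmetric, OF test_fun_integrable[OF t] integrable h(1)])
    finally show ?thesis .
  qed
  have "u x - conv (kern as) h x = 0" for x
  proof (rule continuous_test_zero[of "\<lambda>x. u x - conv (kern as) h x"])
    show "continuous_on UNIV (\<lambda>x. u x - conv (kern as) h x)"
      by (intro continuous_intros u conv_continuous h)
    show "(LINT y|lborel. (u y - conv (kern as) h y) * \<psi> y) = 0" if t: "test_fun \<psi>" for \<psi>
    proof -
      \<comment> \<open>A pairing with \<open>\<psi>\<close> is the convolution with the reflected
        \<open>\<psi>\<close>, evaluated at 0.\<close>
      have "conv (\<lambda>y. \<psi> (0 - y)) u 0 - conv (\<lambda>y. \<psi> (0 - y)) (conv (kern as) h) 0 = 0"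
        using eq[OF test_fun_reflect[OF t, of 0], of 0] by simp
      then have "conv (\<lambda>y. \<psi> (0 - y)) (\<lambda>y. u y - conv (kern as) h y) 0 = 0"
        by (subst conv_diff[OF test_fun_integrable[OF test_fun_reflect[OF t]] ub wb])
      then show ?thesis by (simp add: conv_def mult.commute)
    qed
  qed
  then show ?thesis by auto
qed

text \<open>Sobolev embedding, adapted to the weak derivative as defined. The test function is a
  smooth step of width \<open>e\<close> at \<open>x\<close> minus one of width 1; its derivative is
  a narrow bump minus a unit bump. Hence the local average of \<open>u\<close> at \<open>x\<close>
  is controlled by square integrals that depend on neither \<open>x\<close> nor
  \<open>e\<close>.\<close>

lemma H1_bounded:
  assumes c: "continuous_on UNIV u" and u: "L2_fun u" and g: "L2_fun g" "weak_deriv 1 u g"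
  obtains B where "\<And>x. u x \<le> B"
proof -
  obtain \<Psi> C where \<Psi>: "smooth \<Psi>" "\<And>x. (\<Psi> has_real_derivative std_bump x) (at x)"
    "\<And>x. x \<le> -1 \<Longrightarrow> \<Psi> x = 0" "\<And>x. x \<ge> 1 \<Longrightarrow> \<Psi> x = C" "\<And>x. 0 \<le> \<Psi> x \<and> \<Psi> x \<le> C"
    by (rule smooth_step_exists) blast
  define \<beta> where "\<beta> = (LINT x|lborel. std_bump x)"
  have \<beta>: "\<beta> > 0" unfolding \<beta>_def
    by (rule integral_pos_real[OF test_fun_integrable[OF test_fun_std_bump], of "-1" 1])
      (auto simp: std_bump_nonneg intro!: std_bump_pos)
  have ib2: "integrable lborel (\<lambda>t. (std_bump t)\<^sup>2)"
    unfolding power2_eq_square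
    by (intro integrable_mult_bdd_meas test_fun_integrable test_fun_bdd_meas test_fun_std_bump)
  define M where "M = (LINT t|lborel. (g t)\<^sup>2) + 2 * C\<^sup>2 + (LINT t|lborel. (u t)\<^sup>2) + (LINT t|lborel. (std_bump t)\<^sup>2)"
  have "(u x - 1) * \<beta> \<le> M" for x
  proof -
    have "u x > u x - 1" by simp
    then obtain e where e: "0 < e" "e \<le> 1" "\<And>y. \<bar>y - x\<bar> < e \<Longrightarrow> u y > u x - 1"
      using continuous_pos_nbhd[OF c, of "u x - 1" x] by blast
    \<comment> \<open>Both steps rise to the same constant, so the difference has compact support
      although neither step does.\<close>
    let ?\<psi> = "\<lambda>t. \<Psi> ((t - x) / e) - \<Psi> (t - x)"
    let ?b = "\<lambda>t. std_bump ((t - x) / e) / e" and ?b1 = "\<lambda>t. std_bump (t - x)"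
    have out: "?\<psi> t = 0" if "\<bar>t - x\<bar> > 1" for t
    proof (cases "t > x")
      case True
      then have "(t - x) / e \<ge> 1" "t - x \<ge> 1" using that e by (auto simp: le_divide_eq)
      then show ?thesis using \<Psi>(4) by simp
    next
      case False
      then have "(t - x) / e \<le> -1" "t - x \<le> -1" using that e by (auto simp: divide_le_eq)
      then show ?thesis using \<Psi>(3) by simp
    qed
    have sm: "smooth ?\<psi>"
      using smooth_lincomb[OF smooth_affine[OF \<Psi>(1), of "1/e" "-x/e"] smooth_affine[OF \<Psi>(1), of 1 "-x"], of 1 "-1"]
      by (simp add: diff_divide_distrib)
    have t: "test_fun ?\<psi>"
    proof -
      have "\<forall>t. \<bar>t\<bar> > \<bar>x\<bar> + 1 \<longrightarrow> ?\<psi> t = 0" using out by auto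
      then show ?thesis unfolding test_fun_iff bounded_support_iff
        by (intro conjI sm exI[of _ "\<bar>x\<bar> + 1"]) auto
    qed
    have "(?\<psi> has_real_derivative ?b t - ?b1 t) (at t)" for t
      using e(1) by (auto intro!: derivative_eq_intros DERIV_chain2[OF \<Psi>(2)])
    then have d: "deriv ?\<psi> = (\<lambda>t. ?b t - ?b1 t)" using DERIV_imp_deriv by blast
    have tb: "test_fun (\<lambda>t. std_bump ((t - x) / e))" "test_fun ?b1"
      using test_fun_scaled_bump[OF e(1), of x] test_fun_scaled_bump[of 1 x] by auto
    have Ib: "integrable lborel (\<lambda>t. u t * ?b t)" "integrable lborel (\<lambda>t. u t * ?b1 t)"
      using integrable_continuous_test[OF c tb(1)] integrable_continuous_test[OF c tb(2)] by auto
    have "(LINT t|lborel. u t * deriv ?\<psi> t) = - (LINT t|lborel. g t * ?\<psi> t)"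
      using g(2) t by (auto simp: weak_deriv_def)
    then have w: "(LINT t|lborel. u t * ?b t) = (LINT t|lborel. u t * ?b1 t) - (LINT t|lborel. g t * ?\<psi> t)"
      unfolding d using Ib by (simp add: right_diff_distrib)
    have ab: "a * b \<le> a\<^sup>2 + b\<^sup>2" for a b :: real
      using sum_squares_bound[of a b] zero_le_power2[of a] zero_le_power2[of b] by linarith
    have "(LINT t|lborel. u t * ?b1 t) \<le> (LINT t|lborel. (u t)\<^sup>2 + (?b1 t)\<^sup>2)"
      using u lborel_integrable_shift[OF ib2, of x] Ib(2) ab
      by (intro integral_mono) (auto simp: L2_fun_def)
    also have "\<dots> = (LINT t|lborel. (u t)\<^sup>2) + (LINT t|lborel. (std_bump t)\<^sup>2)"
      using u lborel_integrable_shift[OF ib2, of x] lborel_integral_shift[of "\<lambda>t. (std_bump t)\<^sup>2" x]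
      by (simp add: L2_fun_def)
    finally have 1: "(LINT t|lborel. u t * ?b1 t) \<le> (LINT t|lborel. (u t)\<^sup>2) + (LINT t|lborel. (std_bump t)\<^sup>2)" .
    have p2: "(?\<psi> t)\<^sup>2 \<le> C\<^sup>2 * indicator {x - 1..x + 1} t" for t
    proof (cases "\<bar>t - x\<bar> > 1")
      case True
      then show ?thesis using out by simp
    next
      case False
      have "\<bar>?\<psi> t\<bar> \<le> C" using \<Psi>(5)[of "(t - x) / e"] \<Psi>(5)[of "t - x"] by linarith
      then have "(?\<psi> t)\<^sup>2 \<le> C\<^sup>2" by (rule abs_le_square_iff[THEN iffD1, OF order_trans]) simp
      then show ?thesis using False by (auto simp: indicator_def abs_le_iff not_less)
    qed
    have "- (LINT t|lborel. g t * ?\<psi> t) = (LINT t|lborel. (- g t) * ?\<psi> t)" by simp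
    also have "\<dots> \<le> (LINT t|lborel. (g t)\<^sup>2 + C\<^sup>2 * indicator {x - 1..x + 1} t)"
    proof (rule integral_mono')
      show "integrable lborel (\<lambda>t. (g t)\<^sup>2 + C\<^sup>2 * indicator {x - 1..x + 1} t)"
        using g(1) by (auto simp: L2_fun_def)
      show "(- g t) * ?\<psi> t \<le> (g t)\<^sup>2 + C\<^sup>2 * indicator {x - 1..x + 1} t" for t
        using ab[of "- g t" "?\<psi> t"] p2[of t] by simp
      show "0 \<le> (g t)\<^sup>2 + C\<^sup>2 * indicator {x - 1..x + 1} t" for t by simp
    qed
    also have "\<dots> = (LINT t|lborel. (g t)\<^sup>2) + 2 * C\<^sup>2"
      using g(1) by (simp add: L2_fun_def)
    finally have 2: "- (LINT t|lborel. g t * ?\<psi> t) \<le> (LINT t|lborel. (g t)\<^sup>2) + 2 * C\<^sup>2" .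
    have "\<beta> = (LINT t|lborel. ?b t)"
      using lborel_integral_real_affine[of "1/e" std_bump "-x/e"] e(1)
      by (simp add: \<beta>_def diff_divide_distrib)
    then have "(u x - 1) * \<beta> = (LINT t|lborel. (u x - 1) * ?b t)" by simp
    also have "\<dots> \<le> (LINT t|lborel. u t * ?b t)"
    proof (rule integral_mono)
      show "integrable lborel (\<lambda>t. (u x - 1) * ?b t)" using test_fun_integrable[OF tb(1)] by simp
      show "(u x - 1) * ?b t \<le> u t * ?b t" for t
      proof (cases "\<bar>t - x\<bar> < e")
        case True
        then show ?thesis using e(3)[OF True] e(1) std_bump_nonneg by (intro mult_right_mono) auto
      next
        case False
        then show ?thesis using e(1) std_bump_zero[of "(t - x) / e"] by simp
      qed
    qed (rule Ib)
    finally show ?thesis using w 1 2 by (simp add: M_def)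
  qed
  then have "u x \<le> M / \<beta> + 1" for x using \<beta> by (simp add: field_simps)
  then show ?thesis using that by blast
qed

text \<open>A value of at least \<open>\<rho>\<close> at \<open>x\<close> forces
  \<open>u \<ge> exp (- A) * \<rho>\<close> on \<open>{x..x+1}\<close>, hence a fixed amount
  \<open>exp (- 2 * A) * \<rho>\<^sup>2\<close> of the integral of \<open>u\<^sup>2\<close>. The
  tails of that integral tend to 0.\<close>

lemma harnack_L2_vanishes:
  fixes u :: "real \<Rightarrow> real"
  assumes "A > 0" "\<And>x. u x \<ge> 0" "\<And>x t. exp (- A * \<bar>t\<bar>) * u x \<le> u (x + t)"
    and L2: "integrable lborel (\<lambda>x. (u x)\<^sup>2)" and "\<rho> > 0"
  shows "\<exists>R>0. \<forall>x. \<bar>x\<bar> \<ge> R \<longrightarrow> u x < \<rho>"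
proof -
  let ?I = "\<lambda>n x. indicator {x. \<bar>x\<bar> \<ge> real n} x * (u x)\<^sup>2"
  have m: "{x::real. \<bar>x\<bar> \<ge> real n} \<in> sets borel" for n by measurable
  have I: "integrable lborel (?I n)" for n
    using integrable_mult_indicator[OF _ L2, of "{x. \<bar>x\<bar> \<ge> real n}"] m by simp
  have "(\<lambda>n. LINT x|lborel. ?I n x) \<longlonglongrightarrow> (LINT x::real|lborel. 0)"
  proof (rule integral_dominated_convergence[OF _ _ L2])
    show "AE x in lborel. (\<lambda>n. ?I n x) \<longlonglongrightarrow> 0"
    proof (rule AE_I2)
      fix x
      obtain N where N: "\<bar>x\<bar> < real N" using reals_Archimedean2 by blast
      have "eventually (\<lambda>n. ?I n x = 0) sequentially"
        using eventually_ge_at_top[of N] by eventually_elim (use N in \<open>auto simp: indicator_def\<close>)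
      then show "(\<lambda>n. ?I n x) \<longlonglongrightarrow> 0" by (rule tendsto_eventually)
    qed
  qed (use I in \<open>auto simp: indicator_def\<close>)
  then have "(\<lambda>n. LINT x|lborel. ?I n x) \<longlonglongrightarrow> 0" by simp
  moreover have "exp (- 2 * A) * \<rho>\<^sup>2 > 0" using assms by simp
  ultimately have "eventually (\<lambda>n. (LINT x|lborel. ?I n x) < exp (- 2 * A) * \<rho>\<^sup>2) sequentially"
    by (rule order_tendstoD)
  then obtain n where n: "(LINT x|lborel. ?I n x) < exp (- 2 * A) * \<rho>\<^sup>2"
    by (auto simp: eventually_sequentially)
  have "u x < \<rho>" if "\<bar>x\<bar> \<ge> real n + 1" for x
  proof -
    have "exp (- 2 * A) * (u x)\<^sup>2 = (LINT y|lborel. indicator {x..x+1} y * (exp (- 2 * A) * (u x)\<^sup>2))"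
      by simp
    also have "\<dots> \<le> (LINT y|lborel. ?I n y)"
    proof (rule integral_mono[OF _ I])
      fix y
      show "indicator {x..x+1} y * (exp (- 2 * A) * (u x)\<^sup>2) \<le> ?I n y"
      proof (cases "y \<in> {x..x+1}")
        case True
        then have y: "\<bar>y\<bar> \<ge> real n" "\<bar>y - x\<bar> \<le> 1" using that by auto
        have "exp (- A) * u x \<le> exp (- A * \<bar>y - x\<bar>) * u x"
          using y(2) assms(1,2) by (intro mult_right_mono) (auto simp: mult_le_cancel_left1)
        also have "\<dots> \<le> u y" using assms(3)[of "y - x" x] by simp
        finally have "(exp (- A) * u x)\<^sup>2 \<le> (u y)\<^sup>2" using assms(2) by (intro power_mono) auto
        also have "(exp (- A) * u x)\<^sup>2 = exp (- 2 * A) * (u x)\<^sup>2"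
          by (simp add: power_mult_distrib exp_double[symmetric] mult.commute)
        finally show ?thesis using True y by simp
      qed (auto simp: indicator_def)
    qed simp
    finally have "exp (- 2 * A) * (u x)\<^sup>2 < exp (- 2 * A) * \<rho>\<^sup>2" using n by (rule le_less_trans)
    then have "(u x)\<^sup>2 < \<rho>\<^sup>2" by simp
    then show ?thesis using \<open>\<rho> > 0\<close> by (simp add: power2_less_imp_less)
  qed
  then show ?thesis by (intro exI[of _ "real n + 1"]) auto
qed

lemma L2_fun_if_integrable_bdd:
  assumes "integrable lborel u" "bdd_meas u" shows "L2_fun u"
  using integrable_mult_bdd_meas[OF assms] bdd_meas_measurable[OF assms(2)]
  by (simp add: L2_fun_def power2_eq_square)

text \<open>The derivatives on the test function are absorbed by the kernel, giving
  \<open>conv Q \<psi>\<close>, and the adjoint identity moves \<open>Q\<close> onto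
  \<open>h\<close>. The weak derivative is thus \<open>(-1) ^ j\<close> times the convolution of
  \<open>h\<close> with the reflected \<open>Q\<close>, which is bounded and integrable.\<close>

lemma sobolev_conv_kern:
  assumes as: "as \<noteq> []" "\<forall>a\<in>set as. a \<noteq> 0" and h: "integrable lborel h" "bdd_meas h"
  shows "sobolev_H (length as) (conv (kern as) h)"
    and "test_fun \<psi> \<Longrightarrow> (LINT x|lborel. conv (kern as) h x * L_op as \<psi> x) = (LINT x|lborel. h x * \<psi> x)"
proof -
  obtain A where "sym_kernel (kern as) A" using sym_kernel_kern[OF as] by blast
  then interpret sym_kernel "kern as" A .
  have swap: "(LINT x|lborel. conv (kern as) h x * \<psi> x) = (LINT x|lborel. h x * conv (kern as) \<psi> x)"
    if "test_fun \<psi>" for \<psi>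
    using integral_conv_swap_even[OF test_fun_integrable[OF that] integrable h(2) even] by (simp add: mult.commute)
  show "(LINT x|lborel. conv (kern as) h x * L_op as \<psi> x) = (LINT x|lborel. h x * \<psi> x)" if "test_fun \<psi>"
    using swap[OF test_fun_L_op[OF that]] conv_kern_L_op[OF as that] by simp
  have L2: "L2_fun (conv Q h)" if "integrable lborel Q" for Q
    using integrable_conv_conv[OF that h] bdd_meas_conv[OF that h(2)] by (rule L2_fun_if_integrable_bdd)
  have "\<exists>g. L2_fun g \<and> weak_deriv j (conv (kern as) h) g" if j: "j \<le> length as" for j
  proof -
    obtain Q where Q: "integrable lborel Q" "\<And>\<psi>. test_fun \<psi> \<Longrightarrow> conv (kern as) ((deriv ^^ j) \<psi>) = conv Q \<psi>"
      using conv_kern_derivs[OF as j] by blast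
    let ?g = "\<lambda>x. (-1) ^ j * conv (\<lambda>x. Q (- x)) h x"
    have Q': "integrable lborel (\<lambda>x. Q (- x))" using lborel_integrable_reflect[OF Q(1), of 0] by simp
    have "L2_fun ?g" using L2[OF Q'] by (auto simp: L2_fun_def power_mult_distrib)
    moreover have "weak_deriv j (conv (kern as) h) ?g"
      unfolding weak_deriv_def
    proof (intro allI impI)
      fix \<psi> assume t: "test_fun \<psi>"
      have "(LINT x|lborel. conv (kern as) h x * (deriv ^^ j) \<psi> x) = (LINT x|lborel. h x * conv Q \<psi> x)"
        using swap[OF test_fun_funpow[OF t]] Q(2)[OF t] by simp
      also have "\<dots> = (LINT x|lborel. \<psi> x * conv (\<lambda>x. Q (- x)) h x)"
        by (rule integral_conv_swap[OF h(1) Q(1) test_fun_bdd_meas[OF t]])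
      also have "\<dots> = (-1) ^ j * (LINT x|lborel. ?g x * \<psi> x)"
      proof -
        have sq: "(-1::real) ^ j * (-1) ^ j = 1" by (simp add: power_mult_distrib[symmetric])
        have "(-1) ^ j * (LINT x|lborel. ?g x * \<psi> x) = (LINT x|lborel. (-1) ^ j * (?g x * \<psi> x))" by simp
        also have "(\<lambda>x. (-1) ^ j * (?g x * \<psi> x)) = (\<lambda>x. ((-1) ^ j * (-1) ^ j) * (\<psi> x * conv (\<lambda>x. Q (- x)) h x))"
          by (simp only: mult.assoc mult.commute[of "\<psi> _"])
        finally show ?thesis by (simp only: sq mult_1_left)
      qed
      finally show "(LINT x|lborel. conv (kern as) h x * (deriv ^^ j) \<psi> x) = (-1) ^ j * (LINT x|lborel. ?g x * \<psi> x)" .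
    qed
    ultimately show ?thesis by blast
  qed
  then show "sobolev_H (length as) (conv (kern as) h)"
    using L2[OF integrable] by (auto simp: sobolev_H_def)
qed

section \<open>Symmetry by moving planes\<close>

text \<open>The condition \<open>superlinear\<close> says that \<open>f r / r powr p\<close> is
  nondecreasing for \<open>r > 0\<close>. The vanishing of \<open>f'\<close> at 0 makes the
  nonlinear term a small perturbation wherever a solution is small, in particular near
  infinity.\<close>

locale nonlinearity =
  fixes f f' :: "real \<Rightarrow> real" and p :: real
  assumes deriv: "(f has_real_derivative f' x) (at x)"
    and cont_f': "continuous_on UNIV f'"
    and f_0: "f 0 = 0" and f'_0: "f' 0 = 0"
    and f_pos: "r > 0 \<Longrightarrow> f r > 0"
    and p_gt_1: "p > 1"
    and superlinear: "p * r * f r \<le> r\<^sup>2 * f' r"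
begin

lemma f'_ge: "r > 0 \<Longrightarrow> p * (f r / r) \<le> f' r"
  using superlinear[of r] by (simp add: field_simps power2_eq_square)

lemma f'_pos: "r > 0 \<Longrightarrow> f' r > 0"
  using less_le_trans[OF mult_pos_pos[OF _ divide_pos_pos[OF f_pos]] f'_ge, of r] p_gt_1 by simp

lemma f_nonneg: "r \<ge> 0 \<Longrightarrow> f r \<ge> 0"
  using f_pos[of r] f_0 by (cases "r = 0") auto

lemma cont_f: "continuous_on UNIV f"
  using deriv by (meson DERIV_continuous continuous_at_imp_continuous_on)

lemma f_strict_mono: "0 \<le> a \<Longrightarrow> a < b \<Longrightarrow> f a < f b"
proof (rule DERIV_pos_imp_increasing_open[of a b f])
  show "\<exists>y. (f has_real_derivative y) (at x) \<and> 0 < y" if "0 \<le> a" "a < x" for x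
    using deriv f'_pos[of x] that by auto
  show "continuous_on {a..b} f" using cont_f by (rule continuous_on_subset) simp
qed auto

lemma f_mono: "0 \<le> a \<Longrightarrow> a \<le> b \<Longrightarrow> f a \<le> f b"
  using f_strict_mono[of a b] by (cases "a = b") auto

lemma f_diff_le:
  assumes "\<And>r. a \<le> r \<Longrightarrow> r \<le> b \<Longrightarrow> f' r \<le> M" "a \<le> b"
  shows "f b - f a \<le> M * (b - a)"
proof (cases "a = b")
  case False
  then obtain z where "a < z" "z < b" "f b - f a = (b - a) * f' z"
    using MVT2[of a b f f'] deriv assms(2) by auto
  then show ?thesis using assms(1)[of z] by (simp add: mult.commute mult_left_mono)
qed simp

lemma f_diff_ge:
  assumes "\<And>r. a \<le> r \<Longrightarrow> r \<le> b \<Longrightarrow> M \<le> f' r" "a \<le> b"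
  shows "M * (b - a) \<le> f b - f a"
proof (cases "a = b")
  case False
  then obtain z where "a < z" "z < b" "f b - f a = (b - a) * f' z"
    using MVT2[of a b f f'] deriv assms(2) by auto
  then show ?thesis using assms(1)[of z] by (simp add: mult.commute mult_left_mono)
qed simp

lemma f'_small:
  assumes "\<eta> > 0" obtains \<rho> where "\<rho> > 0" "\<And>r. 0 \<le> r \<Longrightarrow> r \<le> \<rho> \<Longrightarrow> f' r \<le> \<eta>"
proof -
  have "continuous_on UNIV (\<lambda>r. - f' r)" by (intro continuous_intros cont_f')
  then obtain e where e: "e > 0" "\<And>r. \<bar>r - 0\<bar> < e \<Longrightarrow> - f' r > - \<eta>"
    using continuous_pos_nbhd[of "\<lambda>r. - f' r" "- \<eta>" 0] assms f'_0 by auto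
  show ?thesis
  proof (rule that[of "e / 2"])
    show "f' r \<le> \<eta>" if "0 \<le> r" "r \<le> e / 2" for r using e(2)[of r] that e(1) by simp
  qed (use e in simp)
qed

lemma f'_bounded: obtains M where "M > 0" "\<And>r. 0 \<le> r \<Longrightarrow> r \<le> B \<Longrightarrow> f' r \<le> M"
proof -
  have "compact (f' ` {0..B})"
    using cont_f' by (intro compact_continuous_image) (auto intro: continuous_on_subset)
  then obtain M where M: "M > 0" "\<And>r. r \<in> {0..B} \<Longrightarrow> \<bar>f' r\<bar> \<le> M"
    using compact_imp_bounded bounded_pos by (metis imageI real_norm_def)
  have "f' r \<le> M" if "0 \<le> r" "r \<le> B" for r using M(2)[of r] that by simp
  then show ?thesis using that M(1) by blast
qed

lemma bdd_meas_comp: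
  assumes "u \<in> borel_measurable borel" "\<And>x. 0 \<le> u x" "\<And>x. u x \<le> B"
  shows "bdd_meas (\<lambda>x. f (u x))"
proof (rule bdd_measI[where B = "f B"])
  have "f \<in> borel_measurable borel" using cont_f by (rule borel_measurable_continuous_onI)
  then show "(\<lambda>x. f (u x)) \<in> borel_measurable borel" using assms(1) by measurable
  show "\<bar>f (u x)\<bar> \<le> f B" for x using f_nonneg f_mono assms(2,3) by (simp add: abs_of_nonneg)
qed

end

locale moving_planes = sym_kernel K A + nonlinearity f f' p
  for K A f f' p +
  fixes \<phi> :: "real \<Rightarrow> real" and B :: real
  assumes \<phi>_pos: "\<phi> x > 0" and \<phi>_le: "\<phi> x \<le> B"
    and \<phi>_cont: "continuous_on UNIV \<phi>"
    and \<phi>_eq: "\<phi> x = conv K (\<lambda>y. f (\<phi> y)) x"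
    and \<phi>_vanishes: "\<rho> > 0 \<Longrightarrow> \<exists>R>0. \<forall>x. \<bar>x\<bar> \<ge> R \<longrightarrow> \<phi> x < \<rho>"
begin

lemma bdd_g: "bdd_meas (\<lambda>y. f (\<phi> y))"
  using \<phi>_pos \<phi>_le \<phi>_cont by (intro bdd_meas_comp[of _ B]) (auto intro: less_imp_le borel_measurable_continuous_onI)

lemma \<phi>_lipschitz: "\<bar>\<phi> x - \<phi> y\<bar> \<le> A * B * \<bar>x - y\<bar>"
proof -
  have "\<bar>conv K (\<lambda>y. f (\<phi> y)) x - conv K (\<lambda>y. f (\<phi> y)) y\<bar> \<le> A * B * \<bar>x - y\<bar>"
    by (rule conv_lipschitz[OF bdd_g]) (simp_all add: \<phi>_eq[symmetric] \<phi>_le f_nonneg less_imp_le[OF \<phi>_pos])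
  then show ?thesis by (simp add: \<phi>_eq[symmetric])
qed

text \<open>Maximum principle on a half-line: where \<open>\<phi>\<close> exceeds its reflection, the linearised
  coefficient \<open>f'\<close> is small except on a short interval, so the sup norm of the positive part of
  \<open>\<phi> - \<phi> \<circ> reflection\<close> is contracted.\<close>
lemma reflect_le_half_line:
  assumes \<eta>: "\<eta> \<ge> 0" "\<And>r. 0 \<le> r \<Longrightarrow> r \<le> \<rho> \<Longrightarrow> f' r \<le> \<eta>"
    and M: "M \<ge> 0" "\<And>r. 0 \<le> r \<Longrightarrow> r \<le> B \<Longrightarrow> f' r \<le> M"
    and d: "d \<ge> 0"
    and small: "\<And>y. y > l \<Longrightarrow> \<phi> y > \<phi> (2 * l - y) \<Longrightarrow> y \<le> l + d \<or> \<phi> y \<le> \<rho>"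
    and contr: "\<eta> * (LINT y|lborel. K y) + 2 * d * M * K 0 < 1"
    and x: "x > l"
  shows "\<phi> x \<le> \<phi> (2 * l - x)"
proof -
  define w where "w y = max 0 (\<phi> y - \<phi> (2 * l - y))" for y
  define s where "s = (SUP y\<in>{l<..}. w y)"
  have w_le: "w y \<le> B" for y using \<phi>_pos[of "2 * l - y"] \<phi>_le[of y] \<phi>_pos[of y] by (simp add: w_def)
  have bdd: "bdd_above (w ` {l<..})" using w_le by (intro bdd_aboveI[of _ B]) auto
  have s: "w y \<le> s" if "y > l" for y unfolding s_def using that by (intro cSUP_upper bdd) auto
  have s0: "s \<ge> 0" using s[of "l + 1"] by (simp add: w_def)
  define I where "I x y = (K (x - y) - K (2 * l - x - y)) * (f (\<phi> y) - f (\<phi> (2 * l - y)))" for x y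
  \<comment> \<open>The short interval next to the plane, doubled symmetrically because the
    reflection identity integrates over the whole line.\<close>
  define ch :: "real \<Rightarrow> real" where "ch y = indicator {l - d..l + d} y" for y
  have bound1: "I x y \<le> s * (\<eta> * (K (x - y) + K (2 * l - x - y)) + 2 * K 0 * M * ch y)"
    if x: "x > l" and y: "y > l" for x y
  proof -
    have D: "K (2 * l - x - y) < K (x - y)" using x y by (intro less_abs) auto
    have rhs: "0 \<le> \<eta> * (K (x - y) + K (2 * l - x - y)) + 2 * K 0 * M * ch y"
      using pos[of "x - y"] pos[of "2 * l - x - y"] pos[of 0] \<eta>(1) M(1) by (auto simp: ch_def)
    show ?thesis
    proof (cases "\<phi> y > \<phi> (2 * l - y)")
      case False
      then have "f (\<phi> y) \<le> f (\<phi> (2 * l - y))" using \<phi>_pos by (intro f_mono) (auto intro: less_imp_le)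
      then have "I x y \<le> 0" using D by (simp add: I_def mult_nonneg_nonpos)
      also have "0 \<le> s * (\<eta> * (K (x - y) + K (2 * l - x - y)) + 2 * K 0 * M * ch y)"
        using s0 rhs by simp
      finally show ?thesis .
    next
      case True
      let ?v = "\<phi> y - \<phi> (2 * l - y)"
      have v: "0 \<le> ?v" "?v \<le> s" using s[OF y] True by (auto simp: w_def)
      have nn: "0 \<le> \<phi> (2 * l - y)" using \<phi>_pos by (rule less_imp_le)
      consider "\<phi> y \<le> \<rho>" | "y \<le> l + d" using small[OF y True] by blast
      then show ?thesis
      proof cases
        case 1
        have "f (\<phi> y) - f (\<phi> (2 * l - y)) \<le> \<eta> * ?v"
          using 1 nn True by (intro f_diff_le \<eta>(2)) auto
        also have "\<dots> \<le> \<eta> * s" using \<eta>(1) v by (intro mult_left_mono) auto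
        finally have "I x y \<le> (K (x - y) - K (2 * l - x - y)) * (\<eta> * s)"
          unfolding I_def using D by (intro mult_left_mono) auto
        also have "\<dots> \<le> (K (x - y) + K (2 * l - x - y)) * (\<eta> * s)"
          using pos[of "2 * l - x - y"] \<eta>(1) s0 by (intro mult_right_mono) auto
        also have "\<dots> \<le> s * (\<eta> * (K (x - y) + K (2 * l - x - y)) + 2 * K 0 * M * ch y)"
          using s0 M(1) pos[of 0] by (simp add: algebra_simps ch_def)
        finally show ?thesis .
      next
        case 2
        have "f (\<phi> y) - f (\<phi> (2 * l - y)) \<le> M * ?v"
        proof (rule f_diff_le[OF M(2)])
          fix r assume "\<phi> (2 * l - y) \<le> r" "r \<le> \<phi> y"
          then show "0 \<le> r" "r \<le> B" using nn \<phi>_le[of y] by auto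
        qed (use True in simp)
        also have "\<dots> \<le> M * s" using M(1) v by (intro mult_left_mono) auto
        finally have "I x y \<le> (K (x - y) - K (2 * l - x - y)) * (M * s)"
          unfolding I_def using D by (intro mult_left_mono) auto
        also have "\<dots> \<le> (2 * K 0) * (M * s)"
          using pos[of "2 * l - x - y"] le_0[of "x - y"] pos[of "x - y"] M(1) s0 by (intro mult_right_mono) auto
        also have "\<dots> = s * (2 * K 0 * M * ch y)" using 2 y d by (simp add: ch_def)
        also have "\<dots> \<le> s * (\<eta> * (K (x - y) + K (2 * l - x - y)) + 2 * K 0 * M * ch y)"
          using s0 \<eta>(1) pos[of "x - y"] pos[of "2 * l - x - y"] by (intro mult_left_mono) auto
        finally show ?thesis .
      qed
    qed
  qed
  \<comment> \<open>Integrand and bound are both invariant under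
    \<open>y \<mapsto> 2 * l - y\<close>, so the estimate on the right half-line suffices.\<close>
  have bound: "I x y \<le> s * (\<eta> * (K (x - y) + K (2 * l - x - y)) + 2 * K 0 * M * ch y)" if x: "x > l" for x y
  proof -
    consider "y > l" | "y < l" | "y = l" by linarith
    then show ?thesis
    proof cases
      case 2
      have e: "K (x - (2 * l - y)) = K (2 * l - x - y)" "K (2 * l - x - (2 * l - y)) = K (x - y)"
        using even[of "x - (2 * l - y)"] even[of "x - y"] by (simp_all add: algebra_simps)
      have "ch (2 * l - y) = ch y" by (auto simp: ch_def indicator_def)
      moreover have "I x (2 * l - y) = I x y" unfolding I_def e by (simp add: algebra_simps)
      ultimately show ?thesis using bound1[OF x, of "2 * l - y"] 2 unfolding e by (simp add: add.commute)
    next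
      case 3
      have "K (x - l) = K (2 * l - x - l)" using even[of "x - l"] by (simp add: algebra_simps)
      then have "I x y = 0" using 3 by (simp add: I_def)
      then show ?thesis using s0 \<eta>(1) M(1) pos[of "x - y"] pos[of "2 * l - x - y"] pos[of 0]
        by (auto simp: ch_def)
    qed (rule bound1[OF x])
  qed
  \<comment> \<open>Half of \<open>\<eta>\<close> times two copies of the mass of \<open>K\<close>,
    plus half of \<open>2 * K 0 * M\<close> times the window length \<open>2 * d\<close>.\<close>
  define \<theta> where "\<theta> = \<eta> * (LINT y|lborel. K y) + 2 * d * M * K 0"
  have key: "\<phi> x - \<phi> (2 * l - x) \<le> \<theta> * s" if x: "x > l" for x
  proof -
    have iK: "integrable lborel (\<lambda>y. K (c - y))" "(LINT y|lborel. K (c - y)) = (LINT y|lborel. K y)" for c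
      using lborel_integrable_reflect[OF integrable] lborel_integral_reflect[of K] by auto
    have ich: "integrable lborel ch" "(LINT y|lborel. ch y) = 2 * d"
      unfolding ch_def using d by auto
    have "\<phi> x - \<phi> (2 * l - x) = (LINT y|lborel. I x y) / 2"
      using conv_reflect_identity(1)[OF integrable even bdd_g, of x l] by (simp add: I_def \<phi>_eq[symmetric])
    also have "(LINT y|lborel. I x y) \<le> (LINT y|lborel. s * (\<eta> * (K (x - y) + K (2 * l - x - y)) + 2 * K 0 * M * ch y))"
    proof (rule integral_mono)
      show "integrable lborel (I x)"
        using conv_reflect_identity(2)[OF integrable even bdd_g, of x l] by (simp add: I_def[abs_def])
    qed (use iK ich bound[OF x] in auto)
    also have "\<dots> = s * (\<eta> * (2 * (LINT y|lborel. K y)) + 2 * K 0 * M * (2 * d))"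
      using iK ich by simp
    finally show ?thesis by (simp add: \<theta>_def algebra_simps)
  qed
  have \<theta>: "\<theta> < 1" "\<theta> \<ge> 0"
    using contr \<eta>(1) d M(1) pos[of 0] integral_pos by (auto simp: \<theta>_def)
  have "(SUP y\<in>{l<..}. w y) \<le> \<theta> * s"
  proof (rule cSUP_least)
    show "w y \<le> \<theta> * s" if "y \<in> {l<..}" for y
      using key[of y] that \<theta> s0 by (simp add: w_def)
  qed simp
  then have "(1 - \<theta>) * s \<le> 0" by (simp add: s_def[symmetric] algebra_simps)
  then have "s \<le> 0" using \<theta> by (simp add: mult_le_0_iff)
  then show ?thesis using s[OF x] by (simp add: w_def)
qed

definition good :: "real \<Rightarrow> bool" where
  "good l \<longleftrightarrow> (\<forall>x>l. \<phi> x \<le> \<phi> (2 * l - x))"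

text \<open>The plane is moved in from the right to the infimum \<open>l\<close> of the good
  positions. If \<open>\<phi>\<close> were not symmetric about \<open>l\<close>, the inequality at
  \<open>l\<close> would be strict on the whole half-line, hence uniformly strict on a compact set;
  by the Lipschitz bound it would persist for nearby planes. Points close to the plane or far out
  are handled by \<open>reflect_le_half_line\<close>, so the plane could move further.\<close>

theorem symmetric: "\<exists>c. \<forall>x. \<phi> (2 * c - x) = \<phi> x"
proof -
  define J where "J = (LINT y|lborel. K y)"
  have J: "J > 0" using integral_pos by (simp add: J_def)
  \<comment> \<open>With this \<open>\<eta>\<close> and the \<open>d\<close> below, the contraction
    factor is at most \<open>1 / 2 + 1 / 4\<close>.\<close>
  define \<eta> where "\<eta> = 1 / (2 * J)"
  have \<eta>: "\<eta> > 0" "\<eta> * J = 1 / 2" using J by (auto simp: \<eta>_def)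
  obtain \<rho> where \<rho>: "\<rho> > 0" "\<And>r. 0 \<le> r \<Longrightarrow> r \<le> \<rho> \<Longrightarrow> f' r \<le> \<eta>" using f'_small[OF \<eta>(1)] by blast
  obtain M where M: "M > 0" "\<And>r. 0 \<le> r \<Longrightarrow> r \<le> B \<Longrightarrow> f' r \<le> M" using f'_bounded by blast
  define d where "d = 1 / (8 * M * K 0)"
  have d: "d > 0" "2 * d * M * K 0 = 1 / 4" using M(1) pos[of 0] by (auto simp: d_def field_simps)
  obtain R where R: "R > 0" "\<And>x. \<bar>x\<bar> \<ge> R \<Longrightarrow> \<phi> x < \<rho>" using \<phi>_vanishes[OF \<rho>(1)] by blast
  have goodI: "good l" if "\<And>y. y > l \<Longrightarrow> \<phi> y > \<phi> (2 * l - y) \<Longrightarrow> y \<le> l + d \<or> y \<ge> R" for l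
    unfolding good_def
  proof (intro allI impI)
    fix x assume "x > l"
    then show "\<phi> x \<le> \<phi> (2 * l - x)"
    proof (rule reflect_le_half_line[where \<eta> = \<eta> and \<rho> = \<rho> and M = M and d = d and l = l, rotated 7])
      show "y \<le> l + d \<or> \<phi> y \<le> \<rho>" if "y > l" "\<phi> y > \<phi> (2 * l - y)" for y
        using \<open>\<And>y. y > l \<Longrightarrow> \<phi> y > \<phi> (2 * l - y) \<Longrightarrow> y \<le> l + d \<or> y \<ge> R\<close>[OF that] R(2)[of y] by (auto intro: less_imp_le)
      show "\<eta> * (LINT y|lborel. K y) + 2 * d * M * K 0 < 1" using \<eta>(2) d(2) by (simp add: J_def)
    qed (use \<eta> \<rho> M d in auto)
  qed
  define G where "G = {l. \<forall>m\<ge>l. good m}"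
  have "good m" if "m \<ge> R" for m using that by (intro goodI) auto
  then have "R \<in> G" by (auto simp: G_def)
  have Gup: "m \<in> G" if "l \<in> G" "l \<le> m" for l m using that by (auto simp: G_def)
  have bdd: "bdd_below G"
  proof (rule ccontr)
    assume nb: "\<not> bdd_below G"
    have all: "good m" for m
    proof -
      obtain l where "l \<in> G" "l < m" using nb by (meson bdd_belowI not_le)
      then show ?thesis by (auto simp: G_def)
    qed
    \<comment> \<open>If every plane were good, reflecting about midpoints would make
      \<open>\<phi>\<close> nonincreasing on the line, against its decay at minus infinity.\<close>
    have le: "\<phi> x \<le> \<phi> y" if "y < x" for x y
    proof -
      have "(x + y) / 2 < x" using that by simp
      then have "\<phi> x \<le> \<phi> (2 * ((x + y) / 2) - x)" using all[of "(x + y) / 2"] unfolding good_def by blast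
      moreover have "2 * ((x + y) / 2) - x = y" by (simp add: field_simps)
      ultimately show ?thesis by simp
    qed
    obtain R' where R': "R' > 0" "\<And>x. \<bar>x\<bar> \<ge> R' \<Longrightarrow> \<phi> x < \<phi> 0" using \<phi>_vanishes[OF \<phi>_pos[of 0]] by blast
    show False using R'(2)[of "- R'"] R'(1) le[of "- R'" 0] by simp
  qed
  define l where "l = Inf G"
  have lG: "m \<in> G" if "m > l" for m
  proof -
    obtain k where "k \<in> G" "k < m"
      using \<open>m > l\<close> cInf_less_iff[OF _ bdd, of m] \<open>R \<in> G\<close> unfolding l_def by blast
    then show ?thesis using Gup by auto
  qed
  have AB: "A * B \<ge> 0" using A_pos \<phi>_pos[of 0] \<phi>_le[of 0] by simp
  have good_l: "good l"
    unfolding good_def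
  proof (intro allI impI)
    fix x assume x: "x > l"
    have "((\<lambda>m. \<phi> (2 * m - x)) \<longlongrightarrow> \<phi> (2 * l - x)) (at_right l)"
      using \<phi>_cont by (intro continuous_on_tendsto_compose[OF \<phi>_cont] tendsto_intros) auto
    moreover have "eventually (\<lambda>m. \<phi> x \<le> \<phi> (2 * m - x)) (at_right l)"
      using eventually_at_right_less[of l] eventually_at_right_real[OF x]
    proof eventually_elim
      case (elim m)
      then show ?case using lG[of m] by (auto simp: G_def good_def)
    qed
    ultimately show "\<phi> x \<le> \<phi> (2 * l - x)" by (rule tendsto_lowerbound) simp
  qed
  have sym: "\<phi> x = \<phi> (2 * l - x)" if x: "x > l" for x
  proof (rule ccontr)
    assume "\<phi> x \<noteq> \<phi> (2 * l - x)"
    then have "\<phi> x < \<phi> (2 * l - x)" using good_l x by (auto simp: good_def less_le)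
    define z0 where "z0 = 2 * l - x"
    have z0: "z0 < l" "\<phi> z0 - \<phi> (2 * l - z0) > 0" using x \<open>\<phi> x < \<phi> (2 * l - x)\<close> by (auto simp: z0_def)
    have "continuous_on UNIV (\<lambda>z. \<phi> z - \<phi> (2 * l - z))"
      by (intro continuous_intros \<phi>_cont continuous_on_compose2[OF \<phi>_cont]) auto
    then obtain e where e: "0 < e" "\<And>z. \<bar>z - z0\<bar> < e \<Longrightarrow> \<phi> z - \<phi> (2 * l - z) > 0"
      using continuous_pos_nbhd[of "\<lambda>z. \<phi> z - \<phi> (2 * l - z)" 0 z0] z0(2) by blast
    have strict: "\<phi> y < \<phi> (2 * l - y)" if y: "y > l" for y
    proof -
      have "conv K (\<lambda>y. f (\<phi> y)) (2 * l - (2 * l - y)) < conv K (\<lambda>y. f (\<phi> y)) (2 * l - y)"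
      proof (rule conv_reflect_less[OF bdd_g, of "2 * l - y" l "z0 - e" "min l (z0 + e)"])
        show "f (\<phi> (2 * l - z)) \<le> f (\<phi> z)" if "z < l" for z
          using good_l[unfolded good_def, rule_format, of "2 * l - z"] that \<phi>_pos
          by (intro f_mono) (auto intro: less_imp_le)
        show "f (\<phi> (2 * l - z)) < f (\<phi> z)" if "z0 - e < z" "z < min l (z0 + e)" for z
          using e(2)[of z] that \<phi>_pos by (intro f_strict_mono) (auto intro: less_imp_le simp: abs_less_iff)
      qed (use y z0 e in auto)
      then show ?thesis by (simp add: \<phi>_eq[symmetric])
    qed
    define R' where "R' = max R (l + d)"
    \<comment> \<open>A plane \<open>m \<ge> l - d / 2\<close> and a point \<open>y > m + d\<close>
      give \<open>y > l + d / 2\<close>, so this set contains all points below \<open>R\<close> that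
      are not close to a nearby plane.\<close>
    let ?S = "{l + d / 2..R'}"
    let ?h = "\<lambda>y. \<phi> (2 * l - y) - \<phi> y"
    have "?S \<noteq> {}" using d(1) by (auto simp: R'_def)
    moreover have "continuous_on ?S ?h"
      by (rule continuous_on_subset[of UNIV]) (intro continuous_intros \<phi>_cont continuous_on_compose2[OF \<phi>_cont], auto)
    ultimately obtain y0 where y0: "y0 \<in> ?S" "\<And>y. y \<in> ?S \<Longrightarrow> ?h y0 \<le> ?h y"
      using continuous_attains_inf[OF compact_Icc] by (metis (no_types, lifting))
    define \<delta> where "\<delta> = ?h y0"
    have \<delta>: "\<delta> > 0" using strict[of y0] y0(1) d(1) by (auto simp: \<delta>_def)
    \<comment> \<open>Moving the plane by \<open>\<epsilon>\<close> moves reflected points by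
      \<open>2 * \<epsilon>\<close> and changes \<open>\<phi>\<close> there by at most
      \<open>A * B * (2 * \<epsilon>)\<close>; the \<open>+ 1\<close> makes this strictly less than
      \<open>\<delta>\<close>.\<close>
    define \<epsilon> where "\<epsilon> = min (d / 2) (\<delta> / (2 * (A * B + 1)))"
    have \<epsilon>: "\<epsilon> > 0" "\<epsilon> \<le> d / 2" "\<epsilon> \<le> \<delta> / (2 * (A * B + 1))"
    proof -
      show "\<epsilon> > 0" unfolding \<epsilon>_def using \<delta> d(1) AB by (auto intro!: divide_pos_pos)
    qed (simp_all only: \<epsilon>_def min.cobounded1 min.cobounded2)
    have \<epsilon>2: "A * B * (2 * \<epsilon>) < \<delta>"
    proof -
      have "2 * \<epsilon> * (A * B + 1) \<le> \<delta>" using \<epsilon>(3) AB by (simp add: field_simps)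
      then show ?thesis using \<epsilon>(1) by (simp add: algebra_simps)
    qed
    have "good m" if m: "l - \<epsilon> \<le> m" "m \<le> l" for m
    proof (rule goodI)
      fix y assume y: "y > m" "\<phi> y > \<phi> (2 * m - y)"
      show "y \<le> m + d \<or> y \<ge> R"
      proof (rule ccontr)
        assume "\<not> ?thesis"
        then have yS: "y \<in> ?S" using m \<epsilon> by (auto simp: R'_def)
        have "\<bar>\<phi> (2 * l - y) - \<phi> (2 * m - y)\<bar> \<le> A * B * \<bar>(2 * l - y) - (2 * m - y)\<bar>" by (rule \<phi>_lipschitz)
        also have "\<dots> \<le> A * B * (2 * \<epsilon>)" using m AB by (intro mult_left_mono) auto
        finally have "\<phi> (2 * m - y) > \<phi> (2 * l - y) - \<delta>" using \<epsilon>2 by linarith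
        then show False using y0(2)[OF yS] y(2) by (simp add: \<delta>_def)
      qed
    qed
    then have "l - \<epsilon> \<in> G"
    proof -
      assume gd: "\<And>m. l - \<epsilon> \<le> m \<Longrightarrow> m \<le> l \<Longrightarrow> good m"
      have "good m" if "l - \<epsilon> \<le> m" for m
        using gd[of m] lG[of m] that by (cases "m \<le> l") (auto simp: G_def)
      then show ?thesis by (simp add: G_def)
    qed
    then have "l \<le> l - \<epsilon>" unfolding l_def using bdd by (intro cInf_lower)
    then show False using \<epsilon>(1) by simp
  qed
  have "\<phi> (2 * l - x) = \<phi> x" for x
  proof -
    consider "x > l" | "2 * l - x > l" | "2 * l - x = x" by linarith
    then show ?thesis
    proof cases
      case 1
      then show ?thesis by (rule sym[symmetric])
    next
      case 2
      from sym[OF this] show ?thesis by (simp only: diff_diff_eq2 add_diff_cancel_left')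
    qed simp
  qed
  then show ?thesis by blast
qed

end

section \<open>Fixed points and passage to the limit\<close>

text \<open>The dimension \<open>n\<close> is a variable here, so Brouwer's theorem is derived from Kuhn's
  combinatorial lemma instead of its version for Euclidean types.\<close>
lemma brouwer_unit_cube:
  fixes F :: "(nat \<Rightarrow> real) \<Rightarrow> nat \<Rightarrow> real"
  assumes maps: "\<And>x i. (\<And>j. j < n \<Longrightarrow> 0 \<le> x j \<and> x j \<le> 1) \<Longrightarrow> i < n \<Longrightarrow> 0 \<le> F x i \<and> F x i \<le> 1"
    and cont: "\<And>X x i. (\<And>k j. j < n \<Longrightarrow> 0 \<le> X k j \<and> X k j \<le> 1) \<Longrightarrow>
      (\<And>j. j < n \<Longrightarrow> (\<lambda>k. X k j) \<longlonglongrightarrow> x j) \<Longrightarrow> i < n \<Longrightarrow> (\<lambda>k. F (X k) i) \<longlonglongrightarrow> F x i"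
  obtains x where "\<And>j. j < n \<Longrightarrow> 0 \<le> x j \<and> x j \<le> 1" "\<And>i. i < n \<Longrightarrow> F x i = x i"
proof -
  have approx: "\<exists>q. (\<forall>i<n. q i < Suc k) \<and> (\<forall>i<n. \<exists>r s. (\<forall>j<n. q j \<le> r j \<and> r j \<le> q j + 1) \<and>
      (\<forall>j<n. q j \<le> s j \<and> s j \<le> q j + 1) \<and>
      F (\<lambda>j. real (r j) / real (Suc k)) i \<ge> real (r i) / real (Suc k) \<and>
      F (\<lambda>j. real (s j) / real (Suc k)) i \<le> real (s i) / real (Suc k))" for k :: nat
  proof -
    define P where "P = Suc k"
    have P: "0 < P" by (simp add: P_def)
    \<comment> \<open>Label 1 means that \<open>F\<close> decreases the coordinate. The faces are
      labelled by force, as Kuhn's lemma demands; there the required inequality holds because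
      \<open>F\<close> maps the cube into itself.\<close>
    define label where "label z i = (if z i = P \<or> (z i \<noteq> 0 \<and> F (\<lambda>j. real (z j) / real P) i < real (z i) / real P) then 1 else 0 :: nat)"
      for z :: "nat \<Rightarrow> nat" and i
    obtain q where q: "\<forall>i<n. q i < P" "\<forall>i<n. \<exists>r s. (\<forall>j<n. q j \<le> r j \<and> r j \<le> q j + 1) \<and>
        (\<forall>j<n. q j \<le> s j \<and> s j \<le> q j + 1) \<and> label r i \<noteq> label s i"
      by (rule kuhn_lemma[OF P, of n label]) (use P in \<open>auto simp: label_def\<close>)
    have cube: "0 \<le> real (z j) / real P \<and> real (z j) / real P \<le> 1" if "\<forall>j<n. q j \<le> z j \<and> z j \<le> q j + 1" "j < n" for z j
      using that q(1) P by (fastforce simp: divide_le_eq)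
    have l0: "F (\<lambda>j. real (z j) / real P) i \<ge> real (z i) / real P"
      if "\<forall>j<n. q j \<le> z j \<and> z j \<le> q j + 1" "i < n" "label z i = 0" for z i
      using that maps[of "\<lambda>j. real (z j) / real P" i] cube[OF that(1)]
      by (cases "z i = 0") (auto simp: label_def split: if_splits)
    have l1: "F (\<lambda>j. real (z j) / real P) i \<le> real (z i) / real P"
      if "\<forall>j<n. q j \<le> z j \<and> z j \<le> q j + 1" "i < n" "label z i = 1" for z i
      using that maps[of "\<lambda>j. real (z j) / real P" i] cube[OF that(1)] P
      by (cases "z i = P") (auto simp: label_def split: if_splits)
    have "\<exists>r s. (\<forall>j<n. q j \<le> r j \<and> r j \<le> q j + 1) \<and> (\<forall>j<n. q j \<le> s j \<and> s j \<le> q j + 1) \<and>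
      F (\<lambda>j. real (r j) / real P) i \<ge> real (r i) / real P \<and>
      F (\<lambda>j. real (s j) / real P) i \<le> real (s i) / real P" if i: "i < n" for i
    proof -
      obtain r s where rs: "\<forall>j<n. q j \<le> r j \<and> r j \<le> q j + 1" "\<forall>j<n. q j \<le> s j \<and> s j \<le> q j + 1" "label r i \<noteq> label s i"
        using q(2) i by blast
      then consider "label r i = 0" "label s i = 1" | "label r i = 1" "label s i = 0"
        by (auto simp: label_def split: if_splits)
      then show ?thesis
      proof cases
        case 1
        then show ?thesis using l0[OF rs(1) i] l1[OF rs(2) i] rs by blast
      next
        case 2
        then show ?thesis using l0[OF rs(2) i] l1[OF rs(1) i] rs by blast
      qed
    qed
    then show ?thesis using q(1) unfolding P_def by blast
  qed
  then obtain q where q: "\<And>k i. i < n \<Longrightarrow> q k i < Suc k"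
    and ex: "\<And>k i. i < n \<Longrightarrow> \<exists>r s. (\<forall>j<n. q k j \<le> r j \<and> r j \<le> q k j + 1) \<and>
      (\<forall>j<n. q k j \<le> s j \<and> s j \<le> q k j + 1) \<and>
      F (\<lambda>j. real (r j) / real (Suc k)) i \<ge> real (r i) / real (Suc k) \<and>
      F (\<lambda>j. real (s j) / real (Suc k)) i \<le> real (s i) / real (Suc k)"
    by metis
  obtain m where m: "strict_mono m" "\<And>j. j \<in> {..<n} \<Longrightarrow> \<exists>l. (\<lambda>k. real (q (m k) j) / real (Suc (m k))) \<longlonglongrightarrow> l"
  proof (rule function_convergent_subsequence[of "{..<n}" "\<lambda>k j. real (q k j) / real (Suc k)" 1])
    show "norm (real (q k j) / real (Suc k)) \<le> 1" if "j \<in> {..<n}" for k j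
      using q[of j k] that by (simp add: divide_le_eq)
  qed auto
  then obtain x where x: "\<And>j. j < n \<Longrightarrow> (\<lambda>k. real (q (m k) j) / real (Suc (m k))) \<longlonglongrightarrow> x j"
    by (metis lessThan_iff)
  have x01: "0 \<le> x j \<and> x j \<le> 1" if "j < n" for j
  proof
    show "0 \<le> x j" by (rule LIMSEQ_le_const[OF x[OF that]]) auto
    have "real (q (m k) j) / real (Suc (m k)) \<le> 1" for k
      using q[OF that, of "m k"] by (simp add: divide_le_eq)
    then show "x j \<le> 1" by (intro LIMSEQ_le_const2[OF x[OF that]]) auto
  qed
  \<comment> \<open>The vertices of the selected small cubes all converge to the same point, which
    lets the two opposite inequalities meet at \<open>x\<close>.\<close>
  have lim: "(\<lambda>k. real (r k j) / real (Suc (m k))) \<longlonglongrightarrow> x j"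
    if "j < n" "\<And>k. q (m k) j \<le> r k j \<and> r k j \<le> q (m k) j + 1" for r :: "nat \<Rightarrow> nat \<Rightarrow> nat" and j
  proof (rule tendsto_sandwich[OF _ _ x[OF that(1)]])
    show "\<forall>\<^sub>F k in sequentially. real (q (m k) j) / real (Suc (m k)) \<le> real (r k j) / real (Suc (m k))"
      using that(2) by (intro always_eventually allI divide_right_mono) auto
    show "\<forall>\<^sub>F k in sequentially. real (r k j) / real (Suc (m k)) \<le> real (q (m k) j) / real (Suc (m k)) + inverse (real (Suc (m k)))"
    proof (intro always_eventually allI)
      fix k
      have "real (r k j) \<le> real (q (m k) j) + 1" using that(2)[of k] by linarith
      then have "real (r k j) / real (Suc (m k)) \<le> (real (q (m k) j) + 1) / real (Suc (m k))"
        by (rule divide_right_mono) simp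
      then show "real (r k j) / real (Suc (m k)) \<le> real (q (m k) j) / real (Suc (m k)) + inverse (real (Suc (m k)))"
        by (simp add: add_divide_distrib inverse_eq_divide)
    qed
    have "(\<lambda>k. inverse (real (Suc (m k)))) \<longlonglongrightarrow> 0"
      using LIMSEQ_subseq_LIMSEQ[OF LIMSEQ_inverse_real_of_nat m(1)] by (simp add: o_def)
    from tendsto_add[OF x[OF that(1)] this]
    show "(\<lambda>k. real (q (m k) j) / real (Suc (m k)) + inverse (real (Suc (m k)))) \<longlonglongrightarrow> x j" by simp
  qed
  have "F x i = x i" if i: "i < n" for i
  proof -
    obtain r s where rs: "\<And>k j. j < n \<Longrightarrow> q k j \<le> r k j \<and> r k j \<le> q k j + 1"
      "\<And>k j. j < n \<Longrightarrow> q k j \<le> s k j \<and> s k j \<le> q k j + 1"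
      "\<And>k. F (\<lambda>j. real (r k j) / real (Suc k)) i \<ge> real (r k i) / real (Suc k)"
      "\<And>k. F (\<lambda>j. real (s k j) / real (Suc k)) i \<le> real (s k i) / real (Suc k)"
      using ex[OF i] by metis
    have cube: "0 \<le> real (z (m k) j) / real (Suc (m k)) \<and> real (z (m k) j) / real (Suc (m k)) \<le> 1"
      if "\<And>k j. j < n \<Longrightarrow> q k j \<le> z k j \<and> z k j \<le> q k j + 1" "j < n" for z :: "nat \<Rightarrow> nat \<Rightarrow> nat" and k j
    proof -
      have "z (m k) j \<le> Suc (m k)" using that(1)[OF that(2), of "m k"] q[OF that(2), of "m k"] by linarith
      then show ?thesis by (simp add: divide_le_eq)
    qed
    have 1: "(\<lambda>k. F (\<lambda>j. real (r (m k) j) / real (Suc (m k))) i) \<longlonglongrightarrow> F x i"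
      by (rule cont[OF cube[OF rs(1)] lim i]) (use rs(1) in auto)
    have 2: "(\<lambda>k. F (\<lambda>j. real (s (m k) j) / real (Suc (m k))) i) \<longlonglongrightarrow> F x i"
      by (rule cont[OF cube[OF rs(2)] lim i]) (use rs(2) in auto)
    have "x i \<le> F x i"
      by (rule LIMSEQ_le[OF lim[OF i, of "\<lambda>k. r (m k)"] 1]) (use rs(1)[OF i] rs(3) in auto)
    moreover have "F x i \<le> x i"
      by (rule LIMSEQ_le[OF 2 lim[OF i, of "\<lambda>k. s (m k)"]]) (use rs(2)[OF i] rs(4) in auto)
    ultimately show ?thesis by simp
  qed
  then show ?thesis using that x01 by blast
qed

text \<open>A diagonal subsequence converges at all rationals, and the common Lipschitz constant
  carries the Cauchy property over to every real point.\<close>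

lemma lipschitz_convergent_subsequence:
  fixes u :: "nat \<Rightarrow> real \<Rightarrow> real"
  assumes "\<And>k x. \<bar>u k x\<bar> \<le> B" and lip: "\<And>k x y. \<bar>u k x - u k y\<bar> \<le> C * \<bar>x - y\<bar>"
  obtains m v where "strict_mono m" "\<And>x. (\<lambda>k. u (m k) x) \<longlonglongrightarrow> v x"
proof -
  have C: "C \<ge> 0" using lip[of 0 0 1] by simp
  obtain m where m: "strict_mono m" "\<And>x. x \<in> \<rat> \<Longrightarrow> \<exists>l. (\<lambda>k. u (m k) x) \<longlonglongrightarrow> l"
    by (rule function_convergent_subsequence[of \<rat> u B]) (use assms countable_rat in auto)
  have "convergent (\<lambda>k. u (m k) x)" for x
  proof (rule Cauchy_convergent, rule metric_CauchyI)
    fix e :: real assume e: "e > 0"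
    define d where "d = e / (4 * (C + 1))"
    have d: "d > 0" "C * d \<le> e / 4" using e C by (auto simp: d_def field_simps)
    obtain q where q: "q \<in> \<rat>" "x < q" "q < x + d" using Rats_dense_in_real[of x "x + d"] d by auto
    have "Cauchy (\<lambda>k. u (m k) q)" using m(2)[OF q(1)] by (auto intro: LIMSEQ_imp_Cauchy)
    then obtain N where N: "\<And>i j. i \<ge> N \<Longrightarrow> j \<ge> N \<Longrightarrow> dist (u (m i) q) (u (m j) q) < e / 4"
      using e by (metis Cauchy_def zero_less_divide_iff zero_less_numeral)
    have close: "\<bar>u k x - u k q\<bar> \<le> e / 4" for k
    proof -
      have "\<bar>u k x - u k q\<bar> \<le> C * \<bar>x - q\<bar>" by (rule lip)
      also have "\<dots> \<le> C * d" using q C by (intro mult_left_mono) auto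
      finally show ?thesis using d by simp
    qed
    have "dist (u (m i) x) (u (m j) x) < e" if "i \<ge> N" "j \<ge> N" for i j
      using N[OF that] close[of "m i"] close[of "m j"] e unfolding dist_real_def by linarith
    then show "\<exists>N. \<forall>i\<ge>N. \<forall>j\<ge>N. dist (u (m i) x) (u (m j) x) < e" by blast
  qed
  then have "\<forall>x. \<exists>l. (\<lambda>k. u (m k) x) \<longlonglongrightarrow> l" by (simp add: convergent_def)
  then obtain v where "\<And>x. (\<lambda>k. u (m k) x) \<longlonglongrightarrow> v x" by metis
  then show ?thesis using that m(1) by blast
qed

section \<open>Symmetric decreasing solutions and their limits\<close>

locale kernel_nonlinearity = sym_kernel K A + nonlinearity f f' p for K A f f' p
begin

definition sym_decr :: "(real \<Rightarrow> real) \<Rightarrow> bool" where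
  "sym_decr u \<longleftrightarrow> (\<forall>x. u (- x) = u x) \<and> (\<forall>x y. 0 \<le> x \<longrightarrow> x \<le> y \<longrightarrow> u y \<le> u x) \<and> (\<forall>x. 0 \<le> u x)"

lemma sym_decr_le_0: "sym_decr u \<Longrightarrow> u x \<le> u 0"
  unfolding sym_decr_def by (metis abs_ge_zero abs_if order_refl)

lemma conv_sym_decr:
  assumes "bdd_meas g" "sym_decr g" shows "sym_decr (conv K g)"
  using assms conv_even[of K g, OF even] conv_even_antimono[OF integrable even decr assms(1)] conv_nonneg[of g]
  by (auto simp: sym_decr_def)

text \<open>The left end of the cell of length \<open>d\<close> that contains
  \<open>\<bar>y\<bar>\<close>.\<close>

definition samp :: "real \<Rightarrow> real \<Rightarrow> real" where
  "samp d y = d * real (nat \<lfloor>\<bar>y\<bar> / d\<rfloor>)"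

definition cut :: "real \<Rightarrow> (real \<Rightarrow> real) \<Rightarrow> real \<Rightarrow> real" where
  "cut L g y = (if \<bar>y\<bar> < L then g y else 0)"

lemma cut_measurable:
  assumes [measurable]: "g \<in> borel_measurable borel" shows "cut L g \<in> borel_measurable borel"
  unfolding cut_def[abs_def] by measurable

text \<open>One statement serves two limits: mesh size to 0 on a fixed interval, with sampling
  points \<open>\<tau> k\<close>, and interval length to infinity, with
  \<open>\<tau> k y = \<bar>y\<bar>\<close>. The kernel gives a uniform Lipschitz bound, hence a
  subsequence, and \<open>f B * K\<close> dominates the integrals.\<close>

lemma limit_equation:
  assumes eq: "\<And>k x. u k x = conv K (cut (L k) (\<lambda>y. f (u k (\<tau> k y)))) x"
    and u: "\<And>k. sym_decr (u k)" "\<And>k. u k 0 \<le> B"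
    and \<tau>: "\<And>y. (\<lambda>k. \<tau> k y) \<longlonglongrightarrow> \<bar>y\<bar>" "\<And>k. \<tau> k \<in> borel_measurable borel"
    and L: "AE y in lborel. (\<lambda>k. indicator {y. \<bar>y\<bar> < L k} y :: real) \<longlonglongrightarrow> indicator S y"
    and S: "S \<in> sets borel"
  obtains m v where "strict_mono m" "\<And>x. (\<lambda>k. u (m k) x) \<longlonglongrightarrow> v x"
    "\<And>x. v x = conv K (\<lambda>y. indicator S y * f (v y)) x" "sym_decr v" "v 0 \<le> B" "continuous_on UNIV v"
proof -
  define h where "h k = cut (L k) (\<lambda>y. f (u k (\<tau> k y)))" for k
  have uB: "0 \<le> u k x" "u k x \<le> B" for k x
    using u(1)[of k] sym_decr_le_0[OF u(1), of k x] u(2)[of k] by (auto simp: sym_decr_def)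
  have B0: "0 \<le> B" using uB[of 0 0] by linarith
  \<comment> \<open>Continuity of \<open>u k\<close> would follow from the equation only once its
    right-hand side, which contains \<open>u k\<close>, is measurable. Monotonicity on the half-line
    breaks this circle.\<close>
  have um: "u k \<in> borel_measurable borel" for k
  proof -
    have "mono_on {0..} (\<lambda>x. - u k x)" using u(1)[of k] by (auto simp: sym_decr_def mono_on_def)
    then have "(\<lambda>x. - u k x) \<in> borel_measurable (restrict_space borel {0..})"
      by (intro borel_measurable_mono_on_fnc) auto
    moreover have "(\<lambda>x::real. \<bar>x\<bar>) \<in> measurable borel (restrict_space borel {0..})"
      by (intro measurable_restrict_space2) auto
    ultimately have "(\<lambda>x. - u k \<bar>x\<bar>) \<in> borel_measurable borel"
      by (rule measurable_compose[rotated])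
    then have "(\<lambda>x. - (- u k \<bar>x\<bar>)) \<in> borel_measurable borel" by measurable
    moreover have "u k \<bar>x\<bar> = u k x" for x using u(1)[of k] by (auto simp: sym_decr_def abs_if)
    ultimately show ?thesis by simp
  qed
  have fm: "f \<in> borel_measurable borel" using cont_f by (rule borel_measurable_continuous_onI)
  have hm: "h k \<in> borel_measurable borel" for k
    unfolding h_def by (intro cut_measurable measurable_compose[OF measurable_compose[OF \<tau>(2) um] fm])
  have hB: "0 \<le> h k y" "h k y \<le> f B" for k y
    using f_nonneg[OF uB(1)] f_mono[OF uB] f_nonneg[OF B0] by (auto simp: h_def cut_def)
  have hb: "bdd_meas (h k)" for k
    using hB by (intro bdd_measI[OF hm, of _ "f B"]) (auto simp: abs_of_nonneg)
  have eqh: "u k = conv K (h k)" for k using eq unfolding h_def by blast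
  have lip: "\<bar>u k x - u k y\<bar> \<le> A * B * \<bar>x - y\<bar>" for k x y
    unfolding eqh[of k] by (rule conv_lipschitz[OF hb hB(1)]) (simp add: eqh[symmetric] uB)
  obtain m v where m: "strict_mono m" "\<And>x. (\<lambda>k. u (m k) x) \<longlonglongrightarrow> v x"
    by (rule lipschitz_convergent_subsequence[of u B "A * B"]) (use uB lip in \<open>auto simp: abs_of_nonneg\<close>)
  have vB: "0 \<le> v x" "v x \<le> B" for x
    using LIMSEQ_le_const[OF m(2)] LIMSEQ_le_const2[OF m(2)] uB by blast+
  have vlip: "\<bar>v x - v y\<bar> \<le> A * B * \<bar>x - y\<bar>" for x y
    by (rule LIMSEQ_le_const2[OF tendsto_rabs[OF tendsto_diff[OF m(2) m(2)]]]) (use lip in auto)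
  have vc: "continuous_on UNIV v" by (rule lipschitz_imp_continuous[OF vlip])
  have vm: "(\<lambda>y. indicator S y * f (v y)) \<in> borel_measurable borel"
    using measurable_compose[OF borel_measurable_continuous_onI[OF vc] fm] S by measurable
  have sd: "sym_decr v"
    unfolding sym_decr_def
  proof (intro conjI allI impI)
    show "v (- x) = v x" for x
      using LIMSEQ_unique[OF m(2)[of "- x"]] m(2)[of x] u(1) by (auto simp: sym_decr_def)
    show "v y \<le> v x" if "0 \<le> x" "x \<le> y" for x y
      by (rule LIMSEQ_le[OF m(2) m(2)]) (use u(1) that in \<open>auto simp: sym_decr_def\<close>)
  qed (rule vB)
  \<comment> \<open>The uniform Lipschitz bound allows the argument to vary along with the
    function.\<close>
  have comp: "(\<lambda>k. u (m k) (\<tau> (m k) y)) \<longlonglongrightarrow> v y" for y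
  proof -
    have t: "(\<lambda>k. \<tau> (m k) y - \<bar>y\<bar>) \<longlonglongrightarrow> 0"
      using tendsto_diff[OF LIMSEQ_subseq_LIMSEQ[OF \<tau>(1) m(1)] tendsto_const, of y "\<bar>y\<bar>"] by (simp add: o_def)
    have "(\<lambda>k. u (m k) (\<tau> (m k) y) - u (m k) \<bar>y\<bar>) \<longlonglongrightarrow> 0"
    proof (rule Lim_null_comparison[OF _ tendsto_mult_right_zero[OF tendsto_rabs_zero[OF t]]])
      show "\<forall>\<^sub>F k in sequentially. norm (u (m k) (\<tau> (m k) y) - u (m k) \<bar>y\<bar>) \<le> A * B * \<bar>\<tau> (m k) y - \<bar>y\<bar>\<bar>"
        using lip by auto
    qed
    from tendsto_add[OF this m(2)[of "\<bar>y\<bar>"]]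
    have "(\<lambda>k. u (m k) (\<tau> (m k) y)) \<longlonglongrightarrow> v \<bar>y\<bar>" by simp
    moreover have "v \<bar>y\<bar> = v y" using sd by (auto simp: sym_decr_def abs_if)
    ultimately show ?thesis by simp
  qed
  have "v x = conv K (\<lambda>y. indicator S y * f (v y)) x" for x
  proof -
    have "(\<lambda>k. conv K (h (m k)) x) \<longlonglongrightarrow> conv K (\<lambda>y. indicator S y * f (v y)) x"
      unfolding conv_def
    proof (rule integral_dominated_convergence[where w = "\<lambda>y. f B * K (x - y)"])
      have Km: "(\<lambda>y. K (x - y)) \<in> borel_measurable lborel"
        using borel_measurable_integrable[OF lborel_integrable_reflect[OF integrable]] .
      show "(\<lambda>y. K (x - y) * (indicator S y * f (v y))) \<in> borel_measurable lborel"
        using borel_measurable_times[OF Km, of "\<lambda>y. indicator S y * f (v y)"] vm by simp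
      show "(\<lambda>y. K (x - y) * h (m k) y) \<in> borel_measurable lborel" for k
        using Km hm by (intro borel_measurable_times) auto
      show "integrable lborel (\<lambda>y. f B * K (x - y))" using lborel_integrable_reflect[OF integrable] by simp
      show "AE y in lborel. norm (K (x - y) * h (m k) y) \<le> f B * K (x - y)" for k
        using hB less_imp_le[OF pos] by (auto simp: abs_mult mult.commute[of "f B"] intro!: mult_left_mono)
      show "AE y in lborel. (\<lambda>k. K (x - y) * h (m k) y) \<longlonglongrightarrow> K (x - y) * (indicator S y * f (v y))"
        using L
      proof eventually_elim
        case (elim y)
        have fc: "(\<lambda>k. f (u (m k) (\<tau> (m k) y))) \<longlonglongrightarrow> f (v y)"
          by (rule continuous_on_tendsto_compose[OF cont_f comp]) auto
        have "h (m k) y = indicator {y. \<bar>y\<bar> < L (m k)} y * f (u (m k) (\<tau> (m k) y))" for k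
          by (simp add: h_def cut_def)
        moreover have "(\<lambda>k. indicator {y. \<bar>y\<bar> < L (m k)} y :: real) \<longlonglongrightarrow> indicator S y"
          using LIMSEQ_subseq_LIMSEQ[OF elim m(1)] by (simp add: o_def)
        ultimately have "(\<lambda>k. h (m k) y) \<longlonglongrightarrow> indicator S y * f (v y)"
          using tendsto_mult[OF _ fc] by simp
        then show ?case by (rule tendsto_mult_left)
      qed
    qed
    then have "(\<lambda>k. u (m k) x) \<longlonglongrightarrow> conv K (\<lambda>y. indicator S y * f (v y)) x" by (simp add: eqh[symmetric])
    then show ?thesis using LIMSEQ_unique[OF m(2)] by blast
  qed
  then show ?thesis using that[OF m _ sd vB(2) vc] by blast
qed

end

section \<open>Solution of the discretised problem\<close>

context kernel_nonlinearity
begin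

lemma samp_le: "d > 0 \<Longrightarrow> samp d y \<le> \<bar>y\<bar>"
proof -
  assume d: "d > 0"
  have "real (nat \<lfloor>\<bar>y\<bar> / d\<rfloor>) = of_int \<lfloor>\<bar>y\<bar> / d\<rfloor>" using d by simp
  also have "\<dots> \<le> \<bar>y\<bar> / d" by simp
  finally show ?thesis using mult_left_mono[of _ "\<bar>y\<bar> / d" d] d by (fastforce simp: samp_def)
qed

lemma samp_ge: "d > 0 \<Longrightarrow> \<bar>y\<bar> - d \<le> samp d y"
proof -
  assume d: "d > 0"
  have "\<bar>y\<bar> / d - 1 \<le> of_int \<lfloor>\<bar>y\<bar> / d\<rfloor>" by linarith
  also have "\<dots> = real (nat \<lfloor>\<bar>y\<bar> / d\<rfloor>)" using d by simp
  finally have "\<bar>y\<bar> \<le> d * (real (nat \<lfloor>\<bar>y\<bar> / d\<rfloor>) + 1)" using d by (simp add: field_simps)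
  then show ?thesis by (simp add: samp_def algebra_simps)
qed

lemma samp_nonneg: "d > 0 \<Longrightarrow> 0 \<le> samp d y"
  by (simp add: samp_def)

lemma samp_measurable: "samp d \<in> borel_measurable borel"
  unfolding samp_def[abs_def] by measurable

lemma index_less: "d > 0 \<Longrightarrow> \<bar>y\<bar> < real N * d \<Longrightarrow> nat \<lfloor>\<bar>y\<bar> / d\<rfloor> < N"
proof -
  assume d: "d > 0" and y: "\<bar>y\<bar> < real N * d"
  have "\<bar>y\<bar> / d < real N" using d y by (simp add: field_simps)
  then have "\<lfloor>\<bar>y\<bar> / d\<rfloor> < int N" by linarith
  moreover have "0 \<le> \<lfloor>\<bar>y\<bar> / d\<rfloor>" using d by simp
  ultimately show ?thesis by linarith
qed

text \<open>A step function that is constant on the cells of length \<open>d\<close> is parametrised by its value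
  \<open>s\<close> on the first cell and the ratios of consecutive values, all of which range over a cube.
  The fixed-point map updates the ratios by those of the convolution and moves \<open>s\<close> in the
  direction opposite to \<open>T - s\<close>, because the problem is expansive in the amplitude.\<close>
lemma discrete_solution:
  assumes r: "0 < r" "r < R" "f r * (LINT y|lborel. K y) < r"
    and R: "R < f (R * exp (- A)) * (LINT y|lborel. K y * indicator {-1<..<1} y)"
    and d: "d > 0" "real N * d \<ge> 1"
  obtains u where "\<And>x. u x = conv K (cut (real N * d) (\<lambda>y. f (u (samp d y)))) x"
    "sym_decr u" "r \<le> u 0" "u 0 \<le> R"
proof -
  have N: "N > 0" using d by (cases N) auto
  \<comment> \<open>Coordinate 0 places the amplitude in \<open>{r..R}\<close>; the others are the
    ratios of consecutive steps. Thus every point of the cube describes a nonnegative nonincreasing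
    step function.\<close>
  define V where "V x i = (r + (R - r) * x 0) * (\<Prod>j\<in>{1..i}. x j)" for x :: "nat \<Rightarrow> real" and i :: nat
  define H where "H v = cut (real N * d) (\<lambda>y. f (v (nat \<lfloor>\<bar>y\<bar> / d\<rfloor>)))" for v :: "nat \<Rightarrow> real"
  define T where "T v = conv K (H v)" for v
  define cube where "cube x \<longleftrightarrow> (\<forall>j<N. 0 \<le> x j \<and> x j \<le> 1)" for x :: "nat \<Rightarrow> real"
  have V0: "V x 0 = r + (R - r) * x 0" for x by (simp add: V_def)
  have V0r: "r \<le> V x 0" "V x 0 \<le> R" if "cube x" for x
  proof -
    have x: "0 \<le> x 0" "x 0 \<le> 1" using that N by (auto simp: cube_def)
    show "r \<le> V x 0" using x r by (simp add: V0)
    have "(R - r) * x 0 \<le> (R - r) * 1" using x r by (intro mult_left_mono) auto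
    then show "V x 0 \<le> R" by (simp add: V0)
  qed
  have Vs: "V x (Suc i) = V x i * x (Suc i)" for x i by (simp add: V_def)
  have Vn: "0 \<le> V x i" if "cube x" "i < N" for x i
    using that
  proof (induction i)
    case (Suc i)
    then show ?case by (auto simp: Vs cube_def)
  qed (use V0r r in force)
  have Vd: "V x j \<le> V x i" if x: "cube x" and "i \<le> j" "j < N" for x i j
    using that(2,3)
  proof (induction j rule: dec_induct)
    case (step j)
    have "V x j * x (Suc j) \<le> V x j * 1"
      using Vn[OF x, of j] x step.prems by (intro mult_left_mono) (auto simp: cube_def)
    then show ?case using step by (simp add: Vs)
  qed simp
  have VR: "V x i \<le> R" if "cube x" "i < N" for x i
    using Vd[OF that(1), of 0 i] V0r(2)[OF that(1)] that(2) by simp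
  have fm [measurable]: "f \<in> borel_measurable borel" using cont_f by (rule borel_measurable_continuous_onI)
  have Hm: "H v \<in> borel_measurable borel" for v
  proof -
    have [measurable]: "v \<in> measurable (count_space UNIV) borel" by simp
    show ?thesis unfolding H_def by (intro cut_measurable) measurable
  qed
  have HB: "0 \<le> H (V x) y" "H (V x) y \<le> f (V x 0)" if x: "cube x" for x y
  proof -
    show "0 \<le> H (V x) y"
      using Vn[OF x index_less[OF d(1)]] f_nonneg by (auto simp: H_def cut_def)
    show "H (V x) y \<le> f (V x 0)"
      using Vn[OF x index_less[OF d(1)]] Vd[OF x _ index_less[OF d(1)], of 0] f_mono
        f_nonneg[OF Vn[OF x N]] by (auto simp: H_def cut_def)
  qed
  have Hb: "bdd_meas (H (V x))" if x: "cube x" for x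
    using HB[OF x] by (intro bdd_measI[OF Hm, of _ "f (V x 0)"]) (auto simp: abs_of_nonneg)
  have Hs: "sym_decr (H (V x))" if x: "cube x" for x
    unfolding sym_decr_def
  proof (intro conjI allI impI)
    show "H (V x) (- y) = H (V x) y" for y by (simp add: H_def cut_def)
    fix a b :: real assume ab: "0 \<le> a" "a \<le> b"
    show "H (V x) b \<le> H (V x) a"
    proof (cases "b < real N * d")
      case True
      have "nat \<lfloor>\<bar>a\<bar> / d\<rfloor> \<le> nat \<lfloor>\<bar>b\<bar> / d\<rfloor>"
        using ab d by (intro nat_mono floor_mono divide_right_mono) auto
      moreover have "nat \<lfloor>\<bar>b\<bar> / d\<rfloor> < N" using index_less[OF d(1), of b] True ab by simp
      ultimately have "f (V x (nat \<lfloor>\<bar>b\<bar> / d\<rfloor>)) \<le> f (V x (nat \<lfloor>\<bar>a\<bar> / d\<rfloor>))"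
        by (intro f_mono Vn Vd x)
      then show ?thesis using True ab by (simp add: H_def cut_def)
    next
      case False
      then have "H (V x) b = 0" using ab by (simp add: H_def cut_def)
      then show ?thesis using HB(1)[OF x] by simp
    qed
  qed (use HB(1) that in auto)
  have Tpos: "T (V x) y > 0" if x: "cube x" for x y
    unfolding T_def
  proof (rule conv_pos[OF Hb[OF x] HB(1)[OF x] d(1)])
    fix z assume z: "0 < z" "z < d"
    have "z < real N * d" using z N d(1) by (smt (verit) mult_le_cancel_right1 of_nat_0_less_iff One_nat_def Suc_leI real_of_nat_ge_one_iff)
    moreover have "\<lfloor>z / d\<rfloor> = 0" using z d by (simp add: floor_eq_iff)
    ultimately show "H (V x) z > 0" using z V0r[OF x] r by (simp add: H_def cut_def f_pos)
  qed
  have Ts: "sym_decr (T (V x))" if x: "cube x" for x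
    unfolding T_def by (rule conv_sym_decr[OF Hb[OF x] Hs[OF x]])
  have Tlim: "(\<lambda>k. T (V (X k)) y) \<longlonglongrightarrow> T (V x) y"
    if X: "\<And>k. cube (X k)" and x: "cube x" and lim: "\<And>i. i < N \<Longrightarrow> (\<lambda>k. V (X k) i) \<longlonglongrightarrow> V x i" for X x y
    unfolding T_def conv_def
  proof (rule integral_dominated_convergence[where w = "\<lambda>z. f R * K (y - z)"])
    have Km: "(\<lambda>z. K (y - z)) \<in> borel_measurable lborel"
      using borel_measurable_integrable[OF lborel_integrable_reflect[OF integrable]] .
    show "(\<lambda>z. K (y - z) * H (V x) z) \<in> borel_measurable lborel"
      "(\<lambda>z. K (y - z) * H (V (X k)) z) \<in> borel_measurable lborel" for k
      using Km Hm by (intro borel_measurable_times; simp)+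
    show "integrable lborel (\<lambda>z. f R * K (y - z))" using lborel_integrable_reflect[OF integrable] by simp
    show "AE z in lborel. norm (K (y - z) * H (V (X k)) z) \<le> f R * K (y - z)" for k
    proof (rule AE_I2)
      fix z
      have "H (V (X k)) z \<le> f R"
        using HB(2)[OF X] f_mono[OF Vn[OF X N] V0r(2)[OF X]] by (rule order_trans)
      then show "norm (K (y - z) * H (V (X k)) z) \<le> f R * K (y - z)"
        using HB(1)[OF X] less_imp_le[OF pos] by (simp add: abs_mult mult.commute[of "f R"] mult_left_mono)
    qed
    show "AE z in lborel. (\<lambda>k. K (y - z) * H (V (X k)) z) \<longlonglongrightarrow> K (y - z) * H (V x) z"
    proof (rule AE_I2)
      fix z
      have "(\<lambda>k. H (V (X k)) z) \<longlonglongrightarrow> H (V x) z"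
      proof (cases "\<bar>z\<bar> < real N * d")
        case True
        have "(\<lambda>k. f (V (X k) (nat \<lfloor>\<bar>z\<bar> / d\<rfloor>))) \<longlonglongrightarrow> f (V x (nat \<lfloor>\<bar>z\<bar> / d\<rfloor>))"
          by (rule continuous_on_tendsto_compose[OF cont_f lim[OF index_less[OF d(1) True]]]) auto
        then show ?thesis using True by (simp add: H_def cut_def)
      qed (simp add: H_def cut_def)
      then show "(\<lambda>k. K (y - z) * H (V (X k)) z) \<longlonglongrightarrow> K (y - z) * H (V x) z"
        by (rule tendsto_mult_left)
    qed
  qed
  \<comment> \<open>The amplitude \<open>s\<close> is sent to \<open>s - (T - s)\<close>, clipped to
    \<open>{r..R}\<close> and rescaled to the unit interval. The ratios stay in the unit interval
    because the convolution is again symmetric decreasing.\<close>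
  define F where "F x i = (if i = 0 then (max r (min R (2 * V x 0 - T (V x) 0)) - r) / (R - r)
    else T (V x) (real i * d) / T (V x) (real (i - 1) * d))" for x and i :: nat
  obtain x where x: "\<And>j. j < N \<Longrightarrow> 0 \<le> x j \<and> x j \<le> 1" "\<And>i. i < N \<Longrightarrow> F x i = x i"
  proof (rule brouwer_unit_cube[of N F])
    fix x i assume "\<And>j. j < N \<Longrightarrow> 0 \<le> x j \<and> x j \<le> (1::real)" and i: "i < N"
    then have x: "cube x" by (simp add: cube_def)
    show "0 \<le> F x i \<and> F x i \<le> 1"
    proof (cases "i = 0")
      case True
      then show ?thesis using r by (auto simp: F_def divide_le_eq)
    next
      case False
      have "T (V x) (real i * d) \<le> T (V x) (real (i - 1) * d)"
        using Ts[OF x] d by (auto simp: sym_decr_def intro!: mult_right_mono)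
      then show ?thesis using False Tpos[OF x, of "real i * d"] Tpos[OF x, of "real (i - 1) * d"]
        by (simp add: F_def divide_le_eq)
    qed
  next
    fix X x i
    assume X': "\<And>k j. j < N \<Longrightarrow> 0 \<le> X k j \<and> X k j \<le> (1::real)" and lim: "\<And>j. j < N \<Longrightarrow> (\<lambda>k. X k j) \<longlonglongrightarrow> x j" and i: "i < N"
    have X: "cube (X k)" for k using X' by (simp add: cube_def)
    have x: "cube x"
      unfolding cube_def using LIMSEQ_le_const[OF lim] LIMSEQ_le_const2[OF lim] X' by blast
    have limV: "(\<lambda>k. V (X k) i) \<longlonglongrightarrow> V x i" if "i < N" for i
      unfolding V_def using that N by (intro tendsto_intros lim) auto
    note limT = Tlim[OF X x limV]
    show "(\<lambda>k. F (X k) i) \<longlonglongrightarrow> F x i"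
    proof (cases "i = 0")
      case True
      then show ?thesis unfolding F_def using limT limV[OF N] r
        by (auto intro!: tendsto_divide tendsto_diff tendsto_max tendsto_min tendsto_mult)
    next
      case False
      then show ?thesis unfolding F_def using limT Tpos[OF x, of "real (i - 1) * d"]
        by (auto intro!: tendsto_divide)
    qed
  qed blast
  have xc: "cube x" using x(1) by (simp add: cube_def)
  define u where "u = T (V x)"
  define s where "s = V x 0"
  have up: "u y > 0" for y using Tpos[OF xc] by (simp add: u_def)
  \<comment> \<open>Fixed ratios mean that the step function already has the shape of
    \<open>u\<close>; only its amplitude \<open>s\<close> may still differ from
    \<open>u 0\<close>.\<close>
  have V_eq: "V x i = s * u (real i * d) / u 0" if "i < N" for i
    using that
  proof (induction i)
    case 0
    then show ?case using up[of 0] by (simp add: s_def)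
  next
    case (Suc i)
    have "x (Suc i) = u (real (Suc i) * d) / u (real i * d)"
      using x(2)[OF Suc.prems] by (simp add: F_def u_def)
    then show ?case using Suc up[of "real i * d"] by (simp add: Vs)
  qed
  have s: "r \<le> s" "s \<le> R" using V0r[OF xc] by (auto simp: s_def)
  have "(max r (min R (2 * s - u 0)) - r) / (R - r) = x 0"
    using x(2)[OF N] by (simp add: F_def u_def s_def)
  then have cl: "max r (min R (2 * s - u 0)) = s"
    using r(2) by (simp add: s_def V0 field_simps)
  \<comment> \<open>When the clipping is inactive this is immediate. At \<open>s = r\<close> one has
    \<open>u 0 < r\<close>, so the clipped value would exceed \<open>r\<close>; at
    \<open>s = R\<close> one has \<open>u 0 > R\<close>, so it would fall below \<open>R\<close>.
    Neither end can be fixed.\<close>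
  have "u 0 = s"
  proof -
    consider "s = r" | "s = R" | "r < s" "s < R" using s by linarith
    then show ?thesis
    proof cases
      case 1
      have "u 0 \<le> conv K (\<lambda>_. f r) 0"
        unfolding u_def T_def using HB(2)[OF xc] 1
        by (intro conv_mono[OF integrable less_imp_le[OF pos] Hb[OF xc]]) (auto simp: s_def)
      also have "\<dots> < r" using r(3) by (simp add: conv_const)
      finally show ?thesis using cl 1 r(2) by (simp add: max_def min_def split: if_splits)
    next
      case 2
      \<comment> \<open>As the steps have the shape of \<open>u\<close> and maximum
        \<open>R\<close>, the exponential lower bound for \<open>u\<close> keeps them at or above
        \<open>R * exp (- A)\<close> within distance 1 of the centre.\<close>
      have lb: "f (R * exp (- A)) * indicator {-1<..<1} y \<le> H (V x) y" for y :: real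
      proof (cases "y \<in> {-1<..<1}")
        case True
        then have y: "\<bar>y\<bar> < 1" by auto
        then have yN: "\<bar>y\<bar> < real N * d" using d(2) by linarith
        let ?i = "nat \<lfloor>\<bar>y\<bar> / d\<rfloor>"
        have i: "?i < N" by (rule index_less[OF d(1) yN])
        have sm: "real ?i * d = samp d y" by (simp add: samp_def)
        have "exp (- A * \<bar>samp d y\<bar>) * u 0 \<le> u (0 + samp d y)"
          unfolding u_def T_def by (rule conv_harnack[OF Hb[OF xc] HB(1)[OF xc]])
        moreover have "A * \<bar>samp d y\<bar> \<le> A * 1"
          using A_pos samp_le[OF d(1), of y] samp_nonneg[OF d(1), of y] y by (intro mult_left_mono) auto
        then have "exp (- A) * u 0 \<le> exp (- A * \<bar>samp d y\<bar>) * u 0" using up[of 0] by simp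
        ultimately have "exp (- A) * u 0 \<le> u (samp d y)" by simp
        then have "R * exp (- A) \<le> R * (u (samp d y) / u 0)"
          using up[of 0] r by (intro mult_left_mono) (auto simp: field_simps)
        also have "\<dots> = V x ?i" using V_eq[OF i] 2 by (simp add: sm)
        finally have "f (R * exp (- A)) \<le> f (V x ?i)" using r by (intro f_mono) auto
        then show ?thesis using True yN by (simp add: H_def cut_def)
      qed (use HB(1)[OF xc] in auto)
      have "R < f (R * exp (- A)) * (LINT y|lborel. K y * indicator {-1<..<1} y)" by (rule R)
      also have "\<dots> = conv K (\<lambda>y. f (R * exp (- A)) * indicator {-1<..<1} y) 0"
        unfolding conv_cmult by (simp add: conv_def even)
      also have "\<dots> \<le> u 0"
      proof -
        have "bdd_meas (indicator {-1<..<1})" by (rule bdd_measI[of _ 1]) (auto simp: indicator_def)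
        then have "bdd_meas (\<lambda>y. f (R * exp (- A)) * indicator {-1<..<1} y)"
          by (rule bdd_meas_mult[OF bdd_meas_const])
        then show ?thesis unfolding u_def T_def
          by (rule conv_mono[OF integrable less_imp_le[OF pos] _ Hb[OF xc] lb])
      qed
      finally show ?thesis using cl 2 r(2) by (simp add: max_def min_def split: if_splits)
    next
      case 3
      then show ?thesis using cl by (simp add: max_def min_def split: if_splits)
    qed
  qed
  then have V_u: "V x i = u (real i * d)" if "i < N" for i using V_eq[OF that] up[of 0] by simp
  have "H (V x) = cut (real N * d) (\<lambda>y. f (u (samp d y)))"
  proof
    fix y show "H (V x) y = cut (real N * d) (\<lambda>y. f (u (samp d y))) y"
      using V_u[OF index_less[OF d(1), of y]] by (simp add: H_def cut_def samp_def mult.commute)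
  qed
  then have "u y = conv K (cut (real N * d) (\<lambda>y. f (u (samp d y)))) y" for y
    by (simp add: u_def T_def)
  then show ?thesis
    using that[of u] Ts[OF xc] \<open>u 0 = s\<close> s unfolding u_def by blast
qed

end

section \<open>Exclusion of constant limits\<close>

text \<open>\<open>t (1 - t\<^sup>2)\<^sub>+\<^sup>3\<close> plays the role of a first Dirichlet eigenfunction: it stays \<open>C\<^sup>2\<close> when extended by
  zero, and its second derivative is still bounded below by a multiple of the function itself.\<close>
definition odd_hat :: "real \<Rightarrow> real" where
  "odd_hat t = t * (max 0 (1 - t\<^sup>2))\<^sup>2 * (1 - t\<^sup>2)"

definition odd_hat' :: "real \<Rightarrow> real" where
  "odd_hat' t = (max 0 (1 - t\<^sup>2))\<^sup>2 * (1 - 7 * t\<^sup>2)"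

definition odd_hat'' :: "real \<Rightarrow> real" where
  "odd_hat'' t = t * max 0 (1 - t\<^sup>2) * (42 * t\<^sup>2 - 18)"

lemma DERIV_max_0_square: "((\<lambda>z::real. (max 0 z)\<^sup>2) has_real_derivative 2 * max 0 z) (at z)"
proof -
  consider "z > 0" | "z < 0" | "z = 0" by linarith
  then show ?thesis
  proof cases
    case 1
    have "((\<lambda>z::real. z\<^sup>2) has_real_derivative 2 * max 0 z) (at z)"
      using 1 by (auto intro!: derivative_eq_intros)
    then show ?thesis
      by (rule has_field_derivative_transform_within_open[of _ _ _ "{0<..}"]) (use 1 in auto)
  next
    case 2
    have "((\<lambda>z::real. 0) has_real_derivative 2 * max 0 z) (at z)" using 2 by simp
    then show ?thesis
      by (rule has_field_derivative_transform_within_open[of _ _ _ "{..<0}"]) (use 2 in auto)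
  next
    case 3
    have "((\<lambda>z::real. (max 0 z)\<^sup>2) has_real_derivative 0) (at 0)"
      by (rule DERIV_0_quadratic[of _ _ 1]) (auto simp: max_def)
    then show ?thesis using 3 by simp
  qed
qed

lemma DERIV_one_minus_square: "((\<lambda>t::real. 1 - t\<^sup>2) has_real_derivative - 2 * t) (at t)"
  by (auto intro!: derivative_eq_intros)

lemma DERIV_max_0_comp:
  "((\<lambda>t::real. (max 0 (1 - t\<^sup>2))\<^sup>2) has_real_derivative - 4 * t * max 0 (1 - t\<^sup>2)) (at t)"
  by (rule DERIV_cong[OF DERIV_chain2[OF DERIV_max_0_square DERIV_one_minus_square]]) simp

lemma max_0_cases: "max 0 (1 - t\<^sup>2) = 0 \<or> max 0 (1 - t\<^sup>2) = 1 - (t::real)\<^sup>2"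
  by (auto simp: max_def)

lemma DERIV_odd_hat: "(odd_hat has_real_derivative odd_hat' t) (at t)"
  unfolding odd_hat_def[abs_def]
proof (rule DERIV_cong[OF DERIV_mult[OF DERIV_mult[OF DERIV_ident DERIV_max_0_comp] DERIV_one_minus_square]])
  show "(1 * (max 0 (1 - t\<^sup>2))\<^sup>2 + - 4 * t * max 0 (1 - t\<^sup>2) * t) * (1 - t\<^sup>2) + - 2 * t * (t * (max 0 (1 - t\<^sup>2))\<^sup>2)
      = odd_hat' t"
    using max_0_cases[of t] unfolding odd_hat'_def by (auto simp: algebra_simps power2_eq_square)
qed

lemma DERIV_odd_hat': "(odd_hat' has_real_derivative odd_hat'' t) (at t)"
proof -
  have d: "((\<lambda>t::real. 1 - 7 * t\<^sup>2) has_real_derivative - 14 * t) (at t)"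
    by (auto intro!: derivative_eq_intros)
  show ?thesis
    unfolding odd_hat'_def[abs_def]
  proof (rule DERIV_cong[OF DERIV_mult[OF DERIV_max_0_comp d]])
    show "- 4 * t * max 0 (1 - t\<^sup>2) * (1 - 7 * t\<^sup>2) + - 14 * t * (max 0 (1 - t\<^sup>2))\<^sup>2 = odd_hat'' t"
      using max_0_cases[of t] unfolding odd_hat''_def by (auto simp: algebra_simps power2_eq_square)
  qed
qed

lemma odd_hat_odd: "odd_hat (- t) = - odd_hat t" "odd_hat'' (- t) = - odd_hat'' t"
  by (simp_all add: odd_hat_def odd_hat''_def)

lemma odd_hat_zero:
  assumes "\<bar>t\<bar> \<ge> 1" shows "odd_hat t = 0" "odd_hat' t = 0" "odd_hat'' t = 0"
proof -
  have "max 0 (1 - t\<^sup>2) = 0" using assms abs_le_square_iff[of 1 t] by simp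
  then show "odd_hat t = 0" "odd_hat' t = 0" "odd_hat'' t = 0"
    by (simp_all add: odd_hat_def odd_hat'_def odd_hat''_def)
qed

lemma odd_hat_pos: "0 < t \<Longrightarrow> t < 1 \<Longrightarrow> odd_hat t > 0"
  using abs_square_less_1[of t] by (simp add: odd_hat_def max_def)

text \<open>Inside the support and with \<open>m = 1 - t\<^sup>2\<close> the sum is
  \<open>t * m * (19 * m\<^sup>2 - 42 * m + 24)\<close>, whose quadratic has negative discriminant;
  19 is the least integer with this property. Its size is immaterial, since scaling divides it by
  \<open>l\<^sup>2\<close>.\<close>

lemma odd_hat_subsolution: "t \<ge> 0 \<Longrightarrow> 19 * odd_hat t + odd_hat'' t \<ge> 0"
proof -
  assume t: "t \<ge> 0"
  define m where "m = max 0 (1 - t\<^sup>2)"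
  have m0: "m \<ge> 0" by (simp add: m_def)
  have "19 * odd_hat t + odd_hat'' t = t * m * (19 * m * (1 - t\<^sup>2) + 42 * t\<^sup>2 - 18)"
    unfolding odd_hat_def odd_hat''_def m_def[symmetric] by (simp add: algebra_simps power2_eq_square)
  also have "\<dots> = t * m * (19 * m\<^sup>2 - 42 * m + 24)"
  proof (cases "m = 0")
    case False
    then have t2: "t\<^sup>2 = 1 - m" using max_0_cases[of t] unfolding m_def[symmetric] by auto
    show ?thesis unfolding t2 by (simp add: power2_eq_square algebra_simps)
  qed simp
  also have "\<dots> \<ge> 0"
  proof -
    have "19 * m\<^sup>2 - 42 * m + 24 = 19 * (m - 21 / 19)\<^sup>2 + 15 / 19"
      by (simp add: power2_eq_square field_simps)
    then have "19 * m\<^sup>2 - 42 * m + 24 \<ge> 0" by simp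
    then show ?thesis using t m0 by simp
  qed
  finally show ?thesis .
qed

lemma C2_bdd_odd_hat:
  assumes "l > 0"
  shows "C2_bdd (\<lambda>t. odd_hat (t / l)) (\<lambda>t. odd_hat' (t / l) / l) (\<lambda>t. odd_hat'' (t / l) / l\<^sup>2)"
proof -
  have c: "continuous_on UNIV odd_hat" "continuous_on UNIV odd_hat'" "continuous_on UNIV odd_hat''"
    unfolding odd_hat_def[abs_def] odd_hat'_def[abs_def] odd_hat''_def[abs_def] by (intro continuous_intros)+
  obtain B0 B1 B2 where B: "\<And>t. \<bar>odd_hat t\<bar> \<le> B0" "\<And>t. \<bar>odd_hat' t\<bar> \<le> B1" "\<And>t. \<bar>odd_hat'' t\<bar> \<le> B2"
    using compact_support_continuous(2)[of _ 1, OF c(1) odd_hat_zero(1)[OF less_imp_le]]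
      compact_support_continuous(2)[of _ 1, OF c(2) odd_hat_zero(2)[OF less_imp_le]]
      compact_support_continuous(2)[of _ 1, OF c(3) odd_hat_zero(3)[OF less_imp_le]] by metis
  have bnn: "0 \<le> B0" "0 \<le> B1" "0 \<le> B2" using B(1)[of 0] B(2)[of 0] B(3)[of 0] by linarith+
  have b: "\<bar>odd_hat (t / l)\<bar> \<le> B0 + B1 / l + B2 / l\<^sup>2 \<and> \<bar>odd_hat' (t / l) / l\<bar> \<le> B0 + B1 / l + B2 / l\<^sup>2 \<and>
      \<bar>odd_hat'' (t / l) / l\<^sup>2\<bar> \<le> B0 + B1 / l + B2 / l\<^sup>2" for t
  proof -
    have "\<bar>odd_hat' (t / l) / l\<bar> \<le> B1 / l" "\<bar>odd_hat'' (t / l) / l\<^sup>2\<bar> \<le> B2 / l\<^sup>2" "0 \<le> B1 / l" "0 \<le> B2 / l\<^sup>2"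
      using B(2,3) assms bnn by (auto simp: abs_divide divide_right_mono)
    then show ?thesis using B(1)[of "t / l"] bnn(1) by linarith
  qed
  show ?thesis
    unfolding C2_bdd_def
  proof (intro conjI allI exI)
    show "((\<lambda>t. odd_hat (t / l)) has_real_derivative odd_hat' (t / l) / l) (at t)" for t
      using DERIV_chain2[OF DERIV_odd_hat DERIV_cdivide[OF DERIV_ident, of l]] by simp
    show "((\<lambda>t. odd_hat' (t / l) / l) has_real_derivative odd_hat'' (t / l) / l\<^sup>2) (at t)" for t
      using DERIV_cdivide[OF DERIV_chain2[OF DERIV_odd_hat' DERIV_cdivide[OF DERIV_ident, of l]], of l]
      by (simp add: power2_eq_square)
    show "continuous_on UNIV (\<lambda>t. odd_hat'' (t / l) / l\<^sup>2)"
      using assms by (intro continuous_intros continuous_on_compose2[OF c(3)]) auto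
  qed (use b in blast)+
qed

text \<open>By the subsolution property the second-order factor applied to the scaled hat is at most
  \<open>a\<^sup>2 + 19 / l\<^sup>2\<close> times the hat on the half-line. Both sides are odd, so
  the kernel preserves the inequality, and it inverts the factor.\<close>

lemma exp_kernel_odd_hat:
  assumes a: "a \<noteq> 0" and l: "l > 0" and t: "t > 0"
  shows "odd_hat (t / l) \<le> (a\<^sup>2 + 19 / l\<^sup>2) * conv (exp_kernel a) (\<lambda>t. odd_hat (t / l)) t"
proof -
  interpret sym_kernel "exp_kernel a" "\<bar>a\<bar>" by (rule sym_kernel_exp_kernel[OF a])
  let ?S = "\<lambda>t. odd_hat (t / l)" and ?S2 = "\<lambda>t. odd_hat'' (t / l) / l\<^sup>2"
  have C: "C2_bdd ?S (\<lambda>t. odd_hat' (t / l) / l) ?S2" by (rule C2_bdd_odd_hat[OF l])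
  then obtain B where B: "\<And>t. \<bar>?S t\<bar> \<le> B" "\<And>t. \<bar>?S2 t\<bar> \<le> B" unfolding C2_bdd_def by blast
  have "\<And>t. (?S has_real_derivative odd_hat' (t / l) / l) (at t)" using C by (auto simp: C2_bdd_def)
  then have cS: "continuous_on UNIV ?S" by (meson DERIV_continuous continuous_at_imp_continuous_on)
  have cS2: "continuous_on UNIV ?S2" using C by (auto simp: C2_bdd_def)
  have bS: "bdd_meas ?S" "bdd_meas ?S2" using bdd_meas_continuous[OF cS B(1)] bdd_meas_continuous[OF cS2 B(2)] by auto
  have bcS: "bdd_meas (\<lambda>t. c * ?S t)" for c using bdd_meas_mult[of "\<lambda>_. c" ?S] bS by simp
  have bL: "bdd_meas (\<lambda>t. a\<^sup>2 * ?S t - ?S2 t)" by (rule bdd_meas_diff[OF bcS bS(2)])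
  let ?g = "\<lambda>t. (a\<^sup>2 + 19 / l\<^sup>2) * ?S t - (a\<^sup>2 * ?S t - ?S2 t)"
  have "0 \<le> conv (exp_kernel a) ?g t"
  proof (rule conv_odd_nonneg[OF bdd_meas_diff[OF bcS bL] _ _ t])
    show "?g (- s) = - ?g s" for s using odd_hat_odd[of "s / l"] by (simp add: algebra_simps)
    show "?g s \<ge> 0" if "s > 0" for s
    proof -
      have "?g s = (19 * odd_hat (s / l) + odd_hat'' (s / l)) / l\<^sup>2" by (simp add: algebra_simps add_divide_distrib)
      then show ?thesis using odd_hat_subsolution[of "s / l"] that l by simp
    qed
  qed
  also have "conv (exp_kernel a) ?g t = (a\<^sup>2 + 19 / l\<^sup>2) * conv (exp_kernel a) ?S t - ?S t"
    by (simp only: conv_diff[OF integrable bcS bL] conv_cmult conv_exp_kernel_C2[OF a C])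
  finally show ?thesis by simp
qed

lemma bdd_meas_odd_hat:
  assumes "l > 0" shows "bdd_meas (\<lambda>t. odd_hat (t / l))" "integrable lborel (\<lambda>t. odd_hat (t / l))"
proof -
  have c: "continuous_on UNIV odd_hat" unfolding odd_hat_def[abs_def] by (intro continuous_intros)
  then have cl: "continuous_on UNIV (\<lambda>t. odd_hat (t / l))"
    using assms by (intro continuous_on_compose2[OF c] continuous_intros) auto
  have z: "odd_hat (t / l) = 0" if "\<bar>t\<bar> > l" for t
    using odd_hat_zero(1)[of "t / l"] that assms by (simp add: abs_divide)
  show "bdd_meas (\<lambda>t. odd_hat (t / l))"
    using compact_support_continuous(2)[OF cl z] bdd_meas_continuous[OF cl] by blast
  show "integrable lborel (\<lambda>t. odd_hat (t / l))" by (rule compact_support_continuous(1)[OF cl z])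
qed

text \<open>Each further factor is handled by applying the remaining kernel to the one-factor
  inequality, which is legitimate because both of its sides are odd.\<close>

lemma kern_odd_hat:
  assumes "as \<noteq> []" "\<forall>a\<in>set as. a \<noteq> 0" "l > 0" "t > 0"
  shows "odd_hat (t / l) \<le> (\<Prod>a\<leftarrow>as. a\<^sup>2 + 19 / l\<^sup>2) * conv (kern as) (\<lambda>t. odd_hat (t / l)) t"
  using assms
proof (induction as rule: kern.induct)
  case (2 a)
  then show ?case using exp_kernel_odd_hat by simp
next
  case (3 a b as)
  let ?S = "\<lambda>t. odd_hat (t / l)" and ?c = "a\<^sup>2 + 19 / l\<^sup>2" and ?P = "\<Prod>a\<leftarrow>b # as. a\<^sup>2 + 19 / l\<^sup>2"
  have a: "a \<noteq> 0" and ne: "b # as \<noteq> []" "\<forall>a\<in>set (b # as). a \<noteq> 0" using 3 by auto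
  obtain A where "sym_kernel (kern (b # as)) A" using sym_kernel_kern[OF ne] by blast
  then interpret sym_kernel "kern (b # as)" A .
  interpret E: sym_kernel "exp_kernel a" "\<bar>a\<bar>" by (rule sym_kernel_exp_kernel[OF a])
  have S: "bdd_meas ?S" by (rule bdd_meas_odd_hat[OF \<open>l > 0\<close>])
  have bE: "bdd_meas (\<lambda>t. ?c * conv (exp_kernel a) ?S t)"
    using bdd_meas_mult[OF bdd_meas_const bdd_meas_conv[OF E.integrable S]] .
  have oS: "?S (- s) = - ?S s" for s using odd_hat_odd(1)[of "s / l"] by simp
  have "0 \<le> conv (kern (b # as)) (\<lambda>t. ?c * conv (exp_kernel a) ?S t - ?S t) t"
  proof (rule conv_odd_nonneg[OF bdd_meas_diff[OF bE S] _ _ \<open>t > 0\<close>])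
    show "?c * conv (exp_kernel a) ?S (- s) - ?S (- s) = - (?c * conv (exp_kernel a) ?S s - ?S s)" for s
      unfolding E.conv_odd[of ?S, OF oS] oS by simp
    show "0 \<le> ?c * conv (exp_kernel a) ?S s - ?S s" if "s > 0" for s
      using exp_kernel_odd_hat[OF a \<open>l > 0\<close> that] by simp
  qed
  also have "\<dots> = ?c * conv (kern (b # as)) (conv (exp_kernel a) ?S) t - conv (kern (b # as)) ?S t"
    by (simp only: conv_diff[OF integrable bE S] conv_cmult)
  finally have le: "conv (kern (b # as)) ?S t \<le> ?c * conv (kern (a # b # as)) ?S t"
    using conv_kern_Cons[OF ne a S] by simp
  have P: "?P \<ge> 0" by (intro prod_list_nonneg) auto
  have "?S t \<le> ?P * conv (kern (b # as)) ?S t" using 3 ne by simp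
  also have "\<dots> \<le> ?P * (?c * conv (kern (a # b # as)) ?S t)" using le P by (rule mult_left_mono)
  finally show ?case by (simp add: mult.commute mult.left_commute)
qed simp

lemma prod_perturb:
  assumes "(\<Prod>a\<leftarrow>as. (a::real)\<^sup>2) < \<kappa>"
  obtains l where "l > 0" "(\<Prod>a\<leftarrow>as. a\<^sup>2 + 19 / l\<^sup>2) < \<kappa>"
proof -
  have "continuous_on UNIV (\<lambda>e. \<Prod>a\<leftarrow>as. a\<^sup>2 + e)"
    by (induction as) (auto intro!: continuous_intros)
  then have "continuous_on UNIV (\<lambda>e. - (\<Prod>a\<leftarrow>as. a\<^sup>2 + e))" by (intro continuous_intros)
  then obtain e where e: "e > 0" "\<And>y. \<bar>y - 0\<bar> < e \<Longrightarrow> - (\<Prod>a\<leftarrow>as. a\<^sup>2 + y) > - \<kappa>"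
    using continuous_pos_nbhd[of "\<lambda>e. - (\<Prod>a\<leftarrow>as. a\<^sup>2 + e)" "- \<kappa>" 0] assms by auto
  \<comment> \<open>Chosen so that \<open>19 / l\<^sup>2 = e / 2\<close>.\<close>
  define l where "l = sqrt (38 / e)"
  have l: "l > 0" "l\<^sup>2 = 38 / e" using e(1) by (auto simp: l_def)
  have "(\<Prod>a\<leftarrow>as. a\<^sup>2 + 19 / l\<^sup>2) < \<kappa>" using e(2)[of "19 / l\<^sup>2"] e(1) by (simp add: l(2))
  then show ?thesis using that l by blast
qed

section \<open>Growth of the nonlinearity\<close>

context nonlinearity
begin

lemma quotient_mono:
  assumes "0 < a" "a \<le> b" shows "f a / a \<le> f b / b"
proof (rule DERIV_nonneg_imp_nondecreasing[OF assms(2), of "\<lambda>r. f r / r"])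
  fix r assume "a \<le> r" "r \<le> b"
  then have r: "r > 0" using assms by simp
  have "((\<lambda>r. f r / r) has_real_derivative (f' r * r - f r * 1) / (r * r)) (at r)"
    using r by (intro DERIV_divide deriv DERIV_ident) auto
  moreover have "0 \<le> (f' r * r - f r * 1) / (r * r)"
  proof -
    have "f r \<le> p * f r" using p_gt_1 f_pos[OF r] by simp
    also have "\<dots> \<le> f' r * r" using f'_ge[OF r] r by (simp add: field_simps)
    finally show ?thesis by simp
  qed
  ultimately show "\<exists>y. ((\<lambda>r. f r / r) has_real_derivative y) (at r) \<and> 0 \<le> y" by blast
qed

lemma f_ge_powr:
  assumes "z \<ge> 1" shows "f 1 * z powr p \<le> f z"
proof -
  have "f 1 * 1 powr (- p) \<le> f z * z powr (- p)"
  proof (rule DERIV_nonneg_imp_nondecreasing[OF assms, of "\<lambda>r. f r * r powr (- p)"])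
    fix r :: real assume "1 \<le> r"
    then have r: "r > 0" by simp
    have "((\<lambda>r. f r * r powr (- p)) has_real_derivative f' r * r powr (- p) + (- p * r powr (- p - 1)) * f r) (at r)"
      using r by (intro DERIV_mult deriv has_real_derivative_powr)
    moreover have "f' r * r powr (- p) + (- p * r powr (- p - 1)) * f r = r powr (- p) * (f' r - p * (f r / r))"
      using r by (simp add: powr_diff field_simps)
    moreover have "\<dots> \<ge> 0" using f'_ge[OF r] by simp
    ultimately show "\<exists>y. ((\<lambda>r. f r * r powr (- p)) has_real_derivative y) (at r) \<and> 0 \<le> y" by metis
  qed
  then have "f 1 * z powr p \<le> f z * z powr (- p) * z powr p" by (simp add: mult_right_mono)
  then show ?thesis using assms by (simp add: powr_add[symmetric] mult.assoc)
qed

lemma superlinear_growth: obtains z where "z \<ge> 1" "M * z < f z"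
proof -
  define b where "b = max 1 ((\<bar>M\<bar> + 1) / f 1)"
  \<comment> \<open>This solves \<open>z powr (p - 1) = b\<close>, so that
    \<open>f 1 * z powr p = f 1 * b * z\<close> exceeds \<open>M * z\<close>.\<close>
  define z where "z = b powr (1 / (p - 1))"
  have b: "b \<ge> 1" "b * f 1 > M"
  proof -
    have "(\<bar>M\<bar> + 1) / f 1 \<le> b" by (simp add: b_def)
    then have "\<bar>M\<bar> + 1 \<le> b * f 1" using f_pos[of 1] by (simp add: field_simps)
    then show "b * f 1 > M" by linarith
  qed (simp add: b_def)
  have z1: "z \<ge> 1" unfolding z_def using b p_gt_1 by (intro ge_one_powr_ge_zero) auto
  have "z powr (p - 1) = b" unfolding z_def using b p_gt_1 by (simp add: powr_powr)
  then have "z powr p = b * z" using z1 by (simp add: powr_diff field_simps)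
  then have "f 1 * (b * z) \<le> f z" using f_ge_powr[OF z1] by simp
  moreover have "M * z < b * f 1 * z" using b z1 by simp
  ultimately have "M * z < f z" by (simp add: mult.commute mult.left_commute)
  then show ?thesis using that z1 by blast
qed

lemma f_le_linear:
  assumes "\<And>s. 0 \<le> s \<Longrightarrow> s \<le> r \<Longrightarrow> f' s \<le> \<eta>" "0 \<le> r" shows "f r \<le> \<eta> * r"
  using f_diff_le[of 0 r \<eta>] assms f_0 by simp

end

lemma (in sym_kernel) conv_translate: "conv K g (x + c) = conv K (\<lambda>y. g (y + c)) x"
  using lborel_integral_shift[of "\<lambda>y. K (x + c - y) * g y" "- c"] by (simp add: conv_def algebra_simps)

section \<open>Decay on intervals and the solution on the line\<close>

context kernel_nonlinearity
begin

lemma sym_decr_reflect_le: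
  assumes "sym_decr u" "\<bar>x\<bar> \<le> \<bar>y\<bar>" shows "u y \<le> u x"
  using assms by (intro even_antimono_reflect[of u x y]) (auto simp: sym_decr_def)

text \<open>A solution on a bounded interval cannot stay above a level \<open>c\<close> with \<open>p f(c)/c > 1 / \<integral> K\<close>
  on a long interval: the odd part of \<open>u\<close> about \<open>l\<close> would be a positive supersolution of a linear
  problem whose first eigenvalue is too small. This is what rules out that solutions on growing
  intervals converge to a constant.\<close>
lemma decay_at_fixed_distance:
  assumes u: "\<And>x. u x = conv K (\<lambda>y. indicator {y. \<bar>y\<bar> < n} y * f (u y)) x" "sym_decr u" "u 0 > 0"
      "continuous_on UNIV u"
    and l: "l > 0" "2 * l < n"
    and S: "bdd_meas S" "integrable lborel S" "\<And>t. S (- t) = - S t"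
      "\<And>t. 0 < t \<Longrightarrow> t < l \<Longrightarrow> S t > 0" "\<And>t. t \<ge> l \<Longrightarrow> S t = 0"
      "\<And>t. t > 0 \<Longrightarrow> S t \<le> \<kappa>' * conv K S t"
    and \<kappa>: "0 < \<kappa>'" "\<kappa>' < p * (f c / c)" and c: "c > 0"
  shows "u (2 * l) < c"
proof (rule ccontr)
  assume "\<not> u (2 * l) < c"
  then have ul: "u (2 * l) \<ge> c" by simp
  define \<kappa>1 where "\<kappa>1 = p * (f c / c)"
  define h where "h y = indicator {y. \<bar>y\<bar> < n} y * f (u y)" for y
  have uh: "u x = conv K h x" for x using u(1)[of x] by (simp add: h_def[abs_def])
  have u0: "0 \<le> u x" "u x \<le> u 0" for x using u(2) sym_decr_le_0[OF u(2)] by (auto simp: sym_decr_def)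
  have um: "u \<in> borel_measurable borel" using u(4) by (rule borel_measurable_continuous_onI)
  have hb: "bdd_meas h"
  proof -
    have "{y::real. \<bar>y\<bar> < n} \<in> sets borel" by measurable
    then have "bdd_meas (indicator {y. \<bar>y\<bar> < n})"
      by (intro bdd_measI[of _ 1]) (auto simp: indicator_def)
    from bdd_meas_mult[OF this bdd_meas_comp[OF um u0]] show ?thesis by (simp add: h_def[abs_def])
  qed
  have hnn: "h y \<ge> 0" for y using f_nonneg[OF u0(1)] by (simp add: h_def)
  have up: "u x > 0" for x
  proof -
    obtain e where e: "0 < e" "\<And>y. \<bar>y - 0\<bar> < e \<Longrightarrow> u y > 0"
      using continuous_pos_nbhd[OF u(4) u(3)] by blast
    have "conv K h x > 0"
      by (rule conv_pos[OF hb hnn, of 0 "min e n"]) (use e l f_pos in \<open>auto simp: h_def\<close>)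
    then show ?thesis by (simp add: uh)
  qed
  have h_sd: "sym_decr h"
    unfolding sym_decr_def
  proof (intro conjI allI impI)
    show "h (- x) = h x" for x using u(2) by (simp add: h_def sym_decr_def indicator_def)
    show "h y \<le> h x" if "0 \<le> x" "x \<le> y" for x y
      using that f_mono[OF u0(1), of y "u x"] u(2) f_nonneg[OF u0(1)]
      by (auto simp: h_def sym_decr_def indicator_def)
  qed (rule hnn)
  \<comment> \<open>\<open>W\<close> and \<open>H\<close> are twice the odd parts of
    \<open>u\<close> and of the cut-off \<open>f(u)\<close> about \<open>l\<close>, oriented so as
    to be nonnegative for \<open>t > 0\<close>.\<close>
  define W where "W t = u (l - t) - u (t + l)" for t
  define H where "H t = h (l - t) - h (t + l)" for t
  have hl: "bdd_meas (\<lambda>t. h (l - t))" "bdd_meas (\<lambda>t. h (t + l))"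
    using bdd_meas_reflect[OF hb, of l] bdd_meas_reflect[OF bdd_meas_reflect[OF hb, of l], of 0] by (simp_all add: add.commute)
  have Hb: "bdd_meas H" unfolding H_def[abs_def] by (rule bdd_meas_diff[OF hl])
  have WH: "W t = conv K H t" for t
    unfolding W_def uh H_def[abs_def] conv_diff[OF integrable hl]
    using conv_eq_reflect[of K h, OF even, of l t] conv_translate[of h t l] by simp
  have Wo: "W (- t) = - W t" and Ho: "H (- t) = - H t" for t by (simp_all add: W_def H_def add.commute)
  have Hnn: "H t \<ge> 0" if "t > 0" for t
    using sym_decr_reflect_le[OF h_sd, of "l - t" "t + l"] that l by (simp add: H_def)
  \<comment> \<open>Strictness comes from the cut-off: points of \<open>(- n, 2 * l - n)\<close> lie
    inside the interval and their reflections about \<open>l\<close> outside. For a constant on the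
    whole line \<open>W\<close> would vanish.\<close>
  have Wpos: "W t > 0" if "t > 0" for t
  proof -
    have "conv K h (2 * l - (l - t)) < conv K h (l - t)"
    proof (rule conv_reflect_less[OF hb, of "l - t" l "- n" "2 * l - n"])
      show "h (2 * l - z) \<le> h z" if "z < l" for z
        using sym_decr_reflect_le[OF h_sd, of z "2 * l - z"] that l by simp
      show "h (2 * l - z) < h z" if "- n < z" "z < 2 * l - n" for z
        using that l f_pos[OF up] by (simp add: h_def)
    qed (use that l in auto)
    then show ?thesis by (simp add: W_def uh algebra_simps)
  qed
  \<comment> \<open>For \<open>t < l\<close> both arguments lie within distance \<open>2 * l\<close>
    of 0, where \<open>u \<ge> c\<close> by the assumption to be refuted. On such values
    \<open>f' r \<ge> p * (f r / r) \<ge> \<kappa>1\<close>.\<close>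
  have HW: "\<kappa>1 * W t \<le> H t" if t: "0 < t" "t < l" for t
  proof -
    have le: "u (t + l) \<le> u (l - t)" using Wpos[OF t(1)] by (simp add: W_def)
    have cu: "c \<le> u (t + l)"
      using ul sym_decr_reflect_le[OF u(2), of "t + l" "2 * l"] t by simp
    have "\<kappa>1 * (u (l - t) - u (t + l)) \<le> f (u (l - t)) - f (u (t + l))"
    proof (rule f_diff_ge[OF _ le])
      fix r assume "u (t + l) \<le> r" "r \<le> u (l - t)"
      then have r: "c \<le> r" "0 < r" using cu c by auto
      have "\<kappa>1 \<le> p * (f r / r)"
        unfolding \<kappa>1_def using quotient_mono[OF c r(1)] p_gt_1 by (intro mult_left_mono) auto
      also have "\<dots> \<le> f' r" by (rule f'_ge[OF r(2)])
      finally show "\<kappa>1 \<le> f' r" .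
    qed
    then show ?thesis using t l by (simp add: W_def H_def h_def)
  qed
  have Wb: "bdd_meas W" unfolding WH[abs_def] by (rule bdd_meas_conv[OF integrable Hb])
  have SW: "integrable lborel (\<lambda>t. S t * W t)" by (rule integrable_mult_bdd_meas[OF S(2) Wb])
  have KSi: "integrable lborel (\<lambda>t. conv K S t * H t)"
    by (rule integrable_mult_bdd_meas[OF integrable_conv_conv[OF integrable S(2,1)] Hb])
  have KSo: "conv K S (- t) = - conv K S t" for t by (rule conv_odd[of S, OF S(3)])
  have Snn: "S t \<ge> 0" if "t > 0" for t using S(4)[of t] S(5)[of t] that by (cases "t < l") auto
  have pw1: "\<kappa>1 * (S t * W t) \<le> \<kappa>' * (conv K S t * H t)" if t: "t > 0" for t
  proof -
    have KS: "0 \<le> \<kappa>' * conv K S t" using S(6)[OF t] Snn[OF t] by linarith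
    show ?thesis
    proof (cases "t < l")
      case True
      have "\<kappa>1 * (S t * W t) = S t * (\<kappa>1 * W t)" by simp
      also have "\<dots> \<le> S t * H t" using HW[OF t True] Snn[OF t] by (rule mult_left_mono)
      also have "\<dots> \<le> (\<kappa>' * conv K S t) * H t" using S(6)[OF t] Hnn[OF t] by (rule mult_right_mono)
      finally show ?thesis by (simp add: mult.assoc)
    next
      case False
      then have "S t = 0" using S(5) by simp
      then show ?thesis using mult_nonneg_nonneg[OF KS Hnn[OF t]] by (simp add: mult.assoc)
    qed
  qed
  have pw: "\<kappa>1 * (S t * W t) \<le> \<kappa>' * (conv K S t * H t)" for t
  proof -
    consider "t > 0" | "t < 0" | "t = 0" by linarith
    then show ?thesis
    proof cases
      case 2
      then show ?thesis using pw1[of "- t"] by (simp add: S(3) Wo KSo Ho)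
    next
      case 3
      then show ?thesis using Wo[of 0] Ho[of 0] by simp
    qed (rule pw1)
  qed
  \<comment> \<open>The symmetry of the kernel closes the chain: \<open>\<kappa>1\<close> times the
    integral of \<open>S W\<close> is at most \<open>\<kappa>'\<close> times that of
    \<open>(K * S) H\<close>, and the latter integral equals that of \<open>S W\<close>
    again.\<close>
  have "\<kappa>1 * (LINT t|lborel. S t * W t) = (LINT t|lborel. \<kappa>1 * (S t * W t))" by simp
  also have "\<dots> \<le> (LINT t|lborel. \<kappa>' * (conv K S t * H t))"
    using SW KSi pw by (intro integral_mono) auto
  also have "\<dots> = \<kappa>' * (LINT t|lborel. H t * conv K S t)" by (simp add: mult.commute)
  also have "(LINT t|lborel. H t * conv K S t) = (LINT t|lborel. S t * W t)"
    unfolding WH using integral_conv_swap_even[OF S(2) integrable Hb even] by simp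
  finally have le: "\<kappa>1 * (LINT t|lborel. S t * W t) \<le> \<kappa>' * (LINT t|lborel. S t * W t)" .
  have "(LINT t|lborel. S t * W t) > 0"
  proof (rule integral_pos_real[OF SW _ l(1)])
    show "0 \<le> S t * W t" for t
    proof -
      consider "t > 0" | "t < 0" | "t = 0" by linarith
      then show ?thesis
      proof cases
        case 1
        then show ?thesis using Snn Wpos[of t] by (auto intro: less_imp_le)
      next
        case 2
        then show ?thesis using Snn[of "- t"] Wpos[of "- t"] S(3)[of t] Wo[of t] by (auto simp: mult_nonpos_nonpos)
      next
        case 3
        then show ?thesis using Wo[of 0] by simp
      qed
    qed
    show "0 < S t * W t" if "0 < t" "t < l" for t using S(4)[OF that] Wpos[OF that(1)] by simp
  qed
  with le have "\<kappa>1 \<le> \<kappa>'" by simp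
  then show False using \<kappa> by (simp add: \<kappa>1_def)
qed

text \<open>The subsolution \<open>S\<close> depends on the operator, hence is kept as a hypothesis here.\<close>
lemma entire_solution:
  assumes S: "\<And>\<kappa>. \<kappa> * (LINT y|lborel. K y) > 1 \<Longrightarrow> \<exists>l>0. \<exists>S \<kappa>'. 0 < \<kappa>' \<and> \<kappa>' < \<kappa> \<and> bdd_meas S \<and> integrable lborel S \<and>
      (\<forall>t. S (- t) = - S t) \<and> (\<forall>t. 0 < t \<longrightarrow> t < l \<longrightarrow> S t > 0) \<and> (\<forall>t. t \<ge> l \<longrightarrow> S t = 0) \<and>
      (\<forall>t. t > 0 \<longrightarrow> S t \<le> \<kappa>' * conv K S t)"
  obtains v B where "\<And>x. v x = conv K (\<lambda>y. f (v y)) x" "sym_decr v" "v 0 > 0" "v 0 \<le> B"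
    "continuous_on UNIV v" "(v \<longlongrightarrow> 0) at_top"
proof -
  define J where "J = (LINT y|lborel. K y)"
  have J: "J > 0" using integral_pos by (simp add: J_def)
  obtain \<rho> where \<rho>: "\<rho> > 0" "\<And>r. 0 \<le> r \<Longrightarrow> r \<le> \<rho> \<Longrightarrow> f' r \<le> 1 / (2 * J)"
    using f'_small[of "1 / (2 * J)"] J by auto
  \<comment> \<open>At this amplitude \<open>f r \<le> r / (2 * J)\<close>, so the operator lowers
    it. The \<open>1 / 2\<close> yields \<open>r < 1\<close>, which later gives
    \<open>r < R\<close>.\<close>
  define r where "r = min \<rho> (1 / 2)"
  have r: "r > 0" "r < 1" using \<rho> by (auto simp: r_def)
  have fr: "f r \<le> 1 / (2 * J) * r" using r \<rho> by (intro f_le_linear) (auto simp: r_def)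
  have frJ: "f r * J < r"
  proof -
    have "f r * J \<le> 1 / (2 * J) * r * J" using fr J by (intro mult_right_mono) auto
    also have "\<dots> = r / 2" using J by simp
    finally show ?thesis using r by simp
  qed
  define J1 where "J1 = (LINT y|lborel. K y * indicator {-1<..<1} y)"
  have J1: "J1 > 0"
  proof -
    have "bdd_meas (indicator {-1<..<1})" by (rule bdd_measI[of _ 1]) (auto simp: indicator_def)
    from integrable_mult_bdd_meas[OF integrable this] show ?thesis
      unfolding J1_def using less_imp_le[OF pos] pos by (intro integral_pos_real[of _ "-1" 1]) auto
  qed
  \<comment> \<open>With \<open>R = z * exp A\<close> the level left after the loss
    \<open>exp (- A)\<close> is \<open>z\<close>, and superlinear growth makes \<open>f z\<close>
    beat both that loss and the small mass \<open>J1\<close>.\<close>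
  obtain z where z: "z \<ge> 1" "exp A / J1 * z < f z" by (rule superlinear_growth)
  define R where "R = z * exp A"
  have Rz: "R * exp (- A) = z" by (simp add: R_def exp_minus)
  have R: "R < f (R * exp (- A)) * J1" unfolding Rz using z(2) J1 by (simp add: R_def field_simps)
  have rR: "r < R"
  proof -
    have "1 * 1 \<le> z * exp A" using z(1) A_pos by (intro mult_mono) auto
    then show ?thesis using r by (simp add: R_def)
  qed
  obtain z' where z': "z' \<ge> 1" "1 / J * z' < f z'" by (rule superlinear_growth)
  \<comment> \<open>The midpoint of \<open>1 / (p * J)\<close> and \<open>1 / J\<close>. Being below
    \<open>1 / J\<close> it excludes the constant solution in the limit; being above
    \<open>1 / (p * J)\<close> it makes a level \<open>c\<close> with \<open>f c / c = q0\<close>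
    admissible for the decay lemma.\<close>
  define q0 where "q0 = (1 + 1 / p) / 2 / J"
  have p1: "1 / p < 1" using p_gt_1 by simp
  have "\<exists>c. r \<le> c \<and> c \<le> z' \<and> f c / c = q0"
  proof (rule IVT')
    have "f r / r \<le> 1 / (2 * J)" using fr r by (simp add: divide_le_eq)
    also have "1 / (2 * J) \<le> q0" using J p_gt_1 by (simp add: q0_def field_simps)
    finally show "f r / r \<le> q0" .
    have "q0 \<le> 1 / J" unfolding q0_def using J p1 by (intro divide_right_mono) auto
    also have "\<dots> \<le> f z' / z'" using z' J by (simp add: field_simps)
    finally show "q0 \<le> f z' / z'" .
    show "continuous_on {r..z'} (\<lambda>c. f c / c)"
      using r by (intro continuous_intros continuous_on_subset[OF cont_f]) auto
  qed (use r z' in simp)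
  then obtain c where c: "r \<le> c" "f c / c = q0" by blast
  have c0: "c > 0" using c r by simp
  have "p * (f c / c) * J > 1"
    using p_gt_1 J by (simp add: c(2) q0_def field_simps)
  then obtain l S \<kappa>' where l: "l > 0" and \<kappa>': "0 < \<kappa>'" "\<kappa>' < p * (f c / c)"
    and SS: "bdd_meas S" "integrable lborel S" "\<And>t. S (- t) = - S t" "\<And>t. 0 < t \<Longrightarrow> t < l \<Longrightarrow> S t > 0"
      "\<And>t. t \<ge> l \<Longrightarrow> S t = 0" "\<And>t. t > 0 \<Longrightarrow> S t \<le> \<kappa>' * conv K S t"
    using S[of "p * (f c / c)"] unfolding J_def by blast
  \<comment> \<open>The interval is fixed and the mesh \<open>1 / (k + 1)\<close> tends to 0. The
    bounds \<open>r\<close> and \<open>R\<close> depend neither on the mesh nor on \<open>n\<close>,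
    so the limit is nontrivial and the same compactness applies again as \<open>n\<close>
    grows.\<close>
  have step: "\<exists>u. (\<forall>x. u x = conv K (\<lambda>y. indicator {y. \<bar>y\<bar> < real n} y * f (u y)) x) \<and> sym_decr u \<and>
      r \<le> u 0 \<and> u 0 \<le> R \<and> continuous_on UNIV u" if n: "n \<ge> 1" for n :: nat
  proof -
    have "\<exists>u. (\<forall>x. u x = conv K (cut (real n) (\<lambda>y. f (u (samp (1 / real (Suc k)) y)))) x) \<and> sym_decr u \<and> r \<le> u 0 \<and> u 0 \<le> R" for k
    proof -
      have Nd: "real (n * Suc k) * (1 / real (Suc k)) = real n"
        unfolding of_nat_mult using nonzero_mult_div_cancel_right[of "real (Suc k)" "real n"] by (simp del: of_nat_Suc)
      have N1: "real (n * Suc k) * (1 / real (Suc k)) \<ge> 1" unfolding Nd using n by simp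
      have dp: "1 / real (Suc k) > 0" by simp
      obtain u where "\<And>x. u x = conv K (cut (real (n * Suc k) * (1 / real (Suc k))) (\<lambda>y. f (u (samp (1 / real (Suc k)) y)))) x"
        "sym_decr u" "r \<le> u 0" "u 0 \<le> R"
        using discrete_solution[OF r(1) rR frJ[unfolded J_def] R[unfolded J1_def] dp N1] by blast
      then show ?thesis unfolding Nd by blast
    qed
    then obtain u where u: "\<And>k x. u k x = conv K (cut (real n) (\<lambda>y. f (u k (samp (1 / real (Suc k)) y)))) x"
      "\<And>k. sym_decr (u k)" "\<And>k. r \<le> u k 0" "\<And>k. u k 0 \<le> R" by metis
    have tau: "(\<lambda>k. samp (1 / real (Suc k)) y) \<longlonglongrightarrow> \<bar>y\<bar>" for y
    proof (rule tendsto_sandwich[of "\<lambda>k. \<bar>y\<bar> - 1 / real (Suc k)" _ _ "\<lambda>_. \<bar>y\<bar>"])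
      show "\<forall>\<^sub>F k in sequentially. \<bar>y\<bar> - 1 / real (Suc k) \<le> samp (1 / real (Suc k)) y"
        by (intro always_eventually allI samp_ge) simp
      show "\<forall>\<^sub>F k in sequentially. samp (1 / real (Suc k)) y \<le> \<bar>y\<bar>"
        by (intro always_eventually allI samp_le) simp
      show "(\<lambda>k. \<bar>y\<bar> - 1 / real (Suc k)) \<longlonglongrightarrow> \<bar>y\<bar>"
        using tendsto_diff[OF tendsto_const LIMSEQ_inverse_real_of_nat, of "\<bar>y\<bar>"]
        by (simp add: inverse_eq_divide del: of_nat_Suc)
    qed simp
    have m: "{y::real. \<bar>y\<bar> < real n} \<in> sets borel" by measurable
    obtain m v where v: "strict_mono m" "\<And>x. (\<lambda>k. u (m k) x) \<longlonglongrightarrow> v x"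
      "\<And>x. v x = conv K (\<lambda>y. indicator {y. \<bar>y\<bar> < real n} y * f (v y)) x" "sym_decr v" "v 0 \<le> R" "continuous_on UNIV v"
      using limit_equation[of u "\<lambda>_. real n" "\<lambda>k. samp (1 / real (Suc k))" R "{y. \<bar>y\<bar> < real n}",
        OF u(1,2,4) tau samp_measurable AE_I2[OF tendsto_const] m] by blast
    have "r \<le> v 0" by (rule LIMSEQ_le_const[OF v(2)]) (use u(3) in auto)
    then show ?thesis using v by blast
  qed
  obtain n0 :: nat where n0: "2 * l < real n0" using reals_Archimedean2 by blast
  have n01: "n0 \<ge> 1" using n0 l by (cases n0) auto
  have "\<forall>k. \<exists>u. (\<forall>x. u x = conv K (\<lambda>y. indicator {y. \<bar>y\<bar> < real (n0 + k)} y * f (u y)) x) \<and> sym_decr u \<and>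
      r \<le> u 0 \<and> u 0 \<le> R \<and> continuous_on UNIV u"
    using step n01 by (meson trans_le_add1)
  then obtain u where u: "\<And>k x. u k x = conv K (\<lambda>y. indicator {y. \<bar>y\<bar> < real (n0 + k)} y * f (u k y)) x"
      "\<And>k. sym_decr (u k)" "\<And>k. r \<le> u k 0" "\<And>k. u k 0 \<le> R" "\<And>k. continuous_on UNIV (u k)" by metis
  have ul: "u k (2 * l) < c" for k
  proof (rule decay_at_fixed_distance[OF u(1) u(2) _ u(5) l _ SS \<kappa>' c0])
    show "0 < u k 0" using u(3)[of k] r by simp
    show "2 * l < real (n0 + k)" using n0 by simp
  qed
  have cut_eq: "cut (real (n0 + k)) (\<lambda>y. f (u k \<bar>y\<bar>)) = (\<lambda>y. indicator {y. \<bar>y\<bar> < real (n0 + k)} y * f (u k y))" for k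
  proof
    fix y
    have "u k \<bar>y\<bar> = u k y" using u(2)[of k] by (auto simp: sym_decr_def abs_if)
    then show "cut (real (n0 + k)) (\<lambda>y. f (u k \<bar>y\<bar>)) y = indicator {y. \<bar>y\<bar> < real (n0 + k)} y * f (u k y)"
      by (simp add: cut_def indicator_def)
  qed
  obtain m v where v: "strict_mono m" "\<And>x. (\<lambda>k. u (m k) x) \<longlonglongrightarrow> v x"
    "\<And>x. v x = conv K (\<lambda>y. indicator UNIV y * f (v y)) x" "sym_decr v" "v 0 \<le> R" "continuous_on UNIV v"
  proof -
    have eq: "u k x = conv K (cut (real (n0 + k)) (\<lambda>y. f (u k \<bar>y\<bar>))) x" for k x
      unfolding cut_eq by (rule u(1))
    have ae: "AE y in lborel. (\<lambda>k. indicator {y. \<bar>y\<bar> < real (n0 + k)} y :: real) \<longlonglongrightarrow> indicator UNIV y"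
    proof (rule AE_I2)
      fix y :: real
      obtain N :: nat where N: "\<bar>y\<bar> < real N" using reals_Archimedean2 by blast
      have "eventually (\<lambda>k. (indicator {y. \<bar>y\<bar> < real (n0 + k)} y :: real) = indicator UNIV y) sequentially"
        using eventually_ge_at_top[of N] by eventually_elim (use N in auto)
      then show "(\<lambda>k. indicator {y. \<bar>y\<bar> < real (n0 + k)} y :: real) \<longlonglongrightarrow> indicator UNIV y"
        by (rule tendsto_eventually)
    qed
    have abs_m: "(\<lambda>y::real. \<bar>y\<bar>) \<in> borel_measurable borel" by simp
    show ?thesis
    proof (rule limit_equation[of u "\<lambda>k. real (n0 + k)" "\<lambda>_ y. \<bar>y\<bar>" R UNIV, OF eq u(2,4) tendsto_const abs_m ae])
      show "(UNIV :: real set) \<in> sets borel" by simp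
    qed (rule that)
  qed
  have veq: "v x = conv K (\<lambda>y. f (v y)) x" for x using v(3)[of x] by simp
  have rv: "r \<le> v 0" by (rule LIMSEQ_le_const[OF v(2)]) (use u(3) in auto)
  have vl: "v (2 * l) \<le> c" by (rule LIMSEQ_le_const2[OF v(2)]) (use ul less_imp_le in blast)
  have v0: "0 \<le> v x" for x using v(4) by (auto simp: sym_decr_def)
  define L where "L = (INF x\<in>{0..}. v x)"
  have bdd: "bdd_below (v ` {0..})" using v0 by (intro bdd_belowI[of _ 0]) auto
  have Lle: "L \<le> v x" if "x \<ge> 0" for x unfolding L_def using that by (intro cINF_lower bdd) auto
  have L0: "L \<ge> 0" unfolding L_def using v0 by (intro cINF_greatest) auto
  have lim: "(v \<longlongrightarrow> L) at_top"
  proof (rule order_tendstoI)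
    fix a assume "a < L"
    show "eventually (\<lambda>x. a < v x) at_top"
      using eventually_ge_at_top[of 0] by eventually_elim (use Lle \<open>a < L\<close> less_le_trans in blast)
  next
    fix a assume "L < a"
    then obtain x0 where x0: "x0 \<ge> 0" "v x0 < a" unfolding L_def using cINF_less_iff[OF _ bdd, of a] by auto
    show "eventually (\<lambda>x. v x < a) at_top"
      using eventually_ge_at_top[of x0] by eventually_elim (use v(4) x0 in \<open>auto simp: sym_decr_def intro: le_less_trans\<close>)
  qed
  have vR: "v x \<le> R" for x using sym_decr_le_0[OF v(4), of x] v(5) by linarith
  have "(\<lambda>n. conv K (\<lambda>y. f (v y)) (real n)) \<longlonglongrightarrow> (LINT y|lborel. K y * f L)"
    unfolding conv_altdef
  proof (rule integral_dominated_convergence[where w = "\<lambda>y. f R * K y"])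
    have bg: "bdd_meas (\<lambda>y. f (v y))"
      by (rule bdd_meas_comp[OF borel_measurable_continuous_onI[OF v(6)] v0 vR])
    show "(\<lambda>y. K y * f (v (real n - y))) \<in> borel_measurable lborel" for n
      using integrable_mult_bdd_meas[OF integrable bdd_meas_reflect[OF bg]] by simp
    show "(\<lambda>y. K y * f L) \<in> borel_measurable lborel" using integrable by simp
    show "integrable lborel (\<lambda>y. f R * K y)" using integrable by simp
    show "AE y in lborel. norm (K y * f (v (real n - y))) \<le> f R * K y" for n
      using f_mono[OF v0 vR] f_nonneg[OF v0] less_imp_le[OF pos]
      by (intro AE_I2) (simp add: abs_mult mult.commute[of "f R"] mult_left_mono)
    show "AE y in lborel. (\<lambda>n. K y * f (v (real n - y))) \<longlonglongrightarrow> K y * f L"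
    proof (intro AE_I2 tendsto_mult_left)
      fix y
      have "filterlim (\<lambda>n. real n - y) at_top sequentially"
        using filterlim_tendsto_add_at_top[OF tendsto_const[of "- y"] filterlim_real_sequentially] by (simp add: algebra_simps)
      from filterlim_compose[OF lim this] have "(\<lambda>n. v (real n - y)) \<longlonglongrightarrow> L" .
      then show "(\<lambda>n. f (v (real n - y))) \<longlonglongrightarrow> f L" by (intro continuous_on_tendsto_compose[OF cont_f]) auto
    qed
  qed
  then have "(\<lambda>n. v (real n)) \<longlonglongrightarrow> J * f L" by (simp add: veq[symmetric] J_def)
  moreover have "(\<lambda>n. v (real n)) \<longlonglongrightarrow> L" by (rule filterlim_compose[OF lim filterlim_real_sequentially])
  ultimately have JL: "L = J * f L" using LIMSEQ_unique by blast
  \<comment> \<open>A limit \<open>L > 0\<close> at infinity would be a constant solution, with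
    \<open>f L / L = 1 / J\<close>. But \<open>L \<le> v (2 * l) \<le> c\<close>, and monotonicity
    of the quotient allows at most \<open>q0\<close>.\<close>
  have "L = 0"
  proof (rule ccontr)
    assume "L \<noteq> 0"
    then have Lp: "L > 0" using L0 by simp
    have "L \<le> c" using Lle[of "2 * l"] vl l by simp
    from quotient_mono[OF Lp this] have "f L / L \<le> q0" unfolding c(2) .
    also have "q0 < 1 / J" unfolding q0_def using J p1 by (intro divide_strict_right_mono) auto
    also have "1 / J = f L / L"
    proof -
      have "J * f L / L = 1" using JL Lp by (metis divide_self less_irrefl)
      then show ?thesis using J by (simp add: field_simps)
    qed
    finally show False by simp
  qed
  then have "(v \<longlongrightarrow> 0) at_top" using lim by simp
  moreover have "v 0 > 0" using rv r(1) by simp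
  ultimately show ?thesis by (intro that[of v R] veq v(4,5,6))
qed

end

section \<open>Decay and the main theorem\<close>

context kernel_nonlinearity
begin

lemma sym_decr_vanishes:
  assumes "sym_decr v" "(v \<longlongrightarrow> 0) at_top" "\<rho> > 0"
  shows "\<exists>R>0. \<forall>x. \<bar>x\<bar> \<ge> R \<longrightarrow> v x < \<rho>"
proof -
  have "eventually (\<lambda>x. v x < \<rho>) at_top" using assms(2,3) by (rule order_tendstoD)
  then have "eventually (\<lambda>x. v x < \<rho> \<and> x > 0) at_top" using eventually_gt_at_top[of 0] by eventually_elim auto
  then obtain R where R: "R > 0" "v R < \<rho>" by (auto simp: eventually_at_top_linorder)
  have "v x < \<rho>" if "\<bar>x\<bar> \<ge> R" for x
    using sym_decr_reflect_le[OF assms(1), of R x] R that by simp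
  then show ?thesis using R(1) by blast
qed

text \<open>Since \<open>f(v) \<le> \<eta> v\<close> far out with \<open>\<eta> \<integral> K = 1/2\<close>, and a symmetric decreasing function has its largest
  integral over windows of given length at the centred window, the integrals of \<open>v\<close> over
  \<open>[-N, N]\<close> satisfy \<open>X \<le> const + X / 2\<close>.\<close>
lemma solution_integrable:
  assumes v: "\<And>x. v x = conv K (\<lambda>y. f (v y)) x" "sym_decr v" "v 0 \<le> B" "continuous_on UNIV v"
    "(v \<longlongrightarrow> 0) at_top"
  shows "integrable lborel v"
proof -
  define J where "J = (LINT y|lborel. K y)"
  have J: "J > 0" using integral_pos by (simp add: J_def)
  define \<eta> where "\<eta> = 1 / (2 * J)"
  have \<eta>: "\<eta> > 0" "\<eta> * J = 1 / 2" using J by (auto simp: \<eta>_def)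
  obtain \<rho> where \<rho>: "\<rho> > 0" "\<And>r. 0 \<le> r \<Longrightarrow> r \<le> \<rho> \<Longrightarrow> f' r \<le> \<eta>" using f'_small[OF \<eta>(1)] by blast
  obtain R where R: "R > 0" "\<And>x. \<bar>x\<bar> \<ge> R \<Longrightarrow> v x < \<rho>" using sym_decr_vanishes[OF v(2,5) \<rho>(1)] by blast
  have v0: "0 \<le> v x" and vB: "v x \<le> B" for x
    using v(2,3) sym_decr_le_0[OF v(2), of x] by (auto simp: sym_decr_def)
  have vm: "v \<in> borel_measurable borel" using v(4) by (rule borel_measurable_continuous_onI)
  have vb: "bdd_meas v" using v0 vB by (intro bdd_measI[OF vm, of B]) (simp add: abs_of_nonneg)
  let ?g = "\<lambda>y. f (v y)"
  have gb: "bdd_meas ?g" by (rule bdd_meas_comp[OF vm v0 vB])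
  have fB: "0 \<le> f B" using f_nonneg[of B] v0[of 0] vB[of 0] by simp
  define ind_R :: "real \<Rightarrow> real" where "ind_R = indicator {-R..R}"
  have ind_Rb: "bdd_meas ind_R" unfolding ind_R_def by (rule bdd_measI[of _ 1]) (auto simp: indicator_def)
  have gle: "?g y \<le> f B * ind_R y + \<eta> * v y" for y
  proof (cases "\<bar>y\<bar> \<ge> R")
    case True
    have "f (v y) \<le> \<eta> * v y"
      by (rule f_le_linear) (use \<rho>(2) R(2)[OF True] v0 in auto)
    moreover have "0 \<le> f B * ind_R y" using fB by (simp add: ind_R_def)
    ultimately show ?thesis by linarith
  next
    case False
    then have "ind_R y = 1" by (auto simp: ind_R_def indicator_def not_le abs_less_iff)
    then show ?thesis using f_mono[OF v0 vB, of y] \<eta>(1) v0[of y] by (simp add: add_increasing2)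
  qed
  define X where "X N = (LINT y|lborel. indicator {- real N..real N} y * v y)" for N
  have Xb: "X N \<le> 4 * J * R * f B" for N
  proof -
    define I :: "real \<Rightarrow> real" where "I = indicator {- real N..real N}"
    have Ii: "integrable lborel I" unfolding I_def by (simp add: integrable_indicator_iff emeasure_lborel_Icc_eq)
    have Ib: "bdd_meas I" unfolding I_def by (rule bdd_measI[of _ 1]) (auto simp: indicator_def)
    have Ie: "I (- x) = I x" for x by (auto simp: I_def indicator_def)
    have Id: "I y \<le> I x" if "0 \<le> x" "x \<le> y" for x y using that by (auto simp: I_def indicator_def)
    have I0: "0 \<le> I x" for x by (simp add: I_def)
    have X: "X N = conv I v 0" by (simp add: X_def conv_def Ie) (simp add: I_def)
    have vsd: "v (- x) = v x" "0 \<le> x \<Longrightarrow> x \<le> y \<Longrightarrow> v y \<le> v x" for x y using v(2) by (auto simp: sym_decr_def)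
    have Iv: "conv I v y \<le> X N" for y
    proof -
      have "conv I v \<bar>y\<bar> \<le> conv I v 0"
        by (rule conv_even_antimono[OF Ii Ie Id vb vsd]) auto
      moreover have "conv I v \<bar>y\<bar> = conv I v y" using conv_even[of I v, OF Ie vsd(1), of y] by (simp add: abs_if)
      ultimately show ?thesis by (simp add: X)
    qed
    have I_ind: "conv I ind_R y \<le> 2 * R" for y
    proof -
      have "conv I ind_R y \<le> (LINT z|lborel. ind_R z)"
        unfolding conv_def
      proof (rule integral_mono[OF integrable_conv[OF Ii ind_Rb]])
        show "integrable lborel ind_R" unfolding ind_R_def by (simp add: integrable_indicator_iff emeasure_lborel_Icc_eq)
        show "I (y - z) * ind_R z \<le> ind_R z" for z by (auto simp: I_def ind_R_def indicator_def)
      qed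
      also have "\<dots> = 2 * R" using R by (simp add: ind_R_def)
      finally show ?thesis .
    qed
    have b1: "bdd_meas (\<lambda>y. f B * ind_R y)" "bdd_meas (\<lambda>y. \<eta> * v y)"
      using bdd_meas_mult[OF bdd_meas_const ind_Rb] bdd_meas_mult[OF bdd_meas_const vb] by auto
    have b2: "bdd_meas (\<lambda>y. f B * ind_R y + \<eta> * v y)"
      using bdd_meas_diff[OF b1(1) bdd_meas_mult[OF bdd_meas_const[of "- 1"] b1(2)]] by simp
    have Ig: "conv I ?g y \<le> f B * (2 * R) + \<eta> * X N" for y
    proof -
      have "conv I ?g y \<le> conv I (\<lambda>y. f B * ind_R y + \<eta> * v y) y"
        by (rule conv_mono[OF Ii I0 gb b2 gle])
      also have "\<dots> = f B * conv I ind_R y + \<eta> * conv I v y"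
        by (simp only: conv_add[OF Ii b1] conv_cmult)
      also have "\<dots> \<le> f B * (2 * R) + \<eta> * X N"
        using I_ind[of y] Iv[of y] fB \<eta>(1) by (intro add_mono mult_left_mono) auto
      finally show ?thesis .
    qed
    have vK: "v = conv K ?g" using v(1) by blast
    \<comment> \<open>Integration over windows commutes with \<open>K\<close>, so the windowed
      integral of \<open>v\<close> is a weighted integral of windowed integrals of
      \<open>f(v)\<close>, each bounded by \<open>Ig\<close>.\<close>
    have "X N = conv I (conv K ?g) 0" unfolding X by (subst (1) vK) simp
    also have "\<dots> = conv (conv I K) ?g 0" by (rule conv_assoc[OF Ii integrable gb])
    also have "\<dots> = conv (conv K I) ?g 0" by (subst conv_commute[of I]) simp
    also have "\<dots> = conv K (conv I ?g) 0" by (rule conv_assoc[symmetric, OF integrable Ii gb])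
    also have "\<dots> \<le> conv K (\<lambda>_. f B * (2 * R) + \<eta> * X N) 0"
      by (rule conv_mono[OF integrable less_imp_le[OF pos] bdd_meas_conv[OF Ii gb] bdd_meas_const Ig])
    also have "\<dots> = 2 * J * R * f B + (\<eta> * J) * X N"
      by (simp add: conv_const J_def[symmetric] algebra_simps)
    finally have "X N \<le> 2 * J * R * f B + X N / 2" unfolding \<eta>(2) by simp
    then show ?thesis by simp
  qed
  have Ni: "integrable lborel (\<lambda>y. indicator {- real N..real N} y * v y)" for N
    using integrable_mult_bdd_meas[OF _ vb, of "indicator {- real N..real N}"]
    by (simp add: integrable_indicator_iff emeasure_lborel_Icc_eq)
  have mono: "indicator {- real M..real M} y * v y \<le> indicator {- real N..real N} y * v y" if "M \<le> N" for M N :: nat and y :: real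
    using that v0[of y] by (auto simp: indicator_def)
  have "incseq X"
    unfolding incseq_def X_def by (intro allI impI integral_mono Ni mono)
  then obtain Y where Y: "X \<longlonglongrightarrow> Y" using incseq_convergent[of X "4 * J * R * f B"] Xb by blast
  show ?thesis
  proof (rule integrable_monotone_convergence[OF Ni])
    show "AE y in lborel. mono (\<lambda>N. indicator {- real N..real N} y * v y)"
      using mono by (intro AE_I2 monoI) auto
    show "AE y in lborel. (\<lambda>N. indicator {- real N..real N} y * v y) \<longlonglongrightarrow> v y"
    proof (rule AE_I2)
      fix y :: real
      obtain M :: nat where M: "\<bar>y\<bar> < real M" using reals_Archimedean2 by blast
      have "eventually (\<lambda>N. indicator {- real N..real N} y * v y = v y) sequentially"
        using eventually_ge_at_top[of M]
      proof eventually_elim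
        case (elim N)
        then have "\<bar>y\<bar> \<le> real N" using M by linarith
        then show ?case by (simp add: abs_le_iff minus_le_iff)
      qed
      then show "(\<lambda>N. indicator {- real N..real N} y * v y) \<longlonglongrightarrow> v y" by (rule tendsto_eventually)
    qed
    show "(\<lambda>N. LINT y|lborel. indicator {- real N..real N} y * v y) \<longlonglongrightarrow> Y"
      using Y unfolding X_def .
  qed (use vm in simp)
qed

end

section \<open>Existence and symmetry assembled\<close>

lemma prod_list_pos: "(\<And>a. a \<in> set as \<Longrightarrow> 0 < h a) \<Longrightarrow> 0 < (\<Prod>a\<leftarrow>as. h a :: real)"
  by (induction as) auto

lemma exists_positive_solution:
  assumes as: "as \<noteq> []" "\<forall>a\<in>set as. a \<noteq> 0" and nl: "nonlinearity f f' p"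
  shows "\<exists>\<phi>. positive_solution as f \<phi>"
proof -
  obtain A where "sym_kernel (kern as) A" using sym_kernel_kern[OF as] by blast
  then interpret kernel_nonlinearity "kern as" A f f' p
    using nl by (simp add: kernel_nonlinearity_def)
  have prod_pos: "(\<Prod>a\<leftarrow>as. a\<^sup>2) > 0" using as(2) by (intro prod_list_pos) auto
  have J: "(LINT y|lborel. kern as y) = 1 / (\<Prod>a\<leftarrow>as. a\<^sup>2)"
    using conv_kern_const[OF as, of 1 0] by (simp add: conv_const)
  have S: "\<exists>l>0. \<exists>S \<kappa>'. 0 < \<kappa>' \<and> \<kappa>' < \<kappa> \<and> bdd_meas S \<and> integrable lborel S \<and>
      (\<forall>t. S (- t) = - S t) \<and> (\<forall>t. 0 < t \<longrightarrow> t < l \<longrightarrow> S t > 0) \<and> (\<forall>t. t \<ge> l \<longrightarrow> S t = 0) \<and>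
      (\<forall>t. t > 0 \<longrightarrow> S t \<le> \<kappa>' * conv (kern as) S t)"
    if "\<kappa> * (LINT y|lborel. kern as y) > 1" for \<kappa>
  proof -
    \<comment> \<open>Here \<open>\<kappa>\<close> exceeds the symbol at frequency 0. The product
      with \<open>19 / l\<^sup>2\<close> is the symbol at \<open>sqrt 19 / l\<close>, which drops
      below \<open>\<kappa>\<close> when \<open>l\<close> is large.\<close>
    have "(\<Prod>a\<leftarrow>as. a\<^sup>2) < \<kappa>" using that prod_pos by (simp add: J field_simps)
    then obtain l where l: "l > 0" "(\<Prod>a\<leftarrow>as. a\<^sup>2 + 19 / l\<^sup>2) < \<kappa>" by (rule prod_perturb)
    have P: "(\<Prod>a\<leftarrow>as. a\<^sup>2 + 19 / l\<^sup>2) > 0" using l(1) by (intro prod_list_pos) (auto intro!: add_nonneg_pos)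
    have "odd_hat (- t / l) = - odd_hat (t / l)" for t using odd_hat_odd(1)[of "t / l"] by simp
    moreover have "odd_hat (t / l) > 0" if "0 < t" "t < l" for t using odd_hat_pos[of "t / l"] that by simp
    moreover have "odd_hat (t / l) = 0" if "t \<ge> l" for t using odd_hat_zero(1)[of "t / l"] that l(1) by simp
    ultimately show ?thesis
      using l P bdd_meas_odd_hat[OF l(1)] kern_odd_hat[OF as l(1)]
      by (intro exI[of _ l] conjI exI[of _ "\<lambda>t. odd_hat (t / l)"] exI[of _ "\<Prod>a\<leftarrow>as. a\<^sup>2 + 19 / l\<^sup>2"]) auto
  qed
  obtain v B where v: "\<And>x. v x = conv (kern as) (\<lambda>y. f (v y)) x" "sym_decr v" "v 0 > 0" "v 0 \<le> B"
    "continuous_on UNIV v" "(v \<longlongrightarrow> 0) at_top"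
    by (rule entire_solution[OF S]) blast+
  have v0: "0 \<le> v x" and vB: "v x \<le> B" for x
    using v(2,4) sym_decr_le_0[OF v(2), of x] by (auto simp: sym_decr_def)
  have vm: "v \<in> borel_measurable borel" using v(5) by (rule borel_measurable_continuous_onI)
  let ?g = "\<lambda>y. f (v y)"
  have gb: "bdd_meas ?g" by (rule bdd_meas_comp[OF vm v0 vB])
  have vi: "integrable lborel v" by (rule solution_integrable[OF v(1,2,4,5,6)])
  obtain M where M: "M > 0" "\<And>r. 0 \<le> r \<Longrightarrow> r \<le> B \<Longrightarrow> f' r \<le> M" using f'_bounded by blast
  have gi: "integrable lborel ?g"
  proof (rule Bochner_Integration.integrable_bound)
    show "integrable lborel (\<lambda>y. M * v y)" using vi by simp
    show "?g \<in> borel_measurable lborel" using bdd_meas_measurable[OF gb] by simp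
    show "AE y in lborel. norm (?g y) \<le> norm (M * v y)"
    proof (rule AE_I2)
      fix y
      have "f (v y) \<le> M * v y" by (rule f_le_linear[OF M(2) v0]) (use vB order_trans in blast)+
      then show "norm (?g y) \<le> norm (M * v y)" using f_nonneg[OF v0] M(1) v0[of y] by simp
    qed
  qed
  have vK: "v = conv (kern as) ?g" using v(1) by blast
  have vpos: "v x > 0" for x
  proof -
    obtain e where e: "0 < e" "\<And>y. \<bar>y - 0\<bar> < e \<Longrightarrow> v y > 0" using continuous_pos_nbhd[OF v(5,3)] by blast
    have "conv (kern as) ?g x > 0"
      by (rule conv_pos[OF gb f_nonneg[OF v0], of 0 e]) (use e f_pos in auto)
    then show ?thesis using v(1)[of x] by simp
  qed
  have "sobolev_H (length as) v" using sobolev_conv_kern(1)[OF as gi gb] vK by simp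
  moreover have "(LINT x|lborel. v x * L_op as \<psi> x) = (LINT x|lborel. f (v x) * \<psi> x)" if "test_fun \<psi>" for \<psi>
    using sobolev_conv_kern(2)[OF as gi gb that] by (simp add: v(1)[symmetric])
  ultimately show ?thesis using v(5) vpos by (auto simp: positive_solution_def)
qed

text \<open>Since \<open>as\<close> is nonempty, a first weak derivative exists and
  \<open>\<phi>\<close> is bounded; only then is \<open>f(\<phi>)\<close> bounded and the integral
  equation available. The equation gives the exponential lower bound, which together with square
  integrability forces the decay that moving planes needs to start.\<close>

lemma positive_solution_symmetric:
  assumes as: "as \<noteq> []" "\<forall>a\<in>set as. a \<noteq> 0" and nl: "nonlinearity f f' p"
    and sol: "positive_solution as f \<phi>"
  shows "\<exists>c. \<forall>x. \<phi> (2 * c - x) = \<phi> x"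
proof -
  obtain A where A: "sym_kernel (kern as) A" using sym_kernel_kern[OF as] by blast
  interpret sym_kernel "kern as" A by (rule A)
  interpret nonlinearity f f' p by (rule nl)
  have c: "continuous_on UNIV \<phi>" and pos': "\<And>x. \<phi> x > 0" and H: "sobolev_H (length as) \<phi>"
    and weak: "\<And>\<psi>. test_fun \<psi> \<Longrightarrow> (LINT x|lborel. \<phi> x * L_op as \<psi> x) = (LINT x|lborel. f (\<phi> x) * \<psi> x)"
    using sol by (auto simp: positive_solution_def)
  have "1 \<in> {1..length as}" using as(1) by (cases as) auto
  then obtain g where g: "L2_fun g" "weak_deriv 1 \<phi> g" and L2: "L2_fun \<phi>"
    using H unfolding sobolev_H_def by blast
  obtain B where B: "\<And>x. \<phi> x \<le> B" using H1_bounded[OF c L2 g] by blast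
  have gb: "bdd_meas (\<lambda>y. f (\<phi> y))"
    by (rule bdd_meas_comp[OF borel_measurable_continuous_onI[OF c] less_imp_le[OF pos'] B])
  have fnn: "0 \<le> f (\<phi> y)" for y using f_nonneg less_imp_le[OF pos'] by blast
  have eq: "\<phi> = conv (kern as) (\<lambda>y. f (\<phi> y))"
  proof (rule weak_solution_eq_conv[OF as c _ gb fnn weak])
    show "\<bar>\<phi> x\<bar> \<le> B" for x using B[of x] pos'[of x] by simp
  qed
  have harn: "exp (- A * \<bar>t\<bar>) * \<phi> x \<le> \<phi> (x + t)" for x t
    using conv_harnack[OF gb fnn, of t x] unfolding eq[symmetric] .
  have vanish: "\<exists>R>0. \<forall>x. \<bar>x\<bar> \<ge> R \<longrightarrow> \<phi> x < \<rho>" if "\<rho> > 0" for \<rho>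
    using harnack_L2_vanishes[OF A_pos less_imp_le[OF pos'] harn _ that] L2 by (auto simp: L2_fun_def)
  have "moving_planes (kern as) A f f' p \<phi> B"
  proof (intro moving_planes.intro A nl moving_planes_axioms.intro)
    show "\<phi> x = conv (kern as) (\<lambda>y. f (\<phi> y)) x" for x by (rule fun_cong[OF eq])
  qed (use pos' B c vanish in auto)
  then show ?thesis by (rule moving_planes.symmetric)
qed

theorem theorem3p8:
  fixes as :: "real list" and f :: "real \<Rightarrow> real" and p q1 q2 C :: real
  assumes m_pos: "length as \<ge> 1"
    and a_nz: "\<forall>a\<in>set as. a \<noteq> 0"
    and f_C2: "C2_fun f"
    and F1: "f 0 = 0" "\<forall>r>0. f r > 0"
    and F2: "p > 1" "\<forall>r. r\<^sup>2 * deriv f r \<ge> p * r * f r"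
    and F3: "2 \<le> q1" "q1 \<le> q2" "C > 0"
            "\<forall>r. \<bar>deriv f r\<bar> \<le> C * (\<bar>r\<bar> powr (q1 - 1) + \<bar>r\<bar> powr (q2 - 1))"
  shows "(\<exists>\<phi>. positive_solution as f \<phi>) \<and>
         (\<forall>\<phi>. positive_solution as f \<phi> \<longrightarrow> (\<exists>c. \<forall>x. \<phi> (2 * c - x) = \<phi> x))"
proof -
  have ne: "as \<noteq> []" using m_pos by auto
  have "nonlinearity f (deriv f) p"
  proof
    show "(f has_real_derivative deriv f x) (at x)" for x using f_C2 by (simp add: C2_fun_def)
    have "\<And>x. (deriv f has_real_derivative deriv (deriv f) x) (at x)" using f_C2 by (simp add: C2_fun_def)
    then show "continuous_on UNIV (deriv f)" by (meson DERIV_continuous continuous_at_imp_continuous_on)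
    \<comment> \<open>At \<open>r = 0\<close> both powers in the growth bound are 0.\<close>
    show "deriv f 0 = 0" using F3(4)[rule_format, of 0] by simp
  qed (use F1 F2 in auto)
  then show ?thesis
    using exists_positive_solution[OF ne a_nz] positive_solution_symmetric[OF ne a_nz] by blast
qed

end
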